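(* Let $D\subset\mathbb{R}^d$ be a bounded open set and let $\Psi:[0,+\infty]\to[0,+\infty]$ satisfy: (i) $\Psi$ is strictly decreasing; (ii) there exists $p>1$ such that the function $s\mapsto\Psi^{-1}(s^p)$ is convex. Let $$\mathcal{V}=\Big\{V:D\to[0,+\infty]\ :\ V\text{ Lebesgue measurable},\ \int_D\Psi(V)\,dx\le1\Big\},$$ and assume that $\mathcal{V}$ is nonempty, that is $|D|\,\Psi(+\infty)\le 1$. Then, for every $f,g\in L^2(D)$ with $g\ge0$, the optimization problem $$\min\Big\{\int_D g(x)u(x)\,dx\ :\ -\Delta u+Vu=f,\ u\in H^1_0(D),\ V\in\mathcal{V}\Big\}$$ has a solution; that is, there exists $V_{opt}\in\mathcal{V}$ such that $$\int_D g\,R_{V_{opt}}(f)\,dx\le\int_D g\,R_V(f)\,dx\qquad\text{for all }V\in\mathcal{V},$$ where $R_V(f)$ denotes the solution $u$ of the state equation $-\Delta u+Vu=f$.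
   Context: $|D|$ denotes the Lebesgue measure of $D$. In (ii), $\Psi^{-1}$ is the inverse of $\Psi$ on its range, and convexity is meant for the function $s\mapsto\Psi^{-1}(s^p)$ on its domain of definition, which is an interval in $[0,+\infty]$. Examples are $\Psi(s)=s^{-q}$ with $q>0$ and $\Psi(s)=e^{-\alpha s}$ with $\alpha>0$. The state equation $-\Delta u+Vu=f$ with $V:D\to[0,+\infty]$ measurable (possibly taking the value $+\infty$) is understood in the weak sense: $u\in H^1_0(D)\cap L^2(V\,dx)$, i.e. $u\in H^1_0(D)$ with $\int_D u^2V\,dx<+\infty$ (convention $0\cdot\infty=0$), and $$\int_D\nabla u\cdot\nabla\phi\,dx+\int_D V u\phi\,dx=\int_D f\phi\,dx\qquad\forall\phi\in H^1_0(D)\cap L^2(V\,dx).$$ This problem has a unique solution, denoted $R_V(f)$. *)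

theory Defs
  imports "HOL-Analysis.Analysis"
begin

text \<open>
  Elements of \<open>L\<^sup>2(D)\<close>, \<open>H\<^sup>1(D)\<close>, \<dots> are represented by functions on the whole space of which
  only the values on \<open>D\<close> (up to null sets) matter.
\<close>

definition L2_on :: "(real^'n) set \<Rightarrow> (real^'n \<Rightarrow> 'b::euclidean_space) \<Rightarrow> bool" where
  "L2_on D f \<longleftrightarrow> f \<in> borel_measurable (lebesgue_on D) \<and>
     integrable (lebesgue_on D) (\<lambda>x. (norm (f x))\<^sup>2)"


subsection \<open>Test functions and the Sobolev space \<open>H\<^sup>1\<^sub>0(D)\<close>\<close>

definition partial_deriv :: "'n \<Rightarrow> (real^'n \<Rightarrow> real) \<Rightarrow> real^'n \<Rightarrow> real" where
  "partial_deriv i \<phi> = (\<lambda>x. frechet_derivative \<phi> (at x) (axis i 1))"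

definition grad :: "(real^'n \<Rightarrow> real) \<Rightarrow> real^'n \<Rightarrow> real^'n" where
  "grad \<phi> = (\<lambda>x. \<chi> i. partial_deriv i \<phi> x)"

text \<open>
  \<open>C\<^sup>\<infinity>\<close>: all iterated partial derivatives exist and are (Frechet) differentiable everywhere;
  in particular they are all continuous.
\<close>

definition smooth :: "(real^'n \<Rightarrow> real) \<Rightarrow> bool" where
  "smooth \<phi> \<longleftrightarrow> (\<forall>is x. fold partial_deriv is \<phi> differentiable (at x))"

definition test_function :: "(real^'n) set \<Rightarrow> (real^'n \<Rightarrow> real) \<Rightarrow> bool" where
  "test_function D \<phi> \<longleftrightarrow>
     smooth \<phi> \<and> compact (closure {x. \<phi> x \<noteq> 0}) \<and> closure {x. \<phi> x \<noteq> 0} \<subseteq> D"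

text \<open>\<open>u \<in> H\<^sup>1(D)\<close> with distributional gradient \<open>G\<close> (determined by \<open>u\<close> up to null sets).\<close>

definition H1_gradient :: "(real^'n) set \<Rightarrow> (real^'n \<Rightarrow> real) \<Rightarrow> (real^'n \<Rightarrow> real^'n) \<Rightarrow> bool" where
  "H1_gradient D u G \<longleftrightarrow> L2_on D u \<and> L2_on D G \<and>
     (\<forall>\<phi> i. test_function D \<phi> \<longrightarrow>
        (\<integral>x. u x * partial_deriv i \<phi> x \<partial>lebesgue_on D) = - (\<integral>x. G x $ i * \<phi> x \<partial>lebesgue_on D))"

text \<open>\<open>H\<^sup>1\<^sub>0(D)\<close> is the closure of the test functions in the norm of \<open>H\<^sup>1(D)\<close>.\<close>

definition H10 :: "(real^'n) set \<Rightarrow> (real^'n \<Rightarrow> real) set" where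
  "H10 D = {u. \<exists>G \<phi>. H1_gradient D u G \<and> (\<forall>n::nat. test_function D (\<phi> n)) \<and>
     (\<lambda>n. \<integral>x. (\<phi> n x - u x)\<^sup>2 + (norm (grad (\<phi> n) x - G x))\<^sup>2 \<partial>lebesgue_on D) \<longlonglongrightarrow> 0}"


subsection \<open>The state equation\<close>

text \<open>\<open>H\<^sup>1\<^sub>0(D) \<inter> L\<^sup>2(V dx)\<close>; note \<open>\<infinity> * 0 = 0\<close> in \<^typ>\<open>ennreal\<close>.\<close>

definition energy_space :: "(real^'n) set \<Rightarrow> (real^'n \<Rightarrow> ennreal) \<Rightarrow> (real^'n \<Rightarrow> real) set" where
  "energy_space D V = {u \<in> H10 D. (\<integral>\<^sup>+x. V x * ennreal ((u x)\<^sup>2) \<partial>lebesgue_on D) < \<infinity>}"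

text \<open>
  Functions in \<^const>\<open>energy_space\<close> vanish almost everywhere on \<open>{V = \<infinity>}\<close>. Since
  \<open>enn2real \<infinity> = 0\<close>, the integrand \<open>enn2real (V x) * u x * \<phi> x\<close> below therefore agrees almost
  everywhere with \<open>V u \<phi>\<close> under the convention \<open>0 * \<infinity> = 0\<close>.
\<close>

definition weak_solution ::
    "(real^'n) set \<Rightarrow> (real^'n \<Rightarrow> ennreal) \<Rightarrow> (real^'n \<Rightarrow> real) \<Rightarrow> (real^'n \<Rightarrow> real) \<Rightarrow> bool" where
  "weak_solution D V f u \<longleftrightarrow> u \<in> energy_space D V \<and>
     (\<exists>U. H1_gradient D u U \<and>
       (\<forall>\<phi> \<Phi>. \<phi> \<in> energy_space D V \<and> H1_gradient D \<phi> \<Phi> \<longrightarrow>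
          (\<integral>x. U x \<bullet> \<Phi> x \<partial>lebesgue_on D) + (\<integral>x. enn2real (V x) * u x * \<phi> x \<partial>lebesgue_on D)
            = (\<integral>x. f x * \<phi> x \<partial>lebesgue_on D)))"

text \<open>
  The solution \<open>R\<^sub>V(f)\<close>; it is unique only up to null sets in \<open>D\<close>, so a representative is chosen.
\<close>

definition resolvent ::
    "(real^'n) set \<Rightarrow> (real^'n \<Rightarrow> ennreal) \<Rightarrow> (real^'n \<Rightarrow> real) \<Rightarrow> real^'n \<Rightarrow> real" where
  "resolvent D V f = (SOME u. weak_solution D V f u)"


subsection \<open>Admissible potentials\<close>

definition admissible :: "(real^'n) set \<Rightarrow> (ennreal \<Rightarrow> ennreal) \<Rightarrow> (real^'n \<Rightarrow> ennreal) set" where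
  "admissible D \<Psi> = {V \<in> borel_measurable (lebesgue_on D). (\<integral>\<^sup>+x. \<Psi> (V x) \<partial>lebesgue_on D) \<le> 1}"

definition ennreal_powr :: "ennreal \<Rightarrow> real \<Rightarrow> ennreal" where
  "ennreal_powr s p = (if s = \<infinity> then \<infinity> else ennreal (enn2real s powr p))"

text \<open>Convexity of an extended-valued function on an interval \<open>I \<subseteq> [0,\<infinity>]\<close>.\<close>

definition ennreal_convex_on :: "ennreal set \<Rightarrow> (ennreal \<Rightarrow> ennreal) \<Rightarrow> bool" where
  "ennreal_convex_on I F \<longleftrightarrow>
     (\<forall>s\<in>I. \<forall>t\<in>I. {s..t} \<subseteq> I) \<and>
     (\<forall>s\<in>I. \<forall>t\<in>I. \<forall>\<theta>::real. 0 < \<theta> \<and> \<theta> < 1 \<longrightarrow>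
        F (ennreal (1 - \<theta>) * s + ennreal \<theta> * t) \<le> ennreal (1 - \<theta>) * F s + ennreal \<theta> * F t)"

end

(*
  Let u_k = R_{V_k}(f) be a minimizing sequence with u_k -> u strongly in L^2 (Rellich). Since Psi is convex and
  lower semicontinuous (convexity of s |-> Psi^{-1}(s^p) for some p > 1 is stronger), suitable convex combinations
  of tails of (grad u_k, V_k) converge, the gradients in L^2 and the potentials almost everywhere, to
  (grad u, V_0) with int Psi(V_0) <= 1. The optimal potential is V_0 on {u < 0} and infinity elsewhere, which is
  admissible because Psi is decreasing.

  Testing the equation of u_k with phi * theta_m(u_k), where phi >= 0 is bounded and theta_m is a decreasing
  smooth approximation of the indicator of {t < 0}, the term with theta_m' has a favourable sign. Hence in the limit
  z = min(u, 0) is a supersolution for the optimal potential, so the optimal state lies below z <= u by comparison.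
  As g >= 0, its cost is at most the infimum.
*)
theory Submission
  imports Defs "HOL-Library.Diagonal_Subsequence"
begin

section \<open>Square integrable functions\<close>

text \<open>Weak compactness is bypassed throughout. On a decreasing family of midpoint-closed sets
  of pairs (vector field, potential), almost minimisers of a uniformly convex functional converge
  strongly. Potentials enter it through 1/(1+V), which is bounded, convex with a quantitative gap,
  and tolerates the value \<infinity>. The same argument, with the potential held fixed, solves the
  state equation. The obstacle is the product V_k u_k: the potentials converge only after averaging,
  and each comes with its own state. The tested inequality is affine in (grad u_k, V_k) once its
  coefficients stop depending on k. In the gradient term u_k is replaced by its strong limit; in the
  potential term the weight is replaced by its infimum over the tail of the sequence, which only
  preserves an upper bound on the potential term. So a single inequality survives, and it points in
  the useful direction only where the state is negative; elsewhere the infinite potential forces the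
  new state to 0. That the domain of s |-> Psi^{-1}(s^p) is an interval matters on its own: it
  excludes jumps of \<Psi> and is the source of lower semicontinuity.\<close>

definition l2 :: "(real^'n) set \<Rightarrow> (real^'n \<Rightarrow> 'b::euclidean_space) \<Rightarrow> real" where
  "l2 D f = sqrt (\<integral>x. (norm (f x))\<^sup>2 \<partial>lebesgue_on D)"

lemma L2_on_measurable [measurable_dest]: "L2_on D f \<Longrightarrow> f \<in> borel_measurable (lebesgue_on D)"
  by (simp add: L2_on_def)

lemma L2_on_integrable: "L2_on D f \<Longrightarrow> integrable (lebesgue_on D) (\<lambda>x. (norm (f x))\<^sup>2)"
  by (simp add: L2_on_def)

lemma l2_nonneg [simp]: "0 \<le> l2 D f"
  by (simp add: l2_def)

lemma l2_square: "(l2 D f)\<^sup>2 = (\<integral>x. (norm (f x))\<^sup>2 \<partial>lebesgue_on D)"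
  by (simp add: l2_def)

lemma L2_on_bound:
  assumes "L2_on D f" "g \<in> borel_measurable (lebesgue_on D)"
    and "AE x in lebesgue_on D. norm (g x) \<le> c * norm (f x)"
  shows "L2_on D g"
  unfolding L2_on_def
proof
  show "integrable (lebesgue_on D) (\<lambda>x. (norm (g x))\<^sup>2)"
  proof (rule Bochner_Integration.integrable_bound)
    show "integrable (lebesgue_on D) (\<lambda>x. c\<^sup>2 * (norm (f x))\<^sup>2)"
      using L2_on_integrable[OF assms(1)] by simp
    show "(\<lambda>x. (norm (g x))\<^sup>2) \<in> borel_measurable (lebesgue_on D)"
      using assms(2) by measurable
    show "AE x in lebesgue_on D. norm ((norm (g x))\<^sup>2) \<le> norm (c\<^sup>2 * (norm (f x))\<^sup>2)"
      using assms(3)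
    proof eventually_elim
      case (elim x)
      then have "(norm (g x))\<^sup>2 \<le> (c * norm (f x))\<^sup>2"
        by (intro power_mono) auto
      then show ?case by (simp add: power_mult_distrib)
    qed
  qed
qed fact

lemma L2_on_scaleR: "L2_on D f \<Longrightarrow> L2_on D (\<lambda>x. c *\<^sub>R f x)"
  by (rule L2_on_bound[of D f _ "\<bar>c\<bar>"]) auto

lemma L2_on_add:
  assumes f: "L2_on D f" and g: "L2_on D g" shows "L2_on D (\<lambda>x. f x + g x)"
  unfolding L2_on_def
proof
  show m: "(\<lambda>x. f x + g x) \<in> borel_measurable (lebesgue_on D)"
    using assms by measurable
  show "integrable (lebesgue_on D) (\<lambda>x. (norm (f x + g x))\<^sup>2)"
  proof (rule Bochner_Integration.integrable_bound)
    show "integrable (lebesgue_on D) (\<lambda>x. 2 * (norm (f x))\<^sup>2 + 2 * (norm (g x))\<^sup>2)"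
      using L2_on_integrable[OF f] L2_on_integrable[OF g] by simp
    show "(\<lambda>x. (norm (f x + g x))\<^sup>2) \<in> borel_measurable (lebesgue_on D)"
      using m by measurable
    have "(norm (a + b))\<^sup>2 \<le> 2 * (norm a)\<^sup>2 + 2 * (norm b)\<^sup>2" for a b :: 'b
    proof -
      have "(norm (a + b))\<^sup>2 \<le> (norm a + norm b)\<^sup>2"
        by (intro power_mono norm_triangle_ineq) auto
      also have "\<dots> \<le> 2 * (norm a)\<^sup>2 + 2 * (norm b)\<^sup>2"
        using sum_squares_bound[of "norm a" "norm b"] by (simp add: power2_sum)
      finally show ?thesis .
    qed
    then show "AE x in lebesgue_on D. norm ((norm (f x + g x))\<^sup>2)
        \<le> norm (2 * (norm (f x))\<^sup>2 + 2 * (norm (g x))\<^sup>2)"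
      by (intro AE_I2) simp
  qed
qed

lemma L2_on_minus: "L2_on D f \<Longrightarrow> L2_on D (\<lambda>x. - f x)"
  by (drule L2_on_scaleR[of D f "-1"]) simp

lemma L2_on_diff: "L2_on D f \<Longrightarrow> L2_on D g \<Longrightarrow> L2_on D (\<lambda>x. f x - g x)"
  by (drule (1) L2_on_add[OF _ L2_on_minus]) simp

lemma L2_on_zero [simp]: "L2_on D (\<lambda>x. 0)"
  by (simp add: L2_on_def)

lemma L2_on_mult_bounded:
  fixes h :: "real^'n \<Rightarrow> real"
  assumes "L2_on D f" "h \<in> borel_measurable (lebesgue_on D)" "\<And>x. \<bar>h x\<bar> \<le> c"
  shows "L2_on D (\<lambda>x. h x *\<^sub>R f x)"
proof (rule L2_on_bound[OF assms(1), of _ c])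
  show "(\<lambda>x. h x *\<^sub>R f x) \<in> borel_measurable (lebesgue_on D)"
    using assms(1,2) by measurable
  show "AE x in lebesgue_on D. norm (h x *\<^sub>R f x) \<le> c * norm (f x)"
    using assms(3) by (intro AE_I2) (simp add: mult_right_mono)
qed

lemma L2_on_inner_integrable:
  assumes f: "L2_on D f" and g: "L2_on D g" shows "integrable (lebesgue_on D) (\<lambda>x. f x \<bullet> g x)"
proof (rule Bochner_Integration.integrable_bound)
  show "integrable (lebesgue_on D) (\<lambda>x. (norm (f x))\<^sup>2 + (norm (g x))\<^sup>2)"
    using L2_on_integrable[OF f] L2_on_integrable[OF g] by simp
  show "(\<lambda>x. f x \<bullet> g x) \<in> borel_measurable (lebesgue_on D)"
    using assms by measurable
  have "\<bar>a \<bullet> b\<bar> \<le> (norm a)\<^sup>2 + (norm b)\<^sup>2" for a b :: 'b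
    using Cauchy_Schwarz_ineq2[of a b] sum_squares_bound[of "norm a" "norm b"]
      zero_le_power2[of "norm a"] zero_le_power2[of "norm b"] mult_nonneg_nonneg[of "norm a" "norm b"]
    by simp
  then show "AE x in lebesgue_on D. norm (f x \<bullet> g x) \<le> norm ((norm (f x))\<^sup>2 + (norm (g x))\<^sup>2)"
    by (intro AE_I2) simp
qed

lemma L2_on_mult_integrable:
  fixes f g :: "real^'n \<Rightarrow> real"
  assumes "L2_on D f" "L2_on D g" shows "integrable (lebesgue_on D) (\<lambda>x. f x * g x)"
  using L2_on_inner_integrable[OF assms] by simp

lemma L2_on_norm: "L2_on D f \<Longrightarrow> L2_on D (\<lambda>x. norm (f x))"
  by (rule L2_on_bound[of D f _ 1]) auto

lemma l2_norm: "l2 D (\<lambda>x. norm (f x)) = l2 D f"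
  by (simp add: l2_def)

lemma l2_eq_0_iff:
  assumes "L2_on D f" shows "l2 D f = 0 \<longleftrightarrow> (AE x in lebesgue_on D. f x = 0)"
  using integral_nonneg_eq_0_iff_AE[OF L2_on_integrable[OF assms]] by (simp add: l2_def)

lemma l2_zero [simp]: "l2 D (\<lambda>x. 0) = 0"
  by (simp add: l2_def)

lemma l2_scaleR: "l2 D (\<lambda>x. c *\<^sub>R f x) = \<bar>c\<bar> * l2 D f"
  by (simp add: l2_def power_mult_distrib real_sqrt_mult)

lemma l2_commute: "l2 D (\<lambda>x. f x - g x) = l2 D (\<lambda>x. g x - f x)"
  by (simp add: l2_def norm_minus_commute)

lemma norm_add_square: "(norm (a + b))\<^sup>2 = (norm a)\<^sup>2 + 2 * (a \<bullet> b) + (norm b)\<^sup>2"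
  for a b :: "'a::real_inner"
  using dot_norm[of a b] by simp

text \<open>The squared norm of \<open>t f + g\<close> is a nonnegative quadratic in
  \<open>t\<close>; its value at the minimiser \<open>- c / a\<close>, with \<open>a\<close> the
  squared norm of \<open>f\<close>, is the claim. If that norm is 0 there is no minimiser, but then
  \<open>f\<close> vanishes almost everywhere and so does the inner product.\<close>

lemma l2_Cauchy_Schwarz:
  assumes f: "L2_on D f" and g: "L2_on D g"
  shows "\<bar>\<integral>x. f x \<bullet> g x \<partial>lebesgue_on D\<bar> \<le> l2 D f * l2 D g"
proof -
  define c where "c = (\<integral>x. f x \<bullet> g x \<partial>lebesgue_on D)"
  note int = L2_on_inner_integrable[OF f g] L2_on_integrable[OF f] L2_on_integrable[OF g]
  have quad: "0 \<le> t\<^sup>2 * (l2 D f)\<^sup>2 + 2 * t * c + (l2 D g)\<^sup>2" for t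
  proof -
    have "0 \<le> (\<integral>x. (norm (t *\<^sub>R f x + g x))\<^sup>2 \<partial>lebesgue_on D)" by simp
    also have "\<dots> = (\<integral>x. t\<^sup>2 * (norm (f x))\<^sup>2 + 2 * t * (f x \<bullet> g x) + (norm (g x))\<^sup>2 \<partial>lebesgue_on D)"
      by (rule Bochner_Integration.integral_cong)
        (simp_all add: norm_add_square power_mult_distrib)
    also have "\<dots> = t\<^sup>2 * (l2 D f)\<^sup>2 + 2 * t * c + (l2 D g)\<^sup>2"
      using int by (simp add: l2_square c_def)
    finally show ?thesis .
  qed
  have "\<bar>c\<bar> \<le> l2 D f * l2 D g"
  proof (cases "l2 D f = 0")
    case True
    then have "AE x in lebesgue_on D. f x = 0"
      using l2_eq_0_iff[OF f] by simp
    then have "c = (\<integral>x. 0 \<partial>lebesgue_on D)"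
      unfolding c_def using f g by (intro integral_cong_AE) auto
    then show ?thesis by simp
  next
    case False
    define a where "a = (l2 D f)\<^sup>2"
    have "a > 0" using False by (simp add: a_def)
    have "0 \<le> (- c / a)\<^sup>2 * a + 2 * (- c / a) * c + (l2 D g)\<^sup>2"
      using quad[of "- c / a"] by (simp add: a_def)
    then have "c\<^sup>2 / a \<le> (l2 D g)\<^sup>2"
      using \<open>a > 0\<close> by (simp add: power2_eq_square field_simps)
    then have "c\<^sup>2 \<le> (l2 D f * l2 D g)\<^sup>2"
      using \<open>a > 0\<close> by (simp add: field_simps a_def power_mult_distrib)
    then show ?thesis
      by (simp add: abs_le_square_iff[symmetric])
  qed
  then show ?thesis by (simp add: c_def)
qed

lemma l2_Cauchy_Schwarz_real:
  fixes f g :: "real^'n \<Rightarrow> real"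
  assumes "L2_on D f" "L2_on D g"
  shows "\<bar>\<integral>x. f x * g x \<partial>lebesgue_on D\<bar> \<le> l2 D f * l2 D g"
  using l2_Cauchy_Schwarz[OF assms] by simp

lemma l2_triangle:
  assumes f: "L2_on D f" and g: "L2_on D g"
  shows "l2 D (\<lambda>x. f x + g x) \<le> l2 D f + l2 D g"
proof -
  note int = L2_on_inner_integrable[OF f g] L2_on_integrable[OF f] L2_on_integrable[OF g]
  have "(l2 D (\<lambda>x. f x + g x))\<^sup>2
      = (\<integral>x. (norm (f x))\<^sup>2 + 2 * (f x \<bullet> g x) + (norm (g x))\<^sup>2 \<partial>lebesgue_on D)"
    unfolding l2_square by (rule Bochner_Integration.integral_cong)
        (simp_all add: norm_add_square power_mult_distrib)
  also have "\<dots> = (l2 D f)\<^sup>2 + 2 * (\<integral>x. f x \<bullet> g x \<partial>lebesgue_on D) + (l2 D g)\<^sup>2"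
    using int by (simp add: l2_square)
  also have "\<dots> \<le> (l2 D f + l2 D g)\<^sup>2"
    using l2_Cauchy_Schwarz[OF f g] by (simp add: power2_sum)
  finally show ?thesis by (simp add: power2_le_iff_abs_le)
qed

lemma l2_triangle3:
  assumes f: "L2_on D f" and g: "L2_on D g" and h: "L2_on D h"
  shows "l2 D (\<lambda>x. f x - h x) \<le> l2 D (\<lambda>x. f x - g x) + l2 D (\<lambda>x. g x - h x)"
  using l2_triangle[OF L2_on_diff[OF f g] L2_on_diff[OF g h]] by simp

lemma l2_le_diff:
  assumes f: "L2_on D f" and g: "L2_on D g"
  shows "l2 D f \<le> l2 D g + l2 D (\<lambda>x. f x - g x)"
  using l2_triangle[OF g L2_on_diff[OF f g]] by simp

lemma l2_mono:
  assumes "L2_on D f" "g \<in> borel_measurable (lebesgue_on D)"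
    and "AE x in lebesgue_on D. norm (g x) \<le> norm (f x)"
  shows "l2 D g \<le> l2 D f"
proof -
  have "L2_on D g" using L2_on_bound[OF assms(1,2), of 1] assms(3) by simp
  then show ?thesis unfolding l2_def using assms
    by (intro real_sqrt_le_mono integral_mono_AE L2_on_integrable) (auto intro: power_mono)
qed

text \<open>With \<open>F'\<close> and \<open>G'\<close> the two errors, the difference of the inner
  products is \<open>F' G' + F' g + f G'\<close>, and Cauchy-Schwarz bounds each of the three
  terms.\<close>

lemma tendsto_inner_L2:
  assumes f: "\<And>n. L2_on D (F n)" "L2_on D f" "(\<lambda>n. l2 D (\<lambda>x. F n x - f x)) \<longlonglongrightarrow> 0"
    and g: "\<And>n. L2_on D (G n)" "L2_on D g" "(\<lambda>n. l2 D (\<lambda>x. G n x - g x)) \<longlonglongrightarrow> 0"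
  shows "(\<lambda>n. \<integral>x. F n x \<bullet> G n x \<partial>lebesgue_on D) \<longlonglongrightarrow> (\<integral>x. f x \<bullet> g x \<partial>lebesgue_on D)"
proof (rule LIM_zero_cancel, rule Lim_null_comparison, rule always_eventually, rule allI)
  fix n
  let ?I = "\<lambda>h. \<integral>x. h x \<partial>lebesgue_on D"
  define F' G' where "F' = (\<lambda>x. F n x - f x)" and "G' = (\<lambda>x. G n x - g x)"
  have L: "L2_on D F'" "L2_on D G'" using f g by (auto simp: F'_def G'_def intro: L2_on_diff)
  note i = L2_on_inner_integrable
  have "?I (\<lambda>x. F n x \<bullet> G n x) - ?I (\<lambda>x. f x \<bullet> g x)
      = ?I (\<lambda>x. F' x \<bullet> G' x) + ?I (\<lambda>x. F' x \<bullet> g x) + ?I (\<lambda>x. f x \<bullet> G' x)"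
    using i[OF L] i[OF L(1) g(2)] i[OF f(2) L(2)] i[OF f(1) g(1), of n n] i[OF f(2) g(2)]
    by (simp flip: Bochner_Integration.integral_add Bochner_Integration.integral_diff)
       (simp add: F'_def G'_def algebra_simps)
  then have "\<bar>?I (\<lambda>x. F n x \<bullet> G n x) - ?I (\<lambda>x. f x \<bullet> g x)\<bar> \<le> l2 D F' * l2 D G' + l2 D F' * l2 D g + l2 D f * l2 D G'"
    using l2_Cauchy_Schwarz[OF L] l2_Cauchy_Schwarz[OF L(1) g(2)] l2_Cauchy_Schwarz[OF f(2) L(2)] by linarith
  then show "norm (?I (\<lambda>x. F n x \<bullet> G n x) - ?I (\<lambda>x. f x \<bullet> g x))
      \<le> l2 D (\<lambda>x. F n x - f x) * l2 D (\<lambda>x. G n x - g x) + l2 D (\<lambda>x. F n x - f x) * l2 D g + l2 D f * l2 D (\<lambda>x. G n x - g x)"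
    by (simp add: F'_def G'_def)
next
  have "(\<lambda>n. l2 D (\<lambda>x. F n x - f x) * l2 D (\<lambda>x. G n x - g x) + l2 D (\<lambda>x. F n x - f x) * l2 D g + l2 D f * l2 D (\<lambda>x. G n x - g x))
     \<longlonglongrightarrow> 0 * 0 + 0 * l2 D g + l2 D f * 0"
    by (intro tendsto_intros f g)
  then show "(\<lambda>n. l2 D (\<lambda>x. F n x - f x) * l2 D (\<lambda>x. G n x - g x) + l2 D (\<lambda>x. F n x - f x) * l2 D g + l2 D f * l2 D (\<lambda>x. G n x - g x))
     \<longlonglongrightarrow> 0" by simp
qed

lemma tendsto_inner_L2_left:
  assumes f: "\<And>n. L2_on D (F n)" "L2_on D f" "(\<lambda>n. l2 D (\<lambda>x. F n x - f x)) \<longlonglongrightarrow> 0"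
    and g: "L2_on D g"
  shows "(\<lambda>n. \<integral>x. F n x \<bullet> g x \<partial>lebesgue_on D) \<longlonglongrightarrow> (\<integral>x. f x \<bullet> g x \<partial>lebesgue_on D)"
  using tendsto_inner_L2[OF f g g] by simp

lemma tendsto_l2:
  assumes f: "\<And>n. L2_on D (F n)" "L2_on D f" "(\<lambda>n. l2 D (\<lambda>x. F n x - f x)) \<longlonglongrightarrow> 0"
  shows "(\<lambda>n. l2 D (F n)) \<longlonglongrightarrow> l2 D f"
  unfolding l2_def using tendsto_inner_L2[OF f f] by (auto intro: tendsto_real_sqrt simp: power2_norm_eq_inner)

lemma l2_tendsto_dominated:
  assumes "L2_on D h" "\<And>n. F n \<in> borel_measurable (lebesgue_on D)"
    and "\<And>n. AE x in lebesgue_on D. norm (F n x) \<le> norm (h x)"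
    and "AE x in lebesgue_on D. (\<lambda>n. F n x) \<longlonglongrightarrow> 0"
  shows "(\<lambda>n. l2 D (F n)) \<longlonglongrightarrow> 0"
proof -
  have "(\<lambda>n. \<integral>x. (norm (F n x))\<^sup>2 \<partial>lebesgue_on D) \<longlonglongrightarrow> (\<integral>x. 0 \<partial>lebesgue_on D)"
  proof (rule integral_dominated_convergence)
    show "integrable (lebesgue_on D) (\<lambda>x. (norm (h x))\<^sup>2)" by (rule L2_on_integrable[OF assms(1)])
    show "AE x in lebesgue_on D. norm ((norm (F i x))\<^sup>2) \<le> (norm (h x))\<^sup>2" for i
      using assms(3)[of i] by eventually_elim (auto intro: power_mono)
    show "AE x in lebesgue_on D. (\<lambda>i. (norm (F i x))\<^sup>2) \<longlonglongrightarrow> 0"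
      using assms(4) by eventually_elim (auto intro!: tendsto_eq_intros)
    show "(\<lambda>x. (norm (F i x))\<^sup>2) \<in> borel_measurable (lebesgue_on D)" for i
      using assms(2)[of i] by measurable
  qed simp
  then show ?thesis unfolding l2_def using tendsto_real_sqrt by fastforce
qed

section \<open>Square integrable functions on a bounded open set: almost everywhere subsequences and
  completeness\<close>

locale bounded_open =
  fixes D :: "(real^'n) set"
  assumes open_D: "open D" and bounded_D: "bounded D"
begin

lemma lmeasurable_D [simp]: "D \<in> lmeasurable"
  using open_D bounded_D by (simp add: lmeasurable_open)

lemma sets_D [simp, measurable]: "D \<in> sets lebesgue"
  using lmeasurable_D by (rule fmeasurableD)

sublocale finite_measure "lebesgue_on D"
  by (rule finite_measure_lebesgue_on) simp

lemma L2_on_const [simp]: "L2_on D (\<lambda>x. c)"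
  by (simp add: L2_on_def)

lemma L2_on_bounded: "f \<in> borel_measurable (lebesgue_on D) \<Longrightarrow> (\<And>x. norm (f x) \<le> c) \<Longrightarrow> L2_on D f"
  by (rule L2_on_bound[of D "\<lambda>_. 1::real" _ c]) auto

lemma L2_on_integrable1:
  assumes "L2_on D f" shows "integrable (lebesgue_on D) f"
proof -
  have "integrable (lebesgue_on D) (\<lambda>x. norm (f x) * 1)"
    by (intro L2_on_mult_integrable L2_on_norm assms L2_on_const)
  then show ?thesis
    using L2_on_measurable[OF assms] by (simp add: integrable_norm_iff)
qed

text \<open>Cauchy-Schwarz against the constant 1, which is square integrable because
  \<open>D\<close> has finite measure. This turns convergence in L2 into convergence in L1, from
  which almost everywhere convergent subsequences are extracted.\<close>

lemma integral_norm_le_l2: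
  assumes "L2_on D f"
  shows "(\<integral>x. norm (f x) \<partial>lebesgue_on D) \<le> l2 D f * l2 D (\<lambda>_. 1::real)"
  using l2_Cauchy_Schwarz_real[OF L2_on_norm[OF assms] L2_on_const[of 1]]
  by (simp add: l2_norm)

lemma L2_tendsto_AE_subseq:
  assumes f: "\<And>n. L2_on D (F n)" "L2_on D f" "(\<lambda>n. l2 D (\<lambda>x. F n x - f x)) \<longlonglongrightarrow> 0"
  obtains r :: "nat \<Rightarrow> nat" where "strict_mono r" "AE x in lebesgue_on D. (\<lambda>n. F (r n) x) \<longlonglongrightarrow> f x"
proof -
  have "(\<lambda>n. \<integral>x. norm (F n x - f x) \<partial>lebesgue_on D) \<longlonglongrightarrow> 0"
  proof (rule Lim_null_comparison, rule always_eventually, rule allI)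
    show "norm (\<integral>x. norm (F n x - f x) \<partial>lebesgue_on D) \<le> l2 D (\<lambda>x. F n x - f x) * l2 D (\<lambda>_. 1::real)" for n
      using integral_norm_le_l2[OF L2_on_diff[OF f(1) f(2)]] by simp
    show "(\<lambda>n. l2 D (\<lambda>x. F n x - f x) * l2 D (\<lambda>_. 1::real)) \<longlonglongrightarrow> 0"
      using tendsto_mult_left_zero[OF f(3)] .
  qed
  then obtain r where "strict_mono r" "AE x in lebesgue_on D. (\<lambda>n. F (r n) x - f x) \<longlonglongrightarrow> 0"
    using tendsto_L1_AE_subseq[of "lebesgue_on D" "\<lambda>n x. F n x - f x"] L2_on_integrable1[OF L2_on_diff[OF f(1) f(2)]] by auto
  then show ?thesis using that[of r] by (simp add: LIM_zero_iff)
qed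

text \<open>A Cauchy sequence in L2 is Cauchy in L1, so a subsequence converges almost everywhere to
  some \<open>f\<close>. Fatou's lemma along that subsequence bounds the distance from
  \<open>F n\<close> to \<open>f\<close> by the Cauchy bound, which gives membership of
  \<open>f\<close> and convergence at once.\<close>

lemma L2_complete:
  fixes F :: "nat \<Rightarrow> real^'n \<Rightarrow> 'b::euclidean_space"
  assumes L: "\<And>n. L2_on D (F n)"
    and C: "\<And>e. e > 0 \<Longrightarrow> \<exists>N. \<forall>m\<ge>N. \<forall>n\<ge>N. l2 D (\<lambda>x. F m x - F n x) < e"
  obtains f where "L2_on D f" "(\<lambda>n. l2 D (\<lambda>x. F n x - f x)) \<longlonglongrightarrow> 0"
proof -
  let ?c = "l2 D (\<lambda>_. 1::real)"
  have "\<exists>N. \<forall>i\<ge>N. \<forall>j\<ge>N. (\<integral>x. norm (F i x - F j x) \<partial>lebesgue_on D) < e" if "e > 0" for e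
  proof -
    have "?c + 1 > 0" using l2_nonneg[of D "\<lambda>_. 1::real"] by linarith
    then obtain N where N: "\<forall>m\<ge>N. \<forall>n\<ge>N. l2 D (\<lambda>x. F m x - F n x) < e / (?c + 1)"
      using C[of "e / (?c + 1)"] \<open>e > 0\<close> by auto
    have "(\<integral>x. norm (F i x - F j x) \<partial>lebesgue_on D) < e" if "i \<ge> N" "j \<ge> N" for i j
    proof -
      have "(\<integral>x. norm (F i x - F j x) \<partial>lebesgue_on D) \<le> l2 D (\<lambda>x. F i x - F j x) * ?c"
        by (rule integral_norm_le_l2[OF L2_on_diff[OF L L]])
      also have "\<dots> \<le> l2 D (\<lambda>x. F i x - F j x) * (?c + 1)"
        by (intro mult_left_mono) auto
      also have "\<dots> < e"
        using N that \<open>?c + 1 > 0\<close> by (simp add: pos_less_divide_eq)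
      finally show ?thesis .
    qed
    then show ?thesis by blast
  qed
  then obtain r where r: "strict_mono r" "AE x in lebesgue_on D. Cauchy (\<lambda>i. F (r i) x)"
    by (rule cauchy_L1_AE_cauchy_subseq[of "lebesgue_on D" F, OF L2_on_integrable1[OF L]])
  \<comment> \<open>On the null set where the subsequence diverges the value of \<open>lim\<close>
    is unspecified; the function is measurable nevertheless.\<close>
  define f where "f = (\<lambda>x. lim (\<lambda>i. F (r i) x))"
  have f_meas[measurable]: "f \<in> borel_measurable (lebesgue_on D)"
    unfolding f_def using L by (intro borel_measurable_lim_metric) simp
  have conv: "AE x in lebesgue_on D. (\<lambda>i. F (r i) x) \<longlonglongrightarrow> f x"
    using r(2) by eventually_elim (auto simp: f_def Cauchy_convergent_iff convergent_LIMSEQ_iff)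
  have key: "L2_on D (\<lambda>x. F n x - f x) \<and> l2 D (\<lambda>x. F n x - f x) \<le> e"
    if e: "e > 0" and N: "\<And>m. m \<ge> N \<Longrightarrow> l2 D (\<lambda>x. F n x - F m x) < e" for n e N
  proof -
    have "(\<integral>\<^sup>+x. ennreal ((norm (F n x - f x))\<^sup>2) \<partial>lebesgue_on D)
       = (\<integral>\<^sup>+x. liminf (\<lambda>i. ennreal ((norm (F n x - F (r i) x))\<^sup>2)) \<partial>lebesgue_on D)"
      using conv
      by (intro nn_integral_cong_AE, eventually_elim)
        (intro lim_imp_Liminf[symmetric] tendsto_intros, auto)
    also have "\<dots> \<le> liminf (\<lambda>i. \<integral>\<^sup>+x. ennreal ((norm (F n x - F (r i) x))\<^sup>2) \<partial>lebesgue_on D)"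
      using L by (intro nn_integral_liminf) simp
    also have "\<dots> \<le> ennreal (e\<^sup>2)"
    proof (rule Liminf_le)
      show "eventually (\<lambda>i. (\<integral>\<^sup>+x. ennreal ((norm (F n x - F (r i) x))\<^sup>2) \<partial>lebesgue_on D) \<le> ennreal (e\<^sup>2)) sequentially"
      proof (rule eventually_sequentiallyI)
        fix i assume "N \<le> i"
        then have "N \<le> r i" using seq_suble[OF r(1), of i] by simp
        then have "(l2 D (\<lambda>x. F n x - F (r i) x))\<^sup>2 \<le> e\<^sup>2"
          using N[of "r i"] by (intro power_mono) auto
        moreover have "(\<integral>\<^sup>+x. ennreal ((norm (F n x - F (r i) x))\<^sup>2) \<partial>lebesgue_on D)
            = ennreal ((l2 D (\<lambda>x. F n x - F (r i) x))\<^sup>2)"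
          unfolding l2_square
          by (intro nn_integral_eq_integral L2_on_integrable L2_on_diff L) auto
        ultimately show "(\<integral>\<^sup>+x. ennreal ((norm (F n x - F (r i) x))\<^sup>2) \<partial>lebesgue_on D) \<le> ennreal (e\<^sup>2)"
          by (simp add: ennreal_leI)
      qed
    qed simp
    finally have le: "(\<integral>\<^sup>+x. ennreal ((norm (F n x - f x))\<^sup>2) \<partial>lebesgue_on D) \<le> ennreal (e\<^sup>2)" .
    have L2: "L2_on D (\<lambda>x. F n x - f x)"
      unfolding L2_on_def
    proof
      show m: "(\<lambda>x. F n x - f x) \<in> borel_measurable (lebesgue_on D)" using L[of n] by measurable
      show "integrable (lebesgue_on D) (\<lambda>x. (norm (F n x - f x))\<^sup>2)"
      proof (rule integrableI_bounded)
        show "(\<lambda>x. (norm (F n x - f x))\<^sup>2) \<in> borel_measurable (lebesgue_on D)" using m by measurable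
        show "(\<integral>\<^sup>+x. ennreal (norm ((norm (F n x - f x))\<^sup>2)) \<partial>lebesgue_on D) < \<infinity>"
          using le by (auto intro: le_less_trans)
      qed
    qed
    have "ennreal ((l2 D (\<lambda>x. F n x - f x))\<^sup>2) \<le> ennreal (e\<^sup>2)"
      using le unfolding l2_square
      by (subst nn_integral_eq_integral[symmetric]) (auto intro: L2_on_integrable[OF L2])
    then have "(l2 D (\<lambda>x. F n x - f x))\<^sup>2 \<le> e\<^sup>2" by simp
    then have "l2 D (\<lambda>x. F n x - f x) \<le> e"
      using e by (auto simp: power2_le_iff_abs_le)
    with L2 show ?thesis by simp
  qed
  obtain N0 where "\<forall>m\<ge>N0. \<forall>n\<ge>N0. l2 D (\<lambda>x. F m x - F n x) < 1" using C[of 1] by auto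
  then have "L2_on D (\<lambda>x. F N0 x - f x)" using key[of 1 N0 N0] by auto
  then have "L2_on D (\<lambda>x. F N0 x - (F N0 x - f x))" by (rule L2_on_diff[OF L])
  then have "L2_on D f" by simp
  moreover have "(\<lambda>n. l2 D (\<lambda>x. F n x - f x)) \<longlonglongrightarrow> 0"
  proof (rule LIMSEQ_I)
    fix e :: real assume "e > 0"
    then obtain N where N: "\<forall>m\<ge>N. \<forall>n\<ge>N. l2 D (\<lambda>x. F m x - F n x) < e / 2" using C[of "e / 2"] by auto
    have "l2 D (\<lambda>x. F n x - f x) \<le> e / 2" if "n \<ge> N" for n
      using key[of "e / 2" N n] N that \<open>e > 0\<close> by auto
    then show "\<exists>N. \<forall>n\<ge>N. norm (l2 D (\<lambda>x. F n x - f x) - 0) < e"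
      using \<open>e > 0\<close> by (intro exI[of _ N]) fastforce
  qed
  ultimately show ?thesis by (rule that)
qed

end

section \<open>Test functions\<close>

lemma smooth_differentiable: "smooth \<phi> \<Longrightarrow> \<phi> differentiable (at x)"
  unfolding smooth_def by (metis fold_simps(1))

lemma smooth_partial_deriv: "smooth \<phi> \<Longrightarrow> smooth (partial_deriv i \<phi>)"
  unfolding smooth_def by (metis fold_simps(2))

lemma partial_deriv_eqI: "(\<phi> has_derivative \<phi>') (at x) \<Longrightarrow> partial_deriv i \<phi> x = \<phi>' (axis i 1)"
  by (simp add: partial_deriv_def frechet_derivative_at[symmetric])

lemma has_derivative_frechet:
  "\<phi> differentiable (at x) \<Longrightarrow> (\<phi> has_derivative frechet_derivative \<phi> (at x)) (at x)"
  by (simp add: frechet_derivative_works[symmetric])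

lemma partial_deriv_add:
  assumes "\<phi> differentiable (at x)" "\<psi> differentiable (at x)"
  shows "partial_deriv i (\<lambda>x. \<phi> x + \<psi> x) x = partial_deriv i \<phi> x + partial_deriv i \<psi> x"
  by (rule trans[OF partial_deriv_eqI[OF has_derivative_add[OF has_derivative_frechet[OF assms(1)] has_derivative_frechet[OF assms(2)]]]])
     (simp add: partial_deriv_def)

lemma partial_deriv_mult:
  assumes "\<phi> differentiable (at x)" "\<psi> differentiable (at x)"
  shows "partial_deriv i (\<lambda>x. \<phi> x * \<psi> x) x = \<phi> x * partial_deriv i \<psi> x + partial_deriv i \<phi> x * \<psi> x"
  by (rule trans[OF partial_deriv_eqI[OF has_derivative_mult[OF has_derivative_frechet[OF assms(1)] has_derivative_frechet[OF assms(2)]]]])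
     (simp add: partial_deriv_def)

lemma partial_deriv_const [simp]: "partial_deriv i (\<lambda>_. c) = (\<lambda>_. 0)"
  by (rule ext, rule trans[OF partial_deriv_eqI[OF has_derivative_const]]) simp

lemma partial_deriv_compose:
  assumes "(p has_real_derivative p') (at (\<phi> x))" "\<phi> differentiable (at x)"
  shows "partial_deriv i (\<lambda>x. p (\<phi> x)) x = p' * partial_deriv i \<phi> x"
proof -
  have "((\<lambda>x. p (\<phi> x)) has_derivative (\<lambda>h. p' * frechet_derivative \<phi> (at x) h)) (at x)"
    using has_derivative_compose[OF has_derivative_frechet[OF assms(2)] assms(1)[unfolded has_field_derivative_def]] .
  from partial_deriv_eqI[OF this] show ?thesis by (simp add: partial_deriv_def)
qed

text \<open>The subalgebra generated by the smooth functions is closed under partial derivatives,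
  hence consists of smooth functions.\<close>

inductive smooth_generated :: "(real^'n \<Rightarrow> real) \<Rightarrow> bool" where
  base: "smooth \<phi> \<Longrightarrow> smooth_generated \<phi>"
| const: "smooth_generated (\<lambda>_. c)"
| add: "smooth_generated \<phi> \<Longrightarrow> smooth_generated \<psi> \<Longrightarrow> smooth_generated (\<lambda>x. \<phi> x + \<psi> x)"
| mult: "smooth_generated \<phi> \<Longrightarrow> smooth_generated \<psi> \<Longrightarrow> smooth_generated (\<lambda>x. \<phi> x * \<psi> x)"

lemma smooth_generated_differentiable: "smooth_generated \<phi> \<Longrightarrow> \<phi> differentiable (at x)"
  by (induction rule: smooth_generated.induct) (auto simp: smooth_differentiable)

lemma smooth_generated_partial_deriv: "smooth_generated \<phi> \<Longrightarrow> smooth_generated (partial_deriv i \<phi>)"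
proof (induction rule: smooth_generated.induct)
  case (add \<phi> \<psi>)
  have "partial_deriv i (\<lambda>x. \<phi> x + \<psi> x) = (\<lambda>x. partial_deriv i \<phi> x + partial_deriv i \<psi> x)"
    by (rule ext, rule partial_deriv_add) (use add.hyps smooth_generated_differentiable in auto)
  then show ?case using add.IH by (simp add: smooth_generated.add)
next
  case (mult \<phi> \<psi>)
  have "partial_deriv i (\<lambda>x. \<phi> x * \<psi> x) = (\<lambda>x. \<phi> x * partial_deriv i \<psi> x + partial_deriv i \<phi> x * \<psi> x)"
    by (rule ext, rule partial_deriv_mult) (use mult.hyps smooth_generated_differentiable in auto)
  then show ?case using mult by (auto intro!: smooth_generated.add smooth_generated.mult)
qed (auto intro: smooth_generated.intros smooth_partial_deriv)

lemma smooth_generated_smooth: "smooth_generated \<phi> \<Longrightarrow> smooth \<phi>"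
proof -
  have "smooth_generated \<phi> \<Longrightarrow> smooth_generated (fold partial_deriv is \<phi>)" for "is" and \<phi> :: "real^'n \<Rightarrow> real"
    by (induction "is" arbitrary: \<phi>) (auto intro: smooth_generated_partial_deriv)
  then show "smooth_generated \<phi> \<Longrightarrow> smooth \<phi>"
    unfolding smooth_def by (blast intro: smooth_generated_differentiable)
qed

lemma smooth_const: "smooth (\<lambda>_. c)"
  and smooth_add: "smooth \<phi> \<Longrightarrow> smooth \<psi> \<Longrightarrow> smooth (\<lambda>x. \<phi> x + \<psi> x)"
  and smooth_mult: "smooth \<phi> \<Longrightarrow> smooth \<psi> \<Longrightarrow> smooth (\<lambda>x. \<phi> x * \<psi> x)"
  by (blast intro: smooth_generated_smooth smooth_generated.intros)+

text \<open>Closure under sums and products yields polynomial outer functions. Other C1 outer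
  functions are reached by polynomial approximation, at the price of leaving the smooth functions
  for \<open>sobolev0\<close>.\<close>

lemma smooth_polynomial:
  fixes p :: "real \<Rightarrow> real"
  assumes "real_polynomial_function p" "smooth \<phi>"
  shows "smooth (\<lambda>x. p (\<phi> x))"
  using assms(1)
proof (induction rule: real_polynomial_function.induct)
  case (linear p)
  have "p t = p 1 * t" for t
    using linear_scale[OF bounded_linear.linear[OF linear], of t 1] by simp
  then have "(\<lambda>x. p (\<phi> x)) = (\<lambda>x. p 1 * \<phi> x)" by (intro ext)
  then show ?case using smooth_mult[OF smooth_const assms(2)] by simp
qed (auto intro: smooth_const smooth_add smooth_mult)

lemma test_function_smooth: "test_function D \<phi> \<Longrightarrow> smooth \<phi>"
  by (simp add: test_function_def)

lemma test_functionI: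
  assumes "smooth \<psi>" "compact K" "K \<subseteq> D" "\<And>x. x \<notin> K \<Longrightarrow> \<psi> x = 0"
  shows "test_function D \<psi>"
proof -
  have "closure {x. \<psi> x \<noteq> 0} \<subseteq> K"
    using assms by (intro closure_minimal compact_imp_closed) auto
  then show ?thesis
    using assms(1,3) bounded_subset[OF compact_imp_bounded[OF assms(2)]] closure_subset
    unfolding test_function_def compact_closure by blast
qed

text \<open>The complement of the support is open and \<phi> is 0 on it, so the derivative vanishes
  there too: one compact set serves \<phi> and all its partial derivatives.\<close>

lemma test_function_support:
  assumes "test_function D \<phi>"
  obtains K where "compact K" "K \<subseteq> D" "\<And>x. x \<notin> K \<Longrightarrow> \<phi> x = 0" "\<And>x i. x \<notin> K \<Longrightarrow> partial_deriv i \<phi> x = 0"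
proof -
  define K where "K = closure {x. \<phi> x \<noteq> 0}"
  have K: "compact K" "K \<subseteq> D" using assms by (auto simp: test_function_def K_def)
  have z: "\<phi> x = 0" if "x \<notin> K" for x
    using that closure_subset[of "{x. \<phi> x \<noteq> 0}"] unfolding K_def by blast
  have "partial_deriv i \<phi> x = 0" if "x \<notin> K" for x i
  proof -
    have "(\<phi> has_derivative (\<lambda>_. 0)) (at x)"
    proof (rule has_derivative_transform_within_open)
      show "((\<lambda>_. 0::real) has_derivative (\<lambda>_. 0)) (at x)" by simp
      show "open (- K)" using K(1) by (simp add: compact_imp_closed open_Compl)
      show "x \<in> - K" using that by simp
      show "0 = \<phi> y" if "y \<in> - K" for y using z[of y] that by simp
    qed
    then show ?thesis by (rule partial_deriv_eqI)
  qed
  with K z show ?thesis by (intro that)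
qed

lemma test_function_support0:
  assumes "test_function D \<phi>"
  obtains K where "compact K" "K \<subseteq> D" "\<And>x. x \<notin> K \<Longrightarrow> \<phi> x = 0"
  by (rule test_function_support[OF assms]) (rule that)

lemma test_function_partial_deriv:
  assumes "test_function D \<phi>" shows "test_function D (partial_deriv i \<phi>)"
proof -
  obtain K where "compact K" "K \<subseteq> D" "\<And>x. x \<notin> K \<Longrightarrow> \<phi> x = 0"
    "\<And>x i. x \<notin> K \<Longrightarrow> partial_deriv i \<phi> x = 0"
    by (rule test_function_support[OF assms]) (rule that)
  then show ?thesis
    by (intro test_functionI[of _ K] smooth_partial_deriv test_function_smooth[OF assms])
qed

lemma test_function_add:
  assumes "test_function D \<phi>" "test_function D \<psi>" shows "test_function D (\<lambda>x. \<phi> x + \<psi> x)"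
proof -
  obtain K where "compact K" "K \<subseteq> D" "\<And>x. x \<notin> K \<Longrightarrow> \<phi> x = 0"
    by (rule test_function_support0[OF assms(1)]) (rule that)
  moreover obtain L where "compact L" "L \<subseteq> D" "\<And>x. x \<notin> L \<Longrightarrow> \<psi> x = 0"
    by (rule test_function_support0[OF assms(2)]) (rule that)
  ultimately have K: "compact (K \<union> L)" "K \<union> L \<subseteq> D" "\<And>x. x \<notin> K \<union> L \<Longrightarrow> \<phi> x + \<psi> x = 0" by auto
  show ?thesis
    by (rule test_functionI[OF smooth_add[OF assms[THEN test_function_smooth]] K])
qed

lemma test_function_mult:
  assumes "smooth \<phi>" "test_function D \<psi>" shows "test_function D (\<lambda>x. \<phi> x * \<psi> x)"
proof -
  obtain K where "compact K" "K \<subseteq> D" "\<And>x. x \<notin> K \<Longrightarrow> \<psi> x = 0"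
    by (rule test_function_support0[OF assms(2)]) (rule that)
  then show ?thesis
    by (intro test_functionI[of _ K] smooth_mult assms test_function_smooth[OF assms(2)]) auto
qed

lemma test_function_scale: "test_function D \<psi> \<Longrightarrow> test_function D (\<lambda>x. c * \<psi> x)"
  by (rule test_function_mult[OF smooth_const])

lemma test_function_zero: "test_function D (\<lambda>_. 0)"
  by (rule test_functionI[OF smooth_const, of "{}"]) auto

text \<open>\<open>p 0 = 0\<close> makes the composition vanish wherever \<phi> does, hence keeps
  the support compact in \<open>D\<close>.\<close>

lemma test_function_polynomial:
  assumes "real_polynomial_function p" "p 0 = 0" "test_function D \<phi>"
  shows "test_function D (\<lambda>x. p (\<phi> x))"
proof -
  obtain K where K: "compact K" "K \<subseteq> D" "\<And>x. x \<notin> K \<Longrightarrow> \<phi> x = 0"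
    by (rule test_function_support0[OF assms(3)]) (rule that)
  have "p (\<phi> x) = 0" if "x \<notin> K" for x
    using K(3)[OF that] assms(2) by simp
  then show ?thesis
    by (rule test_functionI[OF smooth_polynomial[OF assms(1) test_function_smooth[OF assms(3)]] K(1,2)])
qed

lemma smooth_continuous: "smooth \<phi> \<Longrightarrow> continuous_on A \<phi>"
  by (auto intro!: continuous_at_imp_continuous_on differentiable_imp_continuous_within smooth_differentiable)

lemma grad_continuous: "smooth \<phi> \<Longrightarrow> continuous_on A (grad \<phi>)"
  unfolding grad_def by (intro continuous_on_vec_lambda smooth_continuous smooth_partial_deriv)

lemma grad_nth [simp]: "grad \<phi> x $ i = partial_deriv i \<phi> x"
  by (simp add: grad_def)

lemma grad_add:
  "smooth \<phi> \<Longrightarrow> smooth \<psi> \<Longrightarrow> grad (\<lambda>x. \<phi> x + \<psi> x) x = grad \<phi> x + grad \<psi> x"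
  by (simp add: vec_eq_iff partial_deriv_add smooth_differentiable)

lemma grad_mult:
  "smooth \<phi> \<Longrightarrow> smooth \<psi> \<Longrightarrow> grad (\<lambda>x. \<phi> x * \<psi> x) x = \<phi> x *\<^sub>R grad \<psi> x + \<psi> x *\<^sub>R grad \<phi> x"
  by (simp add: vec_eq_iff partial_deriv_mult smooth_differentiable)

lemma grad_scale: "smooth \<psi> \<Longrightarrow> grad (\<lambda>x. c * \<psi> x) x = c *\<^sub>R grad \<psi> x"
  by (simp add: vec_eq_iff partial_deriv_mult smooth_differentiable)

lemma grad_compose:
  "(p has_real_derivative p') (at (\<phi> x)) \<Longrightarrow> smooth \<phi> \<Longrightarrow> grad (\<lambda>x. p (\<phi> x)) x = p' *\<^sub>R grad \<phi> x"
  by (simp add: vec_eq_iff partial_deriv_compose smooth_differentiable)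

lemma has_derivative_grad:
  assumes "smooth \<phi>" shows "(\<phi> has_derivative (\<lambda>h. grad \<phi> x \<bullet> h)) (at x)"
proof -
  have d: "(\<phi> has_derivative frechet_derivative \<phi> (at x)) (at x)"
    by (rule has_derivative_frechet[OF smooth_differentiable[OF assms]])
  then have lin: "linear (frechet_derivative \<phi> (at x))" by (rule has_derivative_linear)
  have "frechet_derivative \<phi> (at x) h = grad \<phi> x \<bullet> h" for h
  proof -
    have "h = (\<Sum>i\<in>UNIV. h $ i *\<^sub>R axis i 1)"
      using basis_expansion[of h] by (simp add: scalar_mult_eq_scaleR)
    then have "frechet_derivative \<phi> (at x) h = frechet_derivative \<phi> (at x) (\<Sum>i\<in>UNIV. h $ i *\<^sub>R axis i 1)"
      by simp
    also have "\<dots> = (\<Sum>i\<in>UNIV. h $ i * partial_deriv i \<phi> x)"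
      by (simp add: linear_sum[OF lin] linear_scale[OF lin] partial_deriv_def)
    also have "\<dots> = grad \<phi> x \<bullet> h" by (simp add: inner_vec_def mult.commute)
    finally show ?thesis .
  qed
  then show ?thesis using d by presburger
qed

lemma test_function_grad_support:
  assumes "test_function D \<phi>"
  obtains K where "compact K" "K \<subseteq> D" "\<And>x. x \<notin> K \<Longrightarrow> \<phi> x = 0" "\<And>x. x \<notin> K \<Longrightarrow> grad \<phi> x = 0"
  by (rule test_function_support[OF assms]) (rule that, auto simp: grad_def vec_eq_iff)

section \<open>Integrals over the whole space: translations and the Poincare inequality\<close>

lemma compact_support_bounded:
  fixes f :: "'a::topological_space \<Rightarrow> 'b::real_normed_vector"
  assumes "continuous_on UNIV f" "compact K" "\<And>x. x \<notin> K \<Longrightarrow> f x = 0"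
  obtains B where "B \<ge> 0" "\<And>x. norm (f x) \<le> B"
proof -
  have "bounded (f ` K)"
    using assms by (intro compact_imp_bounded compact_continuous_image) (auto intro: continuous_on_subset)
  then obtain B where "\<And>x. x \<in> K \<Longrightarrow> norm (f x) \<le> B" by (auto simp: bounded_iff)
  then have "norm (f x) \<le> max B 0" for x using assms(3)[of x] by (cases "x \<in> K") (auto simp: le_max_iff_disj)
  then show ?thesis using that[of "max B 0"] by auto
qed

lemma integrable_compact_support:
  fixes f :: "'a::euclidean_space \<Rightarrow> 'b::euclidean_space"
  assumes "continuous_on UNIV f" "compact K" "\<And>x. x \<notin> K \<Longrightarrow> f x = 0"
  shows "integrable lborel f"
proof -
  have "integrable lborel (\<lambda>x. indicator K x *\<^sub>R f x)"
    using assms by (intro borel_integrable_compact) (auto intro: continuous_on_subset)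
  also have "(\<lambda>x. indicator K x *\<^sub>R f x) = f"
    using assms(3) by (auto simp: indicator_def fun_eq_iff)
  finally show ?thesis .
qed

lemma integral_lborel_translation:
  fixes f :: "'a::euclidean_space \<Rightarrow> 'b::euclidean_space"
  assumes [measurable]: "f \<in> borel_measurable borel"
  shows "(\<integral>x. f (x + c) \<partial>lborel) = (\<integral>x. f x \<partial>lborel)"
proof -
  have "(\<integral>x. f x \<partial>lborel) = (\<integral>x. f x \<partial>distr lborel borel ((+) c))" by (simp add: lborel_distr_plus)
  also have "\<dots> = (\<integral>x. f (c + x) \<partial>lborel)" by (rule integral_distr) auto
  finally show ?thesis by (simp add: add.commute)
qed

lemma integrable_lborel_translation:
  fixes f :: "'a::euclidean_space \<Rightarrow> 'b::euclidean_space"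
  assumes "integrable lborel f" shows "integrable lborel (\<lambda>x. f (x + c))"
  using integrable_distr[of "(+) c" lborel borel f] assms
  by (simp add: lborel_distr_plus add.commute)

lemma nn_integral_lborel_translation:
  fixes f :: "'a::euclidean_space \<Rightarrow> ennreal"
  assumes [measurable]: "f \<in> borel_measurable borel"
  shows "(\<integral>\<^sup>+x. f (x + c) \<partial>lborel) = (\<integral>\<^sup>+x. f x \<partial>lborel)"
proof -
  have "(\<integral>\<^sup>+x. f x \<partial>lborel) = (\<integral>\<^sup>+x. f x \<partial>distr lborel borel ((+) c))" by (simp add: lborel_distr_plus)
  also have "\<dots> = (\<integral>\<^sup>+x. f (c + x) \<partial>lborel)" by (rule nn_integral_distr) auto
  finally show ?thesis by (simp add: add.commute)
qed

text \<open>Every difference quotient of \<eta> has integral 0 by translation invariance of Lebesgue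
  measure, and the quotients converge dominatedly to the partial derivative, since \<eta> is
  Lipschitz with compact support.\<close>

lemma integral_partial_deriv_eq_0:
  fixes D :: "(real^'n) set"
  assumes "test_function D \<eta>"
  shows "(\<integral>x. partial_deriv i \<eta> x \<partial>lborel) = 0"
proof -
  note sm = test_function_smooth[OF assms]
  obtain K where K: "compact K" "\<And>x. x \<notin> K \<Longrightarrow> \<eta> x = 0" "\<And>x. x \<notin> K \<Longrightarrow> grad \<eta> x = 0"
    by (rule test_function_grad_support[OF assms]) (rule that)
  obtain B where B: "B \<ge> 0" "\<And>x. norm (grad \<eta> x) \<le> B"
    by (rule compact_support_bounded[OF grad_continuous[OF sm] K(1,3)]) (assumption, rule that)
  have lip: "\<bar>\<eta> y - \<eta> x\<bar> \<le> B * norm (y - x)" for x y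
  proof -
    have "norm (\<eta> y - \<eta> x) \<le> B * norm (y - x)"
    proof (rule differentiable_bound[of UNIV])
      show "(\<eta> has_derivative (\<lambda>h. grad \<eta> x \<bullet> h)) (at x within UNIV)" for x
        using has_derivative_grad[OF sm] by simp
      show "onorm (\<lambda>h. grad \<eta> x \<bullet> h) \<le> B" for x
        by (rule onorm_le) (use order_trans[OF Cauchy_Schwarz_ineq2 mult_right_mono[OF B(2) norm_ge_zero]] in simp)
    qed auto
    then show ?thesis by simp
  qed
  have meas[measurable]: "\<eta> \<in> borel_measurable borel" "partial_deriv i \<eta> \<in> borel_measurable borel"
    by (auto intro!: borel_measurable_continuous_onI smooth_continuous sm smooth_partial_deriv)
  have int: "integrable lborel \<eta>"
    by (rule integrable_compact_support[OF smooth_continuous[OF sm] K(1,2)])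
  obtain R where R: "\<And>x. x \<in> K \<Longrightarrow> norm x \<le> R"
    using compact_imp_bounded[OF K(1)] by (auto simp: bounded_iff)
  \<comment> \<open>All steps are at most 1, so the quotients vanish outside the ball of radius
    \<open>R + 1\<close> around 0, where \<open>R\<close> bounds the support; the Lipschitz constant
    times the indicator of that ball dominates them.\<close>
  define h where "h n = inverse (real (Suc n))" for n
  have h: "0 < h n" "h n \<le> 1" for n by (auto simp: h_def field_simps)
  have h0: "h \<longlonglongrightarrow> 0" unfolding h_def by (rule LIMSEQ_inverse_real_of_nat)
  let ?q = "\<lambda>n x. (\<eta> (x + h n *\<^sub>R axis i 1) - \<eta> x) / h n"
  have "(\<lambda>n. \<integral>x. ?q n x \<partial>lborel) \<longlonglongrightarrow> (\<integral>x. partial_deriv i \<eta> x \<partial>lborel)"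
  proof (rule integral_dominated_convergence[where w = "\<lambda>x. B * indicator (cball 0 (R + 1)) x"])
    show "integrable lborel (\<lambda>x. B * indicator (cball (0::real^'n) (R + 1)) x)"
      using emeasure_bounded_finite[OF bounded_cball, of "0::real^'n" "R + 1"]
      by (intro integrable_mult_right integrable_real_indicator) auto
    show "AE x in lborel. (\<lambda>n. ?q n x) \<longlonglongrightarrow> partial_deriv i \<eta> x"
    proof (rule AE_I2)
      fix x
      have "((\<lambda>t. \<eta> (x + t *\<^sub>R axis i 1)) has_derivative (\<lambda>t. grad \<eta> (x + 0 *\<^sub>R axis i 1) \<bullet> (t *\<^sub>R axis i 1))) (at 0)"
        by (rule has_derivative_compose[OF _ has_derivative_grad[OF sm]]) (auto intro!: derivative_eq_intros)
      moreover have "(\<lambda>t. grad \<eta> (x + 0 *\<^sub>R axis i 1) \<bullet> (t *\<^sub>R axis i 1)) = (*) (partial_deriv i \<eta> x)"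
        by (simp add: inner_axis fun_eq_iff)
      ultimately have "((\<lambda>t. \<eta> (x + t *\<^sub>R axis i 1)) has_real_derivative partial_deriv i \<eta> x) (at 0)"
        unfolding has_field_derivative_def by (rule back_subst)
      then have "((\<lambda>t. (\<eta> (x + t *\<^sub>R axis i 1) - \<eta> x) / t) \<longlongrightarrow> partial_deriv i \<eta> x) (at 0)"
        by (simp add: DERIV_def)
      moreover have "filterlim h (at 0) sequentially"
        using h0 h(1) by (auto simp: filterlim_at less_imp_neq[symmetric])
      ultimately show "(\<lambda>n. ?q n x) \<longlonglongrightarrow> partial_deriv i \<eta> x"
        by (rule filterlim_compose)
    qed
    show "AE x in lborel. norm (?q n x) \<le> B * indicator (cball 0 (R + 1)) x" for n
    proof (rule AE_I2)
      fix x :: "real^'n"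
      show "norm (?q n x) \<le> B * indicator (cball 0 (R + 1)) x"
      proof (cases "x \<in> cball 0 (R + 1)")
        case True
        then show ?thesis
          using lip[of "x + h n *\<^sub>R axis i 1" x] h[of n] by (simp add: divide_le_eq)
      next
        case False
        then have "norm x > R + 1" by simp
        moreover have "norm x \<le> norm (x + h n *\<^sub>R axis i 1) + norm (h n *\<^sub>R axis i (1::real))"
          using norm_triangle_ineq4[of "x + h n *\<^sub>R axis i 1" "h n *\<^sub>R axis i (1::real)"] by simp
        moreover have "norm (h n *\<^sub>R axis i (1::real)) \<le> 1" using h[of n] by simp
        ultimately have "x \<notin> K" "x + h n *\<^sub>R axis i 1 \<notin> K" using R[of x] R[of "x + h n *\<^sub>R axis i 1"] by linarith+
        then show ?thesis using K(2) False by simp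
      qed
    qed
  qed auto
  moreover have "(\<integral>x. ?q n x \<partial>lborel) = 0" for n
  proof -
    have "integrable lborel (\<lambda>x. \<eta> (x + h n *\<^sub>R axis i 1))"
      by (rule integrable_lborel_translation[OF int])
    then show ?thesis
      using int by (simp add: integral_lborel_translation[OF meas(1)])
  qed
  ultimately have "(\<lambda>n. 0) \<longlonglongrightarrow> (\<integral>x. partial_deriv i \<eta> x \<partial>lborel)" by (simp only:)
  then show ?thesis by (simp add: LIMSEQ_const_iff)
qed

text \<open>Jensen's inequality on the unit interval, obtained as nonnegativity of the variance of
  \<open>g\<close> around its mean \<open>c\<close>.\<close>

lemma square_integral_le:
  fixes g :: "real \<Rightarrow> real"
  assumes "continuous_on {0..1} g"
  shows "(integral {0..1} g)\<^sup>2 \<le> integral {0..1} (\<lambda>t. (g t)\<^sup>2)"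
proof -
  define c where "c = integral {0..1} g"
  have i: "g integrable_on {0..1}" "(\<lambda>t. (g t)\<^sup>2) integrable_on {0..1}"
    by (auto intro!: integrable_continuous_interval continuous_intros assms)
  have "0 \<le> integral {0..1} (\<lambda>t. (g t - c)\<^sup>2)"
    by (rule Henstock_Kurzweil_Integration.integral_nonneg) (auto intro!: integrable_continuous_interval continuous_intros assms)
  also have "(\<lambda>t. (g t - c)\<^sup>2) = (\<lambda>t. (g t)\<^sup>2 - 2 * c * g t + c\<^sup>2)"
    by (simp add: power2_diff algebra_simps fun_eq_iff)
  also have "integral {0..1} (\<lambda>t. (g t)\<^sup>2 - 2 * c * g t + c\<^sup>2) = integral {0..1} (\<lambda>t. (g t)\<^sup>2) - 2 * c * c + c\<^sup>2"
  proof -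
    have "((\<lambda>t. (g t)\<^sup>2 - 2 * c * g t + c\<^sup>2) has_integral (integral {0..1} (\<lambda>t. (g t)\<^sup>2) - 2 * c * c + c\<^sup>2)) {0..1}"
      using i has_integral_const_real[of "c\<^sup>2" 0 1] unfolding c_def
      by (intro has_integral_add has_integral_diff has_integral_mult_right) (auto simp: integrable_integral)
    then show ?thesis by (rule integral_unique)
  qed
  finally show ?thesis by (simp add: c_def power2_eq_square)
qed

text \<open>The increment is the integral of the directional derivative along the segment from
  \<open>x\<close> to \<open>x + h\<close>. Jensen, Cauchy-Schwarz, exchange of the integrals and
  translation invariance in \<open>x\<close> give the bound. Nonnegative integrals are used so that
  the exchange asks for measurability alone.\<close>

lemma translation_estimate:
  assumes "test_function D \<phi>"
  shows "(\<integral>\<^sup>+x. ennreal ((\<phi> (x + h) - \<phi> x)\<^sup>2) \<partial>lborel)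
    \<le> ennreal ((norm h)\<^sup>2) * (\<integral>\<^sup>+x. ennreal ((norm (grad \<phi> x))\<^sup>2) \<partial>lborel)"
proof -
  note sm = test_function_smooth[OF assms]
  note cont = continuous_on_subset[OF grad_continuous[OF sm, of UNIV]]
  let ?N = "\<lambda>y. ennreal ((norm h)\<^sup>2) * ennreal ((norm (grad \<phi> y))\<^sup>2)"
  have [measurable]: "grad \<phi> \<in> borel_measurable borel"
    by (intro borel_measurable_continuous_onI grad_continuous sm)
  have pointwise: "ennreal ((\<phi> (x + h) - \<phi> x)\<^sup>2) \<le> (\<integral>\<^sup>+t. ?N (x + t *\<^sub>R h) * indicator {0..1} t \<partial>lborel)" for x
  proof -
    let ?g = "\<lambda>t. grad \<phi> (x + t *\<^sub>R h) \<bullet> h"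
    have cg: "continuous_on {0..1} ?g"
      by (intro continuous_intros continuous_on_compose2[OF cont]) auto
    have "(?g has_integral (\<phi> (x + 1 *\<^sub>R h) - \<phi> (x + 0 *\<^sub>R h))) {0..1}"
    proof (rule fundamental_theorem_of_calculus)
      fix t :: real
      have "((\<lambda>t. \<phi> (x + t *\<^sub>R h)) has_derivative (\<lambda>s. grad \<phi> (x + t *\<^sub>R h) \<bullet> (s *\<^sub>R h))) (at t within {0..1})"
        by (rule has_derivative_compose[OF _ has_derivative_grad[OF sm]]) (auto intro!: derivative_eq_intros)
      then show "((\<lambda>t. \<phi> (x + t *\<^sub>R h)) has_vector_derivative ?g t) (at t within {0..1})"
        by (simp add: has_vector_derivative_def)
    qed simp
    then have "(\<phi> (x + h) - \<phi> x)\<^sup>2 = (integral {0..1} ?g)\<^sup>2"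
      by (simp add: integral_unique)
    also have "\<dots> \<le> integral {0..1} (\<lambda>t. (?g t)\<^sup>2)"
      by (rule square_integral_le[OF cg])
    finally have "ennreal ((\<phi> (x + h) - \<phi> x)\<^sup>2) \<le> ennreal (integral {0..1} (\<lambda>t. (?g t)\<^sup>2))"
      by (rule ennreal_leI)
    also have "\<dots> = (\<integral>\<^sup>+t. ennreal ((?g t)\<^sup>2) * indicator {0..1} t \<partial>lborel)"
      by (intro nn_integral_has_integral_lebesgue'[symmetric] integrable_integral integrable_continuous_interval
          continuous_intros cg) auto
    also have "\<dots> \<le> (\<integral>\<^sup>+t. ?N (x + t *\<^sub>R h) * indicator {0..1} t \<partial>lborel)"
    proof (intro nn_integral_mono mult_right_mono)
      fix t
      have "(?g t)\<^sup>2 \<le> (norm (grad \<phi> (x + t *\<^sub>R h)) * norm h)\<^sup>2"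
        using Cauchy_Schwarz_ineq2[of "grad \<phi> (x + t *\<^sub>R h)" h] by (simp add: abs_le_square_iff[symmetric])
      then show "ennreal ((?g t)\<^sup>2) \<le> ?N (x + t *\<^sub>R h)"
        by (simp add: ennreal_mult[symmetric] power_mult_distrib mult.commute ennreal_leI)
    qed simp
    finally show ?thesis .
  qed
  have "(\<integral>\<^sup>+x. ennreal ((\<phi> (x + h) - \<phi> x)\<^sup>2) \<partial>lborel)
      \<le> (\<integral>\<^sup>+x. \<integral>\<^sup>+t. ?N (x + t *\<^sub>R h) * indicator {0..1} t \<partial>lborel \<partial>lborel)"
    by (intro nn_integral_mono pointwise)
  also have "\<dots> = (\<integral>\<^sup>+t. \<integral>\<^sup>+x. ?N (x + t *\<^sub>R h) * indicator {0..1} t \<partial>lborel \<partial>lborel)"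
    by (rule lborel_pair.Fubini'[symmetric]) measurable
  also have "\<dots> = (\<integral>\<^sup>+t. (\<integral>\<^sup>+x. ?N x \<partial>lborel) * indicator {0..1::real} t \<partial>lborel)"
    by (intro nn_integral_cong) (simp add: nn_integral_multc nn_integral_lborel_translation[of ?N])
  also have "\<dots> = (\<integral>\<^sup>+x. ?N x \<partial>lborel)"
    by (simp add: nn_integral_cmult)
  also have "\<dots> = ennreal ((norm h)\<^sup>2) * (\<integral>\<^sup>+x. ennreal ((norm (grad \<phi> x))\<^sup>2) \<partial>lborel)"
    by (rule nn_integral_cmult) measurable
  finally show ?thesis .
qed

text \<open>A translation by more than the diameter of \<open>D\<close> moves every point of the
  support out of the support. There the increment of \<phi> is just its value up to sign, so
  \<open>translation_estimate\<close> bounds the function itself.\<close>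

lemma Poincare_lborel:
  fixes D :: "(real^'n) set"
  assumes "bounded D"
  obtains C where "C \<ge> 0" "\<And>\<phi>. test_function D \<phi> \<Longrightarrow>
    (\<integral>\<^sup>+x. ennreal ((\<phi> x)\<^sup>2) \<partial>lborel) \<le> ennreal C * (\<integral>\<^sup>+x. ennreal ((norm (grad \<phi> x))\<^sup>2) \<partial>lborel)"
proof -
  obtain R where R: "\<And>x. x \<in> D \<Longrightarrow> norm x \<le> R" using assms by (auto simp: bounded_iff)
  \<comment> \<open>Any coordinate direction will do. The length exceeds the diameter bound
    \<open>2 * R\<close>; the absolute value covers an empty \<open>D\<close>, for which
    \<open>R\<close> could be negative.\<close>
  define h :: "real^'n" where "h = (2 * \<bar>R\<bar> + 1) *\<^sub>R axis undefined 1"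
  have h: "norm h = 2 * \<bar>R\<bar> + 1" by (simp add: h_def)
  have "(\<integral>\<^sup>+x. ennreal ((\<phi> x)\<^sup>2) \<partial>lborel) \<le> ennreal ((norm h)\<^sup>2) * (\<integral>\<^sup>+x. ennreal ((norm (grad \<phi> x))\<^sup>2) \<partial>lborel)"
    if t: "test_function D \<phi>" for \<phi>
  proof -
    obtain K where K: "compact K" "K \<subseteq> D" "\<And>x. x \<notin> K \<Longrightarrow> \<phi> x = 0"
      by (rule test_function_support0[OF t]) (rule that)
    have "(\<phi> x)\<^sup>2 \<le> (\<phi> (x + h) - \<phi> x)\<^sup>2" for x
    proof (cases "x \<in> K")
      case True
      then have "norm x \<le> R" using R K by auto
      moreover have "norm h \<le> norm (x + h) + norm x" using norm_triangle_ineq4[of "x + h" x] by simp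
      ultimately have "x + h \<notin> K" using R[of "x + h"] K(2) h by fastforce
      then show ?thesis using K(3) by simp
    qed (simp add: K)
    then have "(\<integral>\<^sup>+x. ennreal ((\<phi> x)\<^sup>2) \<partial>lborel) \<le> (\<integral>\<^sup>+x. ennreal ((\<phi> (x + h) - \<phi> x)\<^sup>2) \<partial>lborel)"
      by (intro nn_integral_mono ennreal_leI)
    also note translation_estimate[OF t, of h]
    finally show ?thesis .
  qed
  then show ?thesis by (intro that[of "(norm h)\<^sup>2"]) auto
qed

section \<open>Compactness of sets of test functions\<close>

text \<open>The index of the half-open cube of side \<delta> containing \<open>x\<close>. The cubes
  appear as fibres of this map, so they partition the space and there are only countably
  many.\<close>

definition grid_cell :: "real \<Rightarrow> real^'n \<Rightarrow> int^'n" where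
  "grid_cell \<delta> x = (\<chi> i. \<lfloor>x $ i / \<delta>\<rfloor>)"

definition grid_average :: "real \<Rightarrow> (real^'n \<Rightarrow> real) \<Rightarrow> real^'n \<Rightarrow> real" where
  "grid_average \<delta> u x = (\<integral>y. indicator {y. grid_cell \<delta> y = grid_cell \<delta> x} y * u y \<partial>lborel) / \<delta> ^ CARD('n)"

lemma grid_cell_measurable [measurable]:
  "{y. grid_cell \<delta> y = k} \<in> sets (borel :: (real^'n) measure)"
proof -
  have "{y. grid_cell \<delta> y = k} = (\<Inter>i\<in>UNIV. {y. \<lfloor>y $ i / \<delta>\<rfloor> = k $ i})"
    by (auto simp: grid_cell_def vec_eq_iff)
  also have "\<dots> = (\<Inter>i\<in>UNIV. {y. of_int (k $ i) \<le> y $ i / \<delta> \<and> y $ i / \<delta> < of_int (k $ i) + 1})"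
    by (auto simp: floor_eq_iff)
  also have "\<dots> \<in> sets borel"
    by (intro sets.finite_INT) auto
  finally show ?thesis .
qed

text \<open>The half-open cube lies between an open and a closed box with the same corners, and
  these have equal volume.\<close>

lemma emeasure_grid_cell:
  assumes "\<delta> > 0"
  shows "emeasure lborel {y :: real^'n. grid_cell \<delta> y = k} = ennreal (\<delta> ^ CARD('n))"
proof (rule antisym)
  define a b :: "real^'n" where "a = (\<chi> i. \<delta> * of_int (k $ i))" and "b = (\<chi> i. \<delta> * (of_int (k $ i) + 1))"
  have ab: "a \<bullet> c \<le> b \<bullet> c" "(b - a) \<bullet> c = \<delta>" if "c \<in> Basis" for c
    using that assms by (auto simp: a_def b_def Basis_vec_def inner_axis algebra_simps)
  have cell: "grid_cell \<delta> y = k \<longleftrightarrow> (\<forall>i. a $ i \<le> y $ i \<and> y $ i < b $ i)" for y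
    using assms by (simp add: grid_cell_def vec_eq_iff floor_eq_iff a_def b_def field_simps)
  have "emeasure lborel {y. grid_cell \<delta> y = k} \<le> emeasure lborel (cbox a b)"
    by (rule emeasure_mono) (auto simp: cell mem_box_cart less_imp_le)
  also have "\<dots> = ennreal (\<delta> ^ CARD('n))"
    using ab by (simp add: emeasure_lborel_cbox_eq)
  finally show "emeasure lborel {y. grid_cell \<delta> y = k} \<le> ennreal (\<delta> ^ CARD('n))" .
  have "ennreal (\<delta> ^ CARD('n)) = emeasure lborel (box a b)"
    using ab by (simp add: emeasure_lborel_box_eq)
  also have "\<dots> \<le> emeasure lborel {y. grid_cell \<delta> y = k}"
    by (rule emeasure_mono) (auto simp: cell mem_box_cart less_imp_le)
  finally show "ennreal (\<delta> ^ CARD('n)) \<le> emeasure lborel {y. grid_cell \<delta> y = k}" .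
qed

lemma grid_cell_eq_imp_close:
  assumes "\<delta> > 0" "grid_cell \<delta> y = grid_cell \<delta> x"
  shows "\<bar>y $ i - x $ i\<bar> \<le> \<delta>"
proof -
  have "\<lfloor>y $ i / \<delta>\<rfloor> = \<lfloor>x $ i / \<delta>\<rfloor>"
    using assms(2) by (simp add: grid_cell_def vec_eq_iff)
  then have "\<bar>y $ i / \<delta> - x $ i / \<delta>\<bar> \<le> 1" by linarith
  then have "\<bar>(y $ i - x $ i) / \<delta>\<bar> \<le> 1" by (simp add: diff_divide_distrib)
  then show ?thesis using assms(1) by (simp add: abs_divide)
qed

text \<open>Jensen's inequality over one cell of volume \<mu>. \<open>lin\<close> expands the
  integral of \<open>(c - u y)\<^sup>2\<close> over the cell: at the mean
  \<open>c = A / \<mu>\<close> its nonnegativity says that \<open>A\<^sup>2 / \<mu>\<close> is at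
  most \<open>I2\<close>, and at \<open>c = u x\<close> this becomes the bound on the deviation of
  \<open>u x\<close> from the mean.\<close>

lemma grid_average_pointwise:
  fixes u :: "real^'n \<Rightarrow> real"
  assumes \<delta>: "\<delta> > 0" and u: "integrable lborel u" "integrable lborel (\<lambda>x. (u x)\<^sup>2)"
  shows "ennreal ((u x - grid_average \<delta> u x)\<^sup>2)
    \<le> (\<integral>\<^sup>+y. indicator {y. grid_cell \<delta> y = grid_cell \<delta> x} y * ennreal ((u x - u y)\<^sup>2) \<partial>lborel) * ennreal (1 / \<delta> ^ CARD('n))"
proof -
  define C where "C = {y. grid_cell \<delta> y = grid_cell \<delta> x}"
  define \<mu> where "\<mu> = \<delta> ^ CARD('n)"
  have \<mu>: "\<mu> > 0" using \<delta> by (simp add: \<mu>_def)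
  have [measurable]: "C \<in> sets borel" by (simp add: C_def)
  have em: "emeasure lborel C = ennreal \<mu>" using emeasure_grid_cell[OF \<delta>] by (simp add: C_def \<mu>_def)
  have i1: "integrable lborel (\<lambda>y. indicator C y :: real)"
    using em by (intro integrable_real_indicator) auto
  have i2: "integrable lborel (\<lambda>y. indicator C y * u y)" "integrable lborel (\<lambda>y. indicator C y * (u y)\<^sup>2)"
    using integrable_mult_indicator[of C lborel u] integrable_mult_indicator[of C lborel "\<lambda>y. (u y)\<^sup>2"] u by auto
  define A where "A = (\<integral>y. indicator C y * u y \<partial>lborel)"
  define s where "s = u x - A / \<mu>"
  have avg: "grid_average \<delta> u x = A / \<mu>" by (simp add: grid_average_def A_def C_def \<mu>_def)
  have m: "(\<integral>y. indicator C y \<partial>lborel) = \<mu>"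
    using em \<mu> by (simp add: measure_def)
  define I2 where "I2 = (\<integral>y. indicator C y * (u y)\<^sup>2 \<partial>lborel)"
  have lin: "(\<integral>y. indicator C y * (c - u y)\<^sup>2 \<partial>lborel) = c\<^sup>2 * \<mu> - 2 * c * A + I2"
       "integrable lborel (\<lambda>y. indicator C y * (c - u y)\<^sup>2)" for c
  proof -
    have eq: "(\<lambda>y. indicator C y * (c - u y)\<^sup>2) = (\<lambda>y. c\<^sup>2 * indicator C y - 2 * c * (indicator C y * u y) + indicator C y * (u y)\<^sup>2)"
      by (auto simp: power2_diff algebra_simps fun_eq_iff)
    show "(\<integral>y. indicator C y * (c - u y)\<^sup>2 \<partial>lborel) = c\<^sup>2 * \<mu> - 2 * c * A + I2"
      "integrable lborel (\<lambda>y. indicator C y * (c - u y)\<^sup>2)"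
      unfolding eq using i1 i2 m by (auto simp: A_def I2_def)
  qed
  have "0 \<le> (\<integral>y. indicator C y * (A / \<mu> - u y)\<^sup>2 \<partial>lborel)" by simp
  then have "A\<^sup>2 / \<mu> \<le> I2"
    using \<mu> unfolding lin by (simp add: power2_eq_square field_simps)
  then have "s\<^sup>2 * \<mu> \<le> (\<integral>y. indicator C y * (u x - u y)\<^sup>2 \<partial>lborel)"
    using \<mu> unfolding lin s_def by (simp add: power2_eq_square field_simps)
  then have "ennreal (s\<^sup>2) * ennreal \<mu> \<le> ennreal (\<integral>y. indicator C y * (u x - u y)\<^sup>2 \<partial>lborel)"
    using \<mu> by (simp add: ennreal_mult[symmetric] ennreal_leI)
  also have "\<dots> = (\<integral>\<^sup>+y. ennreal (indicator C y * (u x - u y)\<^sup>2) \<partial>lborel)"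
    by (rule nn_integral_eq_integral[symmetric]) (auto simp: lin)
  also have "\<dots> = (\<integral>\<^sup>+y. indicator C y * ennreal ((u x - u y)\<^sup>2) \<partial>lborel)"
    by (intro nn_integral_cong) (auto simp: indicator_def)
  finally have "ennreal (s\<^sup>2) * ennreal \<mu> * ennreal (1 / \<mu>)
      \<le> (\<integral>\<^sup>+y. indicator C y * ennreal ((u x - u y)\<^sup>2) \<partial>lborel) * ennreal (1 / \<mu>)"
    by (rule mult_right_mono) simp
  moreover have "ennreal (s\<^sup>2) * ennreal \<mu> * ennreal (1 / \<mu>) = ennreal (s\<^sup>2)"
    using \<mu> by (simp flip: ennreal_mult)
  ultimately have "ennreal (s\<^sup>2) \<le> (\<integral>\<^sup>+y. indicator C y * ennreal ((u x - u y)\<^sup>2) \<partial>lborel) * ennreal (1 / \<mu>)"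
    by simp
  then show ?thesis by (simp add: avg s_def C_def \<mu>_def)
qed

text \<open>Points of one cell differ by a vector of the cube \<open>B\<close>, whose side is twice
  \<delta>. Enlarging the cell to \<open>x + B\<close> makes the domain of differences independent
  of \<open>x\<close>, so that \<open>translation_estimate\<close> applies for each shift
  separately. The constant is the volume ratio \<open>2 ^ CARD('n)\<close> times the largest squared
  length \<open>CARD('n) * \<delta>\<^sup>2\<close> in \<open>B\<close>.\<close>

lemma grid_estimate:
  fixes D :: "(real^'n) set" and \<delta> :: real
  assumes \<delta>: "\<delta> > 0" and t: "test_function D \<phi>"
  shows "(\<integral>\<^sup>+x. ennreal ((\<phi> x - grid_average \<delta> \<phi> x)\<^sup>2) \<partial>lborel)
    \<le> ennreal (2 ^ CARD('n) * CARD('n) * \<delta>\<^sup>2) * (\<integral>\<^sup>+x. ennreal ((norm (grad \<phi> x))\<^sup>2) \<partial>lborel)"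
proof -
  note sm = test_function_smooth[OF t]
  have [measurable]: "\<phi> \<in> borel_measurable borel"
    by (intro borel_measurable_continuous_onI smooth_continuous sm)
  obtain K where K: "compact K" "K \<subseteq> D" "\<And>x. x \<notin> K \<Longrightarrow> \<phi> x = 0"
    by (rule test_function_support0[OF t]) (rule that)
  have int: "integrable lborel \<phi>" "integrable lborel (\<lambda>x. (\<phi> x)\<^sup>2)"
    by (rule integrable_compact_support[OF _ K(1)]; use K(3) in \<open>simp add: continuous_on_power smooth_continuous sm\<close>)+
  define \<mu> where "\<mu> = \<delta> ^ CARD('n)"
  have \<mu>: "\<mu> > 0" using \<delta> by (simp add: \<mu>_def)
  define b :: "real^'n" where "b = (\<chi> i. \<delta>)"
  define B where "B = cbox (- b) b"
  have [measurable]: "B \<in> sets borel" by (simp add: B_def)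
  have emB: "emeasure lborel B = ennreal (2 ^ CARD('n) * \<mu>)"
  proof -
    have "(b - (- b)) \<bullet> c = 2 * \<delta>" "(- b) \<bullet> c \<le> b \<bullet> c" if "c \<in> Basis" for c
      using that \<delta> by (auto simp: b_def Basis_vec_def inner_axis)
    then show ?thesis using \<delta> unfolding B_def emeasure_lborel_cbox_eq by (simp add: \<mu>_def power_mult_distrib)
  qed
  have normB: "(norm z)\<^sup>2 \<le> CARD('n) * \<delta>\<^sup>2" if "z \<in> B" for z
  proof -
    have "(norm z)\<^sup>2 = (\<Sum>i\<in>UNIV. (z $ i)\<^sup>2)" by (simp add: norm_vec_def L2_set_def sum_nonneg)
    also have "\<dots> \<le> (\<Sum>i\<in>(UNIV::'n set). \<delta>\<^sup>2)"
    proof (rule sum_mono)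
      fix i
      have "- \<delta> \<le> z $ i" "z $ i \<le> \<delta>" using that by (auto simp: B_def b_def mem_box_cart)
      then show "(z $ i)\<^sup>2 \<le> \<delta>\<^sup>2" by (intro power2_le_iff_abs_le[THEN iffD2]) (use \<delta> in auto)
    qed
    finally show ?thesis by simp
  qed
  let ?G = "\<integral>\<^sup>+x. ennreal ((norm (grad \<phi> x))\<^sup>2) \<partial>lborel"
  let ?c = "ennreal (CARD('n) * \<delta>\<^sup>2)"
  have "(\<integral>\<^sup>+x. ennreal ((\<phi> x - grid_average \<delta> \<phi> x)\<^sup>2) \<partial>lborel)
      \<le> (\<integral>\<^sup>+x. (\<integral>\<^sup>+z. indicator B z * ennreal ((\<phi> (x + z) - \<phi> x)\<^sup>2) \<partial>lborel) * ennreal (1 / \<mu>) \<partial>lborel)"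
  proof (rule nn_integral_mono)
    fix x
    have "(\<integral>\<^sup>+y. indicator {y. grid_cell \<delta> y = grid_cell \<delta> x} y * ennreal ((\<phi> x - \<phi> y)\<^sup>2) \<partial>lborel)
        \<le> (\<integral>\<^sup>+y. indicator B (y - x) * ennreal ((\<phi> y - \<phi> x)\<^sup>2) \<partial>lborel)"
    proof (rule nn_integral_mono, rule mult_mono)
      fix y
      show "indicator {y. grid_cell \<delta> y = grid_cell \<delta> x} y \<le> (indicator B (y - x) :: ennreal)"
      proof (cases "grid_cell \<delta> y = grid_cell \<delta> x")
        case True
        have "- \<delta> \<le> y $ i - x $ i \<and> y $ i - x $ i \<le> \<delta>" for i using grid_cell_eq_imp_close[OF \<delta> True, of i] by linarith
        then have "y - x \<in> B" by (simp add: B_def b_def mem_box_cart)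
        then show ?thesis by (simp add: indicator_def)
      qed simp
      show "ennreal ((\<phi> x - \<phi> y)\<^sup>2) \<le> ennreal ((\<phi> y - \<phi> x)\<^sup>2)" by (simp add: power2_commute)
    qed auto
    also have "\<dots> = (\<integral>\<^sup>+z. indicator B z * ennreal ((\<phi> (x + z) - \<phi> x)\<^sup>2) \<partial>lborel)"
      using nn_integral_lborel_translation[of "\<lambda>z. indicator B z * ennreal ((\<phi> (x + z) - \<phi> x)\<^sup>2)" "- x"] by simp
    finally have "(\<integral>\<^sup>+y. indicator {y. grid_cell \<delta> y = grid_cell \<delta> x} y * ennreal ((\<phi> x - \<phi> y)\<^sup>2) \<partial>lborel) * ennreal (1 / \<mu>)
         \<le> (\<integral>\<^sup>+z. indicator B z * ennreal ((\<phi> (x + z) - \<phi> x)\<^sup>2) \<partial>lborel) * ennreal (1 / \<mu>)"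
      by (rule mult_right_mono) simp
    with grid_average_pointwise[OF \<delta> int, of x]
    show "ennreal ((\<phi> x - grid_average \<delta> \<phi> x)\<^sup>2) \<le> (\<integral>\<^sup>+z. indicator B z * ennreal ((\<phi> (x + z) - \<phi> x)\<^sup>2) \<partial>lborel) * ennreal (1 / \<mu>)"
      unfolding \<mu>_def by (rule order_trans)
  qed
  also have "\<dots> = (\<integral>\<^sup>+x. \<integral>\<^sup>+z. indicator B z * ennreal ((\<phi> (x + z) - \<phi> x)\<^sup>2) \<partial>lborel \<partial>lborel) * ennreal (1 / \<mu>)"
    by (rule nn_integral_multc) measurable
  also have "(\<integral>\<^sup>+x. \<integral>\<^sup>+z. indicator B z * ennreal ((\<phi> (x + z) - \<phi> x)\<^sup>2) \<partial>lborel \<partial>lborel)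
     = (\<integral>\<^sup>+z. \<integral>\<^sup>+x. indicator B z * ennreal ((\<phi> (x + z) - \<phi> x)\<^sup>2) \<partial>lborel \<partial>lborel)"
    by (rule lborel_pair.Fubini'[symmetric]) measurable
  also have "\<dots> \<le> (\<integral>\<^sup>+z. indicator B z * (?c * ?G) \<partial>lborel)"
  proof (rule nn_integral_mono)
    fix z
    have "(\<integral>\<^sup>+x. indicator B z * ennreal ((\<phi> (x + z) - \<phi> x)\<^sup>2) \<partial>lborel) \<le> indicator B z * (ennreal ((norm z)\<^sup>2) * ?G)"
      using translation_estimate[OF t, of z] by (simp add: nn_integral_cmult mult_left_mono)
    also have "\<dots> \<le> indicator B z * (?c * ?G)"
      using normB[of z] by (auto simp: indicator_def intro!: mult_right_mono ennreal_leI)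
    finally show "(\<integral>\<^sup>+x. indicator B z * ennreal ((\<phi> (x + z) - \<phi> x)\<^sup>2) \<partial>lborel) \<le> indicator B z * (?c * ?G)" .
  qed
  also have "\<dots> = emeasure lborel B * (?c * ?G)"
    by (simp add: nn_integral_multc)
  finally have "(\<integral>\<^sup>+x. ennreal ((\<phi> x - grid_average \<delta> \<phi> x)\<^sup>2) \<partial>lborel) \<le> emeasure lborel B * (?c * ?G) * ennreal (1 / \<mu>)"
    by (simp add: mult_right_mono)
  also have "\<dots> = ennreal (2 ^ CARD('n)) * ?c * ?G"
  proof -
    have "emeasure lborel B * ennreal (1 / \<mu>) = ennreal (2 ^ CARD('n))"
      using \<mu> by (simp add: emB flip: ennreal_mult)
    moreover have "emeasure lborel B * (?c * ?G) * ennreal (1 / \<mu>) = emeasure lborel B * ennreal (1 / \<mu>) * ?c * ?G"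
      by (simp only: mult_ac)
    ultimately show ?thesis by simp
  qed
  also have "\<dots> = ennreal (2 ^ CARD('n) * CARD('n) * \<delta>\<^sup>2) * ?G"
    by (simp add: ennreal_mult[symmetric] mult.assoc[symmetric])
  finally show ?thesis .
qed

lemma grid_cell_measurable_count_space: "(grid_cell \<delta> :: real^'n \<Rightarrow> int^'n) \<in> borel \<rightarrow>\<^sub>M count_space UNIV"
proof (subst measurable_count_space_eq_countable)
  have "grid_cell \<delta> -` {k} = {y. grid_cell \<delta> y = k}" for k :: "int^'n" by auto
  then have "grid_cell \<delta> -` {k} \<in> sets borel" for k :: "int^'n" by (simp only: grid_cell_measurable)
  then show "grid_cell \<delta> \<in> space borel \<rightarrow> UNIV \<and> (\<forall>k\<in>UNIV. grid_cell \<delta> -` {k} \<inter> space borel \<in> sets (borel :: (real^'n) measure))"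
    by auto
qed simp

text \<open>The average factors through the countable set of cell indices, on which every function
  is measurable.\<close>

lemma grid_average_measurable [measurable]:
  fixes u :: "real^'n \<Rightarrow> real"
  shows "grid_average \<delta> u \<in> borel_measurable borel"
proof -
  have "(\<lambda>k. (\<integral>y. indicator {y. grid_cell \<delta> y = k} y * u y \<partial>lborel) / \<delta> ^ CARD('n)) \<in> borel_measurable (count_space UNIV)"
    by simp
  from measurable_compose[OF grid_cell_measurable_count_space this, of \<delta>]
  show ?thesis by (simp add: grid_average_def[abs_def])
qed

lemma indicator_mult_integral_le:
  fixes u :: "'a::euclidean_space \<Rightarrow> real"
  assumes "integrable lborel u" "S \<in> sets borel"
  shows "\<bar>\<integral>y. indicator S y * u y \<partial>lborel\<bar> \<le> (\<integral>y. \<bar>u y\<bar> \<partial>lborel)"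
proof -
  have "integrable lborel (\<lambda>y. indicator S y * u y)"
    using integrable_mult_indicator[of S lborel u] assms by simp
  then have "\<bar>\<integral>y. indicator S y * u y \<partial>lborel\<bar> \<le> (\<integral>y. \<bar>indicator S y * u y\<bar> \<partial>lborel)"
    using integral_norm_bound[of lborel "\<lambda>y. indicator S y * u y"] by simp
  also have "\<dots> \<le> (\<integral>y. \<bar>u y\<bar> \<partial>lborel)"
    using assms integrable_abs[OF \<open>integrable lborel (\<lambda>y. indicator S y * u y)\<close>]
    by (intro integral_mono) (auto simp: indicator_def)
  finally show ?thesis .
qed

section \<open>Test functions on \<open>D\<close>: passage from the whole space to
  \<open>lebesgue_on D\<close>, Poincare and Rellich\<close>

context bounded_open
begin

lemma borel_measurable_lebesgue_on: "f \<in> borel_measurable borel \<Longrightarrow> f \<in> borel_measurable (lebesgue_on D)"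
  by (intro measurable_restrict_space1 measurable_completion) simp

lemma nn_integral_D_eq_lborel:
  assumes "\<And>x. x \<notin> D \<Longrightarrow> f x = 0"
  shows "(\<integral>\<^sup>+x. f x \<partial>lebesgue_on D) = (\<integral>\<^sup>+x. f x \<partial>lborel)"
proof -
  have "(\<integral>\<^sup>+x. f x \<partial>lebesgue_on D) = (\<integral>\<^sup>+x. f x * indicator D x \<partial>lebesgue)"
    by (rule nn_integral_restrict_space) simp
  also have "(\<lambda>x. f x * indicator D x) = f"
    using assms by (auto simp: indicator_def)
  finally show ?thesis by (simp add: nn_integral_completion)
qed

lemma nn_integral_D_le_lborel: "(\<integral>\<^sup>+x. f x \<partial>lebesgue_on D) \<le> (\<integral>\<^sup>+x. f x \<partial>lborel)"
proof -
  have "(\<integral>\<^sup>+x. f x \<partial>lebesgue_on D) = (\<integral>\<^sup>+x. f x * indicator D x \<partial>lebesgue)"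
    by (rule nn_integral_restrict_space) simp
  also have "\<dots> \<le> (\<integral>\<^sup>+x. f x \<partial>lebesgue)"
    by (intro nn_integral_mono) (auto simp: indicator_def)
  finally show ?thesis by (simp add: nn_integral_completion)
qed

lemma integral_D_eq_lborel:
  fixes f :: "real^'n \<Rightarrow> 'b::euclidean_space"
  assumes "f \<in> borel_measurable borel" "\<And>x. x \<notin> D \<Longrightarrow> f x = 0"
  shows "(\<integral>x. f x \<partial>lebesgue_on D) = (\<integral>x. f x \<partial>lborel)"
proof -
  have "(\<integral>x. f x \<partial>lebesgue_on D) = (\<integral>x. indicator D x *\<^sub>R f x \<partial>lebesgue)"
    by (rule integral_restrict_space) simp
  also have "(\<lambda>x. indicator D x *\<^sub>R f x) = f"
    using assms by (auto simp: indicator_def)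
  finally show ?thesis using assms by (simp add: integral_completion)
qed

lemma ennreal_l2_square:
  assumes "L2_on D f" shows "ennreal ((l2 D f)\<^sup>2) = (\<integral>\<^sup>+x. ennreal ((norm (f x))\<^sup>2) \<partial>lebesgue_on D)"
  unfolding l2_square by (rule nn_integral_eq_integral[symmetric]) (auto intro: L2_on_integrable assms)

lemma test_function_zero_outside: "test_function D \<phi> \<Longrightarrow> x \<notin> D \<Longrightarrow> \<phi> x = 0"
  using closure_subset[of "{x. \<phi> x \<noteq> 0}"] unfolding test_function_def by blast

lemma test_function_grad_zero_outside: "test_function D \<phi> \<Longrightarrow> x \<notin> D \<Longrightarrow> grad \<phi> x = 0"
  using test_function_zero_outside[OF test_function_partial_deriv] by (simp add: vec_eq_iff)

lemma test_function_measurable: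
  assumes "test_function D \<phi>"
  shows "\<phi> \<in> borel_measurable borel" "grad \<phi> \<in> borel_measurable borel"
  by (intro borel_measurable_continuous_onI smooth_continuous grad_continuous test_function_smooth[OF assms])+

lemma test_function_L2:
  assumes "test_function D \<phi>"
  shows "L2_on D \<phi>" "L2_on D (grad \<phi>)"
proof -
  obtain K where K: "compact K" "K \<subseteq> D" "\<And>x. x \<notin> K \<Longrightarrow> \<phi> x = 0" "\<And>x. x \<notin> K \<Longrightarrow> grad \<phi> x = 0"
    by (rule test_function_grad_support[OF assms]) (rule that)
  note sm = test_function_smooth[OF assms]
  obtain B where "\<And>x. norm (\<phi> x) \<le> B"
    by (rule compact_support_bounded[OF smooth_continuous[OF sm] K(1,3)]) (assumption, rule that)
  then show "L2_on D \<phi>"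
    by (intro L2_on_bounded borel_measurable_lebesgue_on test_function_measurable assms)
  obtain B where "\<And>x. norm (grad \<phi> x) \<le> B"
    by (rule compact_support_bounded[OF grad_continuous[OF sm] K(1,4)]) (assumption, rule that)
  then show "L2_on D (grad \<phi>)"
    by (intro L2_on_bounded borel_measurable_lebesgue_on test_function_measurable assms)
qed

lemma test_function_l2_lborel:
  assumes "test_function D \<phi>"
  shows "(\<integral>\<^sup>+x. ennreal ((\<phi> x)\<^sup>2) \<partial>lborel) = ennreal ((l2 D \<phi>)\<^sup>2)"
    "(\<integral>\<^sup>+x. ennreal ((norm (grad \<phi> x))\<^sup>2) \<partial>lborel) = ennreal ((l2 D (grad \<phi>))\<^sup>2)"
  by (simp_all add: ennreal_l2_square test_function_L2[OF assms] nn_integral_D_eq_lborel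
      test_function_zero_outside[OF assms] test_function_grad_zero_outside[OF assms])

text \<open>The product of the two test functions is a test function, and its partial derivative
  integrates to 0.\<close>

lemma integration_by_parts:
  assumes t: "test_function D \<phi>" "test_function D \<psi>"
  shows "(\<integral>x. \<phi> x * partial_deriv i \<psi> x \<partial>lebesgue_on D) = - (\<integral>x. partial_deriv i \<phi> x * \<psi> x \<partial>lebesgue_on D)"
proof -
  note sm = t[THEN test_function_smooth]
  have tt: "test_function D (\<lambda>x. \<phi> x * \<psi> x)" by (rule test_function_mult[OF sm(1) t(2)])
  have "(\<integral>x. \<phi> x * partial_deriv i \<psi> x \<partial>lebesgue_on D) + (\<integral>x. partial_deriv i \<phi> x * \<psi> x \<partial>lebesgue_on D)
      = (\<integral>x. \<phi> x * partial_deriv i \<psi> x + partial_deriv i \<phi> x * \<psi> x \<partial>lebesgue_on D)"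
    by (intro Bochner_Integration.integral_add[symmetric] L2_on_mult_integrable test_function_L2 test_function_partial_deriv t)
  also have "\<dots> = (\<integral>x. partial_deriv i (\<lambda>x. \<phi> x * \<psi> x) x \<partial>lebesgue_on D)"
    by (simp add: partial_deriv_mult smooth_differentiable sm)
  also have "\<dots> = (\<integral>x. partial_deriv i (\<lambda>x. \<phi> x * \<psi> x) x \<partial>lborel)"
    by (intro integral_D_eq_lborel test_function_measurable test_function_partial_deriv tt
        test_function_zero_outside[OF test_function_partial_deriv[OF tt]])
  also have "\<dots> = 0" by (rule integral_partial_deriv_eq_0[OF tt])
  finally show ?thesis by simp
qed

lemma Poincare_test_function:
  obtains C where "C \<ge> 0" "\<And>\<phi>. test_function D \<phi> \<Longrightarrow> l2 D \<phi> \<le> C * l2 D (grad \<phi>)"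
proof -
  obtain C where C: "C \<ge> 0" "\<And>\<phi>. test_function D \<phi> \<Longrightarrow>
    (\<integral>\<^sup>+x. ennreal ((\<phi> x)\<^sup>2) \<partial>lborel) \<le> ennreal C * (\<integral>\<^sup>+x. ennreal ((norm (grad \<phi> x))\<^sup>2) \<partial>lborel)"
    by (rule Poincare_lborel[OF bounded_D]) (rule that)
  have "l2 D \<phi> \<le> sqrt C * l2 D (grad \<phi>)" if "test_function D \<phi>" for \<phi>
  proof -
    have "ennreal ((l2 D \<phi>)\<^sup>2) \<le> ennreal (C * (l2 D (grad \<phi>))\<^sup>2)"
      using C(2)[OF that] C(1) by (simp add: test_function_l2_lborel[OF that] ennreal_mult)
    then have "(l2 D \<phi>)\<^sup>2 \<le> (sqrt C * l2 D (grad \<phi>))\<^sup>2"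
      using C(1) by (simp add: power_mult_distrib)
    then show ?thesis
      by (rule power2_le_imp_le) (use C(1) in simp)
  qed
  then show ?thesis using that[of "sqrt C"] C(1) by simp
qed

lemma test_function_integrable_lborel:
  assumes "test_function D \<phi>" shows "integrable lborel \<phi>"
proof -
  obtain K where K: "compact K" "K \<subseteq> D" "\<And>x. x \<notin> K \<Longrightarrow> \<phi> x = 0"
    by (rule test_function_support0[OF assms]) (rule that)
  show ?thesis
    by (rule integrable_compact_support[OF smooth_continuous[OF test_function_smooth[OF assms]] K(1,3)])
qed

lemma integral_abs_test_function_le:
  assumes "test_function D \<phi>"
  shows "(\<integral>y. \<bar>\<phi> y\<bar> \<partial>lborel) \<le> l2 D \<phi> * l2 D (\<lambda>_. 1::real)"
proof -
  have "(\<integral>y. \<bar>\<phi> y\<bar> \<partial>lborel) = (\<integral>y. \<bar>\<phi> y\<bar> \<partial>lebesgue_on D)"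
    using test_function_measurable(1)[OF assms] test_function_zero_outside[OF assms]
    by (intro integral_D_eq_lborel[symmetric]) auto
  then show ?thesis using integral_norm_le_l2[OF test_function_L2(1)[OF assms]] by simp
qed

lemma grid_average_bound:
  assumes "test_function D \<phi>" "\<delta> > 0"
  shows "\<bar>grid_average \<delta> \<phi> x\<bar> \<le> l2 D \<phi> * l2 D (\<lambda>_. 1::real) / \<delta> ^ CARD('n)"
proof -
  have "\<bar>\<integral>y. indicator {y. grid_cell \<delta> y = grid_cell \<delta> x} y * \<phi> y \<partial>lborel\<bar> \<le> l2 D \<phi> * l2 D (\<lambda>_. 1::real)"
    by (rule order_trans[OF indicator_mult_integral_le integral_abs_test_function_le])
      (auto intro: test_function_integrable_lborel assms)
  then show ?thesis
    using assms(2) by (simp add: grid_average_def abs_divide divide_right_mono)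
qed

lemma grid_average_L2:
  assumes "test_function D \<phi>" "\<delta> > 0" shows "L2_on D (grid_average \<delta> \<phi>)"
  by (rule L2_on_bounded[OF borel_measurable_lebesgue_on[OF grid_average_measurable]])
    (use grid_average_bound[OF assms] in simp)

lemma grid_estimate_l2:
  assumes t: "test_function D \<phi>" and \<delta>: "\<delta> > 0"
  shows "l2 D (\<lambda>x. \<phi> x - grid_average \<delta> \<phi> x) \<le> sqrt (2 ^ CARD('n) * real CARD('n)) * \<delta> * l2 D (grad \<phi>)"
proof -
  let ?c = "2 ^ CARD('n) * real CARD('n)"
  have "ennreal ((l2 D (\<lambda>x. \<phi> x - grid_average \<delta> \<phi> x))\<^sup>2) = (\<integral>\<^sup>+x. ennreal ((\<phi> x - grid_average \<delta> \<phi> x)\<^sup>2) \<partial>lebesgue_on D)"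
    using ennreal_l2_square[OF L2_on_diff[OF test_function_L2(1)[OF t] grid_average_L2[OF assms]]] by simp
  also have "\<dots> \<le> (\<integral>\<^sup>+x. ennreal ((\<phi> x - grid_average \<delta> \<phi> x)\<^sup>2) \<partial>lborel)"
    by (rule nn_integral_D_le_lborel)
  also have "\<dots> \<le> ennreal (?c * \<delta>\<^sup>2 * (l2 D (grad \<phi>))\<^sup>2)"
    using grid_estimate[OF \<delta> t] by (simp add: test_function_l2_lborel[OF t] ennreal_mult)
  finally have "(l2 D (\<lambda>x. \<phi> x - grid_average \<delta> \<phi> x))\<^sup>2 \<le> (sqrt ?c * \<delta> * l2 D (grad \<phi>))\<^sup>2"
    by (simp add: power_mult_distrib)
  then show ?thesis
    by (rule power2_le_imp_le) (use \<delta> in simp)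
qed

text \<open>The grid averages at scale \<open>\<delta>\<close> take finitely many values on \<open>D\<close>, so a diagonal
  subsequence makes them converge for all scales \<open>1/(j+1)\<close> at once.\<close>

lemma Rellich_test_function:
  assumes t: "\<And>n. test_function D (\<phi> n)" and B: "\<And>n. l2 D (\<phi> n) \<le> B" "\<And>n. l2 D (grad (\<phi> n)) \<le> B"
  obtains r u where "strict_mono (r :: nat \<Rightarrow> nat)" "L2_on D u" "(\<lambda>n. l2 D (\<lambda>x. \<phi> (r n) x - u x)) \<longlonglongrightarrow> 0"
proof -
  have B0: "B \<ge> 0" using order_trans[OF l2_nonneg B(1)] .
  define \<delta> where "\<delta> j = inverse (real (Suc j))" for j
  have \<delta>: "\<delta> j > 0" for j by (simp add: \<delta>_def)
  \<comment> \<open>The single index \<open>m\<close> encodes a scale and a cell, so the diagonal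
    argument runs over one countable family of bounded scalar sequences.\<close>
  define a where "a n m = (case from_nat m of (j, k) \<Rightarrow> \<integral>y. indicator {y. grid_cell (\<delta> j) y = k} y * \<phi> n y \<partial>lborel)" for n m
  let ?c1 = "l2 D (\<lambda>_. 1::real)"
  have a_bound: "\<bar>a n m\<bar> \<le> B * ?c1" for n m
  proof -
    obtain j :: nat and k :: "int^'n" where jk: "from_nat m = (j, k)" by (cases "from_nat m :: nat \<times> (int^'n)")
    have "\<bar>a n m\<bar> \<le> (\<integral>y. \<bar>\<phi> n y\<bar> \<partial>lborel)"
      unfolding a_def jk prod.case by (rule indicator_mult_integral_le) (auto intro: test_function_integrable_lborel t)
    also have "\<dots> \<le> l2 D (\<phi> n) * ?c1" by (rule integral_abs_test_function_le[OF t])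
    also have "\<dots> \<le> B * ?c1" by (intro mult_right_mono B) simp
    finally show ?thesis .
  qed
  interpret subseqs "\<lambda>m s. convergent (\<lambda>n. a (s n) m)"
  proof
    fix m and s :: "nat \<Rightarrow> nat"
    have "bounded (range (\<lambda>n. a (s n) m))"
      using a_bound by (auto simp: bounded_iff)
    then obtain l r where "strict_mono r" "((\<lambda>n. a (s n) m) \<circ> r) \<longlonglongrightarrow> l"
      using bounded_imp_convergent_subsequence by blast
    then show "\<exists>r'. strict_mono r' \<and> convergent (\<lambda>n. a ((s \<circ> r') n) m)"
      by (auto simp: convergent_def o_def)
  qed
  define r where "r = diagseq"
  have r: "strict_mono r" unfolding r_def by (rule subseq_diagseq)
  have conv: "convergent (\<lambda>n. a (r n) m)" for m
  proof -
    \<comment> \<open>The diagonal sequence is a subsequence of the \<open>m\<close>-th selection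
      only from position \<open>Suc m\<close> on; the initial segment does not affect
      convergence.\<close>
    have "convergent (\<lambda>n. a ((diagseq \<circ> ((+) (Suc m))) n) m)"
    proof (rule diagseq_holds)
      fix r s :: "nat \<Rightarrow> nat" and n assume "strict_mono r" "convergent (\<lambda>i. a (s i) n)"
      then show "convergent (\<lambda>i. a ((s \<circ> r) i) n)"
        using convergent_subseq_convergent[of "\<lambda>i. a (s i) n" r] by (simp add: o_def)
    qed
    then have "convergent (\<lambda>n. a (r (n + Suc m)) m)" by (simp add: r_def add.commute)
    then show ?thesis using convergent_ignore_initial_segment[of "\<lambda>n. a (r n) m" "Suc m"] by simp
  qed
  have avg_a: "grid_average (\<delta> j) (\<phi> n) x = a n (to_nat (j, grid_cell (\<delta> j) x)) / \<delta> j ^ CARD('n)" for j n x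
    by (simp add: grid_average_def a_def)
  define b where "b j x = lim (\<lambda>n. grid_average (\<delta> j) (\<phi> (r n)) x)" for j x
  have b: "(\<lambda>n. grid_average (\<delta> j) (\<phi> (r n)) x) \<longlonglongrightarrow> b j x" for j x
  proof -
    obtain l where "(\<lambda>n. a (r n) (to_nat (j, grid_cell (\<delta> j) x))) \<longlonglongrightarrow> l" using conv unfolding convergent_def by blast
    then have "(\<lambda>n. grid_average (\<delta> j) (\<phi> (r n)) x) \<longlonglongrightarrow> l / \<delta> j ^ CARD('n)"
      unfolding avg_a using \<delta>[of j] by (intro tendsto_divide) auto
    then show ?thesis unfolding b_def by (metis limI)
  qed
  have avg_bd: "\<bar>grid_average (\<delta> j) (\<phi> n) x\<bar> \<le> B * ?c1 / \<delta> j ^ CARD('n)" for j n x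
    unfolding avg_a using a_bound \<delta>[of j] by (simp add: abs_divide divide_right_mono)
  have b_bd: "\<bar>b j x\<bar> \<le> B * ?c1 / \<delta> j ^ CARD('n)" for j x
    using tendsto_rabs[OF b[of j x]] avg_bd by (intro LIMSEQ_le_const2[of "\<lambda>n. \<bar>grid_average (\<delta> j) (\<phi> (r n)) x\<bar>"]) auto
  have b_meas: "b j \<in> borel_measurable (lebesgue_on D)" for j
    by (rule borel_measurable_lebesgue_on, rule borel_measurable_LIMSEQ_metric[OF grid_average_measurable b])
  have b_L2: "L2_on D (b j)" for j
    by (rule L2_on_bounded[OF b_meas]) (use b_bd in simp)
  have avg_L2: "L2_on D (grid_average (\<delta> j) (\<phi> n))" for j n by (rule grid_average_L2[OF t \<delta>])
  \<comment> \<open>At a fixed scale the averages are uniformly bounded, so pointwise convergence on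
    the set \<open>D\<close> of finite measure becomes convergence in L2.\<close>
  have b_lim: "(\<lambda>n. l2 D (\<lambda>x. grid_average (\<delta> j) (\<phi> (r n)) x - b j x)) \<longlonglongrightarrow> 0" for j
  proof (rule l2_tendsto_dominated[where h = "\<lambda>_. 2 * (B * ?c1 / \<delta> j ^ CARD('n))"])
    show "(\<lambda>x. grid_average (\<delta> j) (\<phi> (r n)) x - b j x) \<in> borel_measurable (lebesgue_on D)" for n
      using L2_on_measurable[OF avg_L2[of j "r n"]] b_meas[of j] by measurable
    have "norm (grid_average (\<delta> j) (\<phi> (r n)) x - b j x) \<le> norm (2 * (B * ?c1 / \<delta> j ^ CARD('n)))" for n x
      using avg_bd[of j "r n" x] b_bd[of j x] unfolding real_norm_def by linarith
    then show "AE x in lebesgue_on D. norm (grid_average (\<delta> j) (\<phi> (r n)) x - b j x) \<le> norm (2 * (B * ?c1 / \<delta> j ^ CARD('n)))" for n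
      by (intro AE_I2)
    show "AE x in lebesgue_on D. (\<lambda>n. grid_average (\<delta> j) (\<phi> (r n)) x - b j x) \<longlonglongrightarrow> 0"
      by (intro AE_I2 LIM_zero b)
  qed simp
  \<comment> \<open>The distance of \<phi> \<open>n\<close> to its average at scale
    \<open>\<delta> j\<close> is at most \<open>c * \<delta> j\<close> uniformly in
    \<open>n\<close>. A fine scale thus transfers the Cauchy property from the averages to the
    functions.\<close>
  define c where "c = sqrt (2 ^ CARD('n) * real CARD('n)) * B"
  have c0: "c \<ge> 0" using B0 by (simp add: c_def)
  have near: "l2 D (\<lambda>x. \<phi> n x - grid_average (\<delta> j) (\<phi> n) x) \<le> c * \<delta> j" for n j
  proof -
    have "sqrt (2 ^ CARD('n) * real CARD('n)) * \<delta> j * l2 D (grad (\<phi> n)) \<le> sqrt (2 ^ CARD('n) * real CARD('n)) * \<delta> j * B"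
      using \<delta>[of j] by (intro mult_left_mono B) auto
    then show ?thesis using grid_estimate_l2[OF t \<delta>, of n j] by (simp add: c_def mult_ac)
  qed
  have L: "L2_on D (\<phi> n)" for n by (rule test_function_L2[OF t])
  have "\<exists>N. \<forall>m\<ge>N. \<forall>n\<ge>N. l2 D (\<lambda>x. \<phi> (r m) x - \<phi> (r n) x) < e" if e: "e > 0" for e
  proof -
    have "(\<lambda>j. c * \<delta> j) \<longlonglongrightarrow> c * 0"
      unfolding \<delta>_def by (intro tendsto_mult_left LIMSEQ_inverse_real_of_nat)
    then obtain j where j: "c * \<delta> j < e / 4"
      using order_tendstoD(2)[of _ "c * 0" sequentially "e / 4"] e by (force simp: eventually_sequentially)
    obtain N where N: "\<And>n. n \<ge> N \<Longrightarrow> l2 D (\<lambda>x. grid_average (\<delta> j) (\<phi> (r n)) x - b j x) < e / 4"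
      using order_tendstoD(2)[OF b_lim[of j], of "e / 4"] e by (auto simp: eventually_sequentially)
    have close: "l2 D (\<lambda>x. \<phi> (r n) x - b j x) < e / 2" if "n \<ge> N" for n
      using l2_triangle3[OF L avg_L2 b_L2, of "r n" j j "r n"] near[of "r n" j] N[OF that] j by linarith
    have "l2 D (\<lambda>x. \<phi> (r m) x - \<phi> (r n) x) < e" if "m \<ge> N" "n \<ge> N" for m n
      using l2_triangle3[OF L[of "r m"] b_L2[of j] L[of "r n"]] close[OF that(1)] close[OF that(2)]
        l2_commute[of D "b j" "\<phi> (r n)"] by linarith
    then show ?thesis by blast
  qed
  from L2_complete[of "\<lambda>n. \<phi> (r n)", OF L this] show ?thesis using that[OF r] by blast
qed

end

section \<open>Calculus in the Sobolev space\<close>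

text \<open>\<open>u \<in> H\<^sup>1\<^sub>0(D)\<close> together with the gradient obtained as the limit of the gradients of the
  approximating test functions.\<close>

definition sobolev0 :: "(real^'n) set \<Rightarrow> (real^'n \<Rightarrow> real) \<Rightarrow> (real^'n \<Rightarrow> real^'n) \<Rightarrow> bool" where
  "sobolev0 D u G \<longleftrightarrow> L2_on D u \<and> L2_on D G \<and>
     (\<forall>e>0. \<exists>\<phi>. test_function D \<phi> \<and> l2 D (\<lambda>x. \<phi> x - u x) < e \<and> l2 D (\<lambda>x. grad \<phi> x - G x) < e)"

lemma sobolev0_L2: "sobolev0 D u G \<Longrightarrow> L2_on D u" "sobolev0 D u G \<Longrightarrow> L2_on D G"
  by (simp_all add: sobolev0_def)

lemma sobolev0_measurable [measurable_dest]:
  "sobolev0 D u G \<Longrightarrow> u \<in> borel_measurable (lebesgue_on D)"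
  "sobolev0 D u G \<Longrightarrow> G \<in> borel_measurable (lebesgue_on D)"
  by (simp_all add: sobolev0_def L2_on_def)

lemma sobolev0_obtain:
  assumes "sobolev0 D u G"
  obtains \<phi> where "\<And>n::nat. test_function D (\<phi> n)" "(\<lambda>n. l2 D (\<lambda>x. \<phi> n x - u x)) \<longlonglongrightarrow> 0"
    "(\<lambda>n. l2 D (\<lambda>x. grad (\<phi> n) x - G x)) \<longlonglongrightarrow> 0"
proof -
  define e where "e n = inverse (real (Suc n))" for n
  have "\<forall>n. \<exists>\<phi>. test_function D \<phi> \<and> l2 D (\<lambda>x. \<phi> x - u x) < e n \<and> l2 D (\<lambda>x. grad \<phi> x - G x) < e n"
    using assms by (auto simp: sobolev0_def e_def)
  then obtain \<phi> where \<phi>: "\<And>n. test_function D (\<phi> n)" "\<And>n. l2 D (\<lambda>x. \<phi> n x - u x) < e n"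
      "\<And>n. l2 D (\<lambda>x. grad (\<phi> n) x - G x) < e n"
    by metis
  have e: "e \<longlonglongrightarrow> 0" unfolding e_def by (rule LIMSEQ_inverse_real_of_nat)
  have "(\<lambda>n. l2 D (\<lambda>x. \<phi> n x - u x)) \<longlonglongrightarrow> 0"
    by (rule Lim_null_comparison[OF always_eventually e]) (use \<phi>(2) in \<open>simp add: less_imp_le\<close>)
  moreover have "(\<lambda>n. l2 D (\<lambda>x. grad (\<phi> n) x - G x)) \<longlonglongrightarrow> 0"
    by (rule Lim_null_comparison[OF always_eventually e]) (use \<phi>(3) in \<open>simp add: less_imp_le\<close>)
  ultimately show ?thesis using that \<phi>(1) by blast
qed

lemma norm_scaleR_le: "norm v \<le> c \<Longrightarrow> norm (a *\<^sub>R v) \<le> c * norm a"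
  for v :: "'a::real_normed_vector" and a :: real
  using mult_left_mono[of "norm v" c "\<bar>a\<bar>"] by (simp add: mult.commute)

text \<open>The outer functions of the chain and product rules. The global bound on the derivative
  keeps gradients of compositions square integrable and makes composition Lipschitz in L2.\<close>

definition C1_Lipschitz :: "(real \<Rightarrow> real) \<Rightarrow> (real \<Rightarrow> real) \<Rightarrow> real \<Rightarrow> bool" where
  "C1_Lipschitz T T' C \<longleftrightarrow> (\<forall>t. (T has_real_derivative T' t) (at t)) \<and> continuous_on UNIV T' \<and> (\<forall>t. \<bar>T' t\<bar> \<le> C)"

lemma C1_Lipschitz_diff_le:
  assumes "C1_Lipschitz T T' C" shows "\<bar>T s - T t\<bar> \<le> C * \<bar>s - t\<bar>"
proof -
  have "norm (T s - T t) \<le> C * norm (s - t)"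
    using assms by (intro field_differentiable_bound[of UNIV T T']) (auto simp: C1_Lipschitz_def)
  then show ?thesis by simp
qed

lemma C1_Lipschitz_measurable:
  assumes "C1_Lipschitz T T' C"
  shows "T \<in> borel_measurable borel" "T' \<in> borel_measurable borel"
proof -
  have "continuous_on UNIV T" "continuous_on UNIV T'"
    using assms DERIV_isCont[of T] unfolding C1_Lipschitz_def by (auto intro: continuous_at_imp_continuous_on)
  then show "T \<in> borel_measurable borel" "T' \<in> borel_measurable borel"
    by (simp_all add: borel_measurable_continuous_onI)
qed

lemma C1_Lipschitz_tendsto:
  assumes "C1_Lipschitz T T' C" "s \<longlonglongrightarrow> t"
  shows "(\<lambda>n. T (s n)) \<longlonglongrightarrow> T t" "(\<lambda>n. T' (s n)) \<longlonglongrightarrow> T' t"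
proof -
  have "isCont T t" "isCont T' t"
    using assms(1) DERIV_isCont[of T] unfolding C1_Lipschitz_def by (auto simp: continuous_on_eq_continuous_at)
  then show "(\<lambda>n. T (s n)) \<longlonglongrightarrow> T t" "(\<lambda>n. T' (s n)) \<longlonglongrightarrow> T' t"
    by (simp_all add: isCont_tendsto_compose[OF _ assms(2)])
qed

text \<open>Weierstrass is applied to the derivative, and the polynomial found is integrated from 0.
  This controls function and derivative together, and \<open>P 0 = T 0\<close> holds exactly, so
  compact supports survive when \<open>T 0 = 0\<close>.\<close>

lemma C1_polynomial_approximation:
  assumes T: "C1_Lipschitz T T' C" and "R \<ge> 0" "e > 0"
  obtains P p where "real_polynomial_function P" "\<And>t. (P has_real_derivative p t) (at t)" "P 0 = T 0"
    "\<And>t. \<bar>t\<bar> \<le> R \<Longrightarrow> \<bar>P t - T t\<bar> \<le> e" "\<And>t. \<bar>t\<bar> \<le> R \<Longrightarrow> \<bar>p t - T' t\<bar> \<le> e"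
proof -
  \<comment> \<open>Integrating an error \<open>e'\<close> over a length of at most \<open>R\<close>
    must cost no more than \<open>e\<close>; the denominator \<open>R + 1\<close> also gives
    \<open>e' \<le> e\<close> and is nonzero for \<open>R = 0\<close>.\<close>
  define e' where "e' = e / (R + 1)"
  have e': "e' > 0" "e' \<le> e" "e' * R \<le> e"
    using assms by (auto simp: e'_def field_simps)
  have "continuous_on {-R..R} T'"
    using T unfolding C1_Lipschitz_def by (blast intro: continuous_on_subset)
  then obtain p where p: "real_polynomial_function p" "\<And>t. t \<in> {-R..R} \<Longrightarrow> \<bar>T' t - p t\<bar> < e'"
    using Stone_Weierstrass_real_polynomial_function[of "{-R..R}" T' e'] e' by auto
  obtain a n where pa: "p = (\<lambda>t. \<Sum>i\<le>n. a i * t ^ i)"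
    using p(1) by (auto simp: real_polynomial_function_iff_sum)
  define P where "P t = T 0 + (\<Sum>i\<le>n. a i * t ^ Suc i / real (Suc i))" for t
  have mono: "real_polynomial_function (\<lambda>t::real. t ^ k)" for k
    by (induction k) (simp_all add: real_polynomial_function.intros(2)
        real_polynomial_function.intros(4)[OF real_polynomial_function.intros(1)[OF bounded_linear_ident]])
  have "real_polynomial_function (\<lambda>t. a i / real (Suc i) * t ^ Suc i)" for i
    by (intro real_polynomial_function.intros(4) real_polynomial_function.intros(2) mono)
  then have "real_polynomial_function P"
    unfolding P_def[abs_def]
    by (intro real_polynomial_function.intros(3) real_polynomial_function.intros(2) real_polynomial_function_sum) auto
  moreover have dP: "(P has_real_derivative p t) (at t)" for t
    unfolding P_def[abs_def] pa
    by (auto intro!: derivative_eq_intros sum.cong simp del: power_Suc of_nat_Suc)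
  moreover have "P 0 = T 0" by (simp add: P_def)
  moreover have "\<bar>P t - T t\<bar> \<le> e" if t: "\<bar>t\<bar> \<le> R" for t
  proof -
    have "norm ((P t - T t) - (P 0 - T 0)) \<le> e' * norm (t - 0)"
    proof (rule field_differentiable_bound[of "{-R..R}" "\<lambda>t. P t - T t" "\<lambda>t. p t - T' t"])
      show "((\<lambda>t. P t - T t) has_field_derivative p t - T' t) (at t within {-R..R})" for t
        by (rule has_field_derivative_at_within, rule DERIV_diff[OF dP]) (use T in \<open>simp add: C1_Lipschitz_def\<close>)
      show "norm (p t - T' t) \<le> e'" if "t \<in> {-R..R}" for t
        using p(2)[OF that] by (simp add: abs_minus_commute)
    qed (use t assms in auto)
    also have "\<dots> \<le> e' * R" using t e' by (intro mult_left_mono) auto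
    finally show ?thesis using \<open>P 0 = T 0\<close> e' by simp
  qed
  moreover have "\<bar>p t - T' t\<bar> \<le> e" if "\<bar>t\<bar> \<le> R" for t
  proof -
    have "t \<in> {-R..R}" using that by auto
    then show ?thesis using p(2)[of t] e' by linarith
  qed
  ultimately show ?thesis by (rule that)
qed

context bounded_open
begin

lemma sobolev0_test_function: "test_function D \<phi> \<Longrightarrow> sobolev0 D \<phi> (grad \<phi>)"
  unfolding sobolev0_def using test_function_L2[of \<phi>] by (auto intro!: exI[of _ \<phi>])

lemma sobolev0_closed:
  assumes s: "\<And>n. sobolev0 D (u n) (G n)" and L: "L2_on D v" "L2_on D H"
    and "(\<lambda>n. l2 D (\<lambda>x. u n x - v x)) \<longlonglongrightarrow> 0" "(\<lambda>n. l2 D (\<lambda>x. G n x - H x)) \<longlonglongrightarrow> 0"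
  shows "sobolev0 D v H"
  unfolding sobolev0_def
proof (intro conjI allI impI L)
  fix e :: real assume "e > 0"
  then have "eventually (\<lambda>n. l2 D (\<lambda>x. u n x - v x) < e / 2 \<and> l2 D (\<lambda>x. G n x - H x) < e / 2) sequentially"
    using assms(4,5) by (intro eventually_conj order_tendstoD) auto
  then obtain n where n: "l2 D (\<lambda>x. u n x - v x) < e / 2" "l2 D (\<lambda>x. G n x - H x) < e / 2"
    by (auto simp: eventually_sequentially)
  obtain \<phi> where \<phi>: "test_function D \<phi>" "l2 D (\<lambda>x. \<phi> x - u n x) < e / 2" "l2 D (\<lambda>x. grad \<phi> x - G n x) < e / 2"
    using s[of n] \<open>e > 0\<close> unfolding sobolev0_def by (meson half_gt_zero)
  have "l2 D (\<lambda>x. \<phi> x - v x) < e" "l2 D (\<lambda>x. grad \<phi> x - H x) < e"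
    using l2_triangle3[OF test_function_L2(1)[OF \<phi>(1)] sobolev0_L2(1)[OF s] L(1), of n]
      l2_triangle3[OF test_function_L2(2)[OF \<phi>(1)] sobolev0_L2(2)[OF s] L(2), of n] n \<phi> by linarith+
  then show "\<exists>\<phi>. test_function D \<phi> \<and> l2 D (\<lambda>x. \<phi> x - v x) < e \<and> l2 D (\<lambda>x. grad \<phi> x - H x) < e"
    using \<phi>(1) by blast
qed

lemma sobolev0_lincomb:
  assumes u: "sobolev0 D u G" and v: "sobolev0 D v H"
  shows "sobolev0 D (\<lambda>x. a * u x + b * v x) (\<lambda>x. a *\<^sub>R G x + b *\<^sub>R H x)"
proof -
  obtain \<phi> where \<phi>: "\<And>n::nat. test_function D (\<phi> n)" "(\<lambda>n. l2 D (\<lambda>x. \<phi> n x - u x)) \<longlonglongrightarrow> 0"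
    "(\<lambda>n. l2 D (\<lambda>x. grad (\<phi> n) x - G x)) \<longlonglongrightarrow> 0" by (rule sobolev0_obtain[OF u]) (rule that)
  obtain \<psi> where \<psi>: "\<And>n::nat. test_function D (\<psi> n)" "(\<lambda>n. l2 D (\<lambda>x. \<psi> n x - v x)) \<longlonglongrightarrow> 0"
    "(\<lambda>n. l2 D (\<lambda>x. grad (\<psi> n) x - H x)) \<longlonglongrightarrow> 0" by (rule sobolev0_obtain[OF v]) (rule that)
  note Lu = sobolev0_L2[OF u] and Lv = sobolev0_L2[OF v]
  have lim: "(\<lambda>n. l2 D (\<lambda>x. (a *\<^sub>R p n x + b *\<^sub>R q n x) - (a *\<^sub>R p' x + b *\<^sub>R q' x))) \<longlonglongrightarrow> 0"
    if L: "\<And>n. L2_on D (p n)" "\<And>n. L2_on D (q n)" "L2_on D p'" "L2_on D q'"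
     and l: "(\<lambda>n. l2 D (\<lambda>x. p n x - p' x)) \<longlonglongrightarrow> 0" "(\<lambda>n. l2 D (\<lambda>x. q n x - q' x)) \<longlonglongrightarrow> 0"
    for p q :: "nat \<Rightarrow> real^'n \<Rightarrow> 'b::euclidean_space" and p' q'
  proof (rule Lim_null_comparison[OF always_eventually])
    show "\<forall>n. norm (l2 D (\<lambda>x. (a *\<^sub>R p n x + b *\<^sub>R q n x) - (a *\<^sub>R p' x + b *\<^sub>R q' x)))
       \<le> \<bar>a\<bar> * l2 D (\<lambda>x. p n x - p' x) + \<bar>b\<bar> * l2 D (\<lambda>x. q n x - q' x)"
    proof
      fix n
      have "l2 D (\<lambda>x. a *\<^sub>R (p n x - p' x) + b *\<^sub>R (q n x - q' x))
          \<le> l2 D (\<lambda>x. a *\<^sub>R (p n x - p' x)) + l2 D (\<lambda>x. b *\<^sub>R (q n x - q' x))"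
        by (intro l2_triangle L2_on_scaleR L2_on_diff L)
      moreover have "(\<lambda>x. a *\<^sub>R (p n x - p' x) + b *\<^sub>R (q n x - q' x)) = (\<lambda>x. (a *\<^sub>R p n x + b *\<^sub>R q n x) - (a *\<^sub>R p' x + b *\<^sub>R q' x))"
        by (simp add: algebra_simps fun_eq_iff)
      ultimately show "norm (l2 D (\<lambda>x. (a *\<^sub>R p n x + b *\<^sub>R q n x) - (a *\<^sub>R p' x + b *\<^sub>R q' x)))
       \<le> \<bar>a\<bar> * l2 D (\<lambda>x. p n x - p' x) + \<bar>b\<bar> * l2 D (\<lambda>x. q n x - q' x)"
        by (simp add: l2_scaleR)
    qed
    have "(\<lambda>n. \<bar>a\<bar> * l2 D (\<lambda>x. p n x - p' x) + \<bar>b\<bar> * l2 D (\<lambda>x. q n x - q' x)) \<longlonglongrightarrow> \<bar>a\<bar> * 0 + \<bar>b\<bar> * 0"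
      by (intro tendsto_intros l)
    then show "(\<lambda>n. \<bar>a\<bar> * l2 D (\<lambda>x. p n x - p' x) + \<bar>b\<bar> * l2 D (\<lambda>x. q n x - q' x)) \<longlonglongrightarrow> 0" by simp
  qed
  show ?thesis
  proof (rule sobolev0_closed)
    fix n
    have "test_function D (\<lambda>x. a * \<phi> n x + b * \<psi> n x)"
      by (intro test_function_add test_function_scale \<phi> \<psi>)
    note st = sobolev0_test_function[OF this]
    have "grad (\<lambda>x. a * \<phi> n x + b * \<psi> n x) = (\<lambda>x. a *\<^sub>R grad (\<phi> n) x + b *\<^sub>R grad (\<psi> n) x)"
      using test_function_smooth[OF \<phi>(1)[of n]] test_function_smooth[OF \<psi>(1)[of n]]
      by (intro ext) (simp add: grad_add grad_scale smooth_mult smooth_const)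
    with st show "sobolev0 D (\<lambda>x. a *\<^sub>R \<phi> n x + b *\<^sub>R \<psi> n x) (\<lambda>x. a *\<^sub>R grad (\<phi> n) x + b *\<^sub>R grad (\<psi> n) x)"
      by simp
  next
    show "L2_on D (\<lambda>x. a * u x + b * v x)" "L2_on D (\<lambda>x. a *\<^sub>R G x + b *\<^sub>R H x)"
      using L2_on_add[OF L2_on_scaleR[OF Lu(1), of a] L2_on_scaleR[OF Lv(1), of b]]
        L2_on_add[OF L2_on_scaleR[OF Lu(2), of a] L2_on_scaleR[OF Lv(2), of b]] by simp_all
    show "(\<lambda>n. l2 D (\<lambda>x. (a *\<^sub>R \<phi> n x + b *\<^sub>R \<psi> n x) - (a * u x + b * v x))) \<longlonglongrightarrow> 0"
      using lim[OF test_function_L2(1)[OF \<phi>(1)] test_function_L2(1)[OF \<psi>(1)] Lu(1) Lv(1) \<phi>(2) \<psi>(2)] by simp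
    show "(\<lambda>n. l2 D (\<lambda>x. (a *\<^sub>R grad (\<phi> n) x + b *\<^sub>R grad (\<psi> n) x) - (a *\<^sub>R G x + b *\<^sub>R H x))) \<longlonglongrightarrow> 0"
      using lim[OF test_function_L2(2)[OF \<phi>(1)] test_function_L2(2)[OF \<psi>(1)] Lu(2) Lv(2) \<phi>(3) \<psi>(3)] by simp
  qed
qed

lemma sobolev0_diff: "sobolev0 D u G \<Longrightarrow> sobolev0 D v H \<Longrightarrow> sobolev0 D (\<lambda>x. u x - v x) (\<lambda>x. G x - H x)"
  by (drule (1) sobolev0_lincomb[where a = 1 and b = "-1"]) simp

lemma sobolev0_H1_gradient:
  assumes s: "sobolev0 D u G" shows "H1_gradient D u G"
  unfolding H1_gradient_def
proof (intro conjI allI impI sobolev0_L2[OF s])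
  fix \<psi> i assume t: "test_function D \<psi>"
  obtain \<phi> where \<phi>: "\<And>n::nat. test_function D (\<phi> n)" "(\<lambda>n. l2 D (\<lambda>x. \<phi> n x - u x)) \<longlonglongrightarrow> 0"
    "(\<lambda>n. l2 D (\<lambda>x. grad (\<phi> n) x - G x)) \<longlonglongrightarrow> 0" by (rule sobolev0_obtain[OF s]) (rule that)
  have "(\<lambda>n. \<integral>x. \<phi> n x \<bullet> partial_deriv i \<psi> x \<partial>lebesgue_on D) \<longlonglongrightarrow> (\<integral>x. u x \<bullet> partial_deriv i \<psi> x \<partial>lebesgue_on D)"
    by (rule tendsto_inner_L2_left[OF test_function_L2(1)[OF \<phi>(1)] sobolev0_L2(1)[OF s] \<phi>(2) test_function_L2(1)[OF test_function_partial_deriv[OF t]]])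
  \<comment> \<open>Testing against the field with \<psi> in the \<open>i\<close>-th slot expresses
    the component integral as an inner product of vector fields.\<close>
  moreover have "(\<lambda>n. \<integral>x. grad (\<phi> n) x \<bullet> (\<psi> x *\<^sub>R axis i 1) \<partial>lebesgue_on D) \<longlonglongrightarrow> (\<integral>x. G x \<bullet> (\<psi> x *\<^sub>R axis i 1) \<partial>lebesgue_on D)"
  proof (rule tendsto_inner_L2_left[OF test_function_L2(2)[OF \<phi>(1)] sobolev0_L2(2)[OF s] \<phi>(3)])
    show "L2_on D (\<lambda>x. \<psi> x *\<^sub>R axis i (1::real))"
      by (rule L2_on_bound[OF test_function_L2(1)[OF t], of _ 1]) (use test_function_L2(1)[OF t] in auto)
  qed
  then have "(\<lambda>n. - (\<integral>x. partial_deriv i (\<phi> n) x * \<psi> x \<partial>lebesgue_on D)) \<longlonglongrightarrow> - (\<integral>x. G x $ i * \<psi> x \<partial>lebesgue_on D)"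
    by (intro tendsto_minus) (simp add: inner_axis mult.commute)
  ultimately show "(\<integral>x. u x * partial_deriv i \<psi> x \<partial>lebesgue_on D) = - (\<integral>x. G x $ i * \<psi> x \<partial>lebesgue_on D)"
    using integration_by_parts[OF \<phi>(1) t] by (intro LIMSEQ_unique) simp_all
qed

text \<open>Against a gradient of a test function \<psi>, either distributional gradient of
  \<open>u\<close> gives minus the integral of \<open>u\<close> times the Laplacian of \<psi>; the
  general \<Phi> is a limit of such gradients. This allows the gradients chosen in
  \<open>weak_solution\<close> to be exchanged without comparing them pointwise.\<close>

lemma integral_inner_gradient_eq:
  assumes U: "H1_gradient D u U" and G: "H1_gradient D u G" and s: "sobolev0 D \<phi> \<Phi>"
  shows "(\<integral>x. U x \<bullet> \<Phi> x \<partial>lebesgue_on D) = (\<integral>x. G x \<bullet> \<Phi> x \<partial>lebesgue_on D)"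
proof -
  have test: "(\<integral>x. grad \<psi> x \<bullet> U x \<partial>lebesgue_on D) = - (\<Sum>i\<in>UNIV. \<integral>x. u x * partial_deriv i (partial_deriv i \<psi>) x \<partial>lebesgue_on D)"
    if U: "H1_gradient D u U" and t: "test_function D \<psi>" for U \<psi>
  proof -
    have LU: "L2_on D U" using U by (simp add: H1_gradient_def)
    have LUi: "L2_on D (\<lambda>x. U x $ i)" for i
    proof (rule L2_on_bound[OF LU, of _ 1])
      have "(\<lambda>x. U x \<bullet> axis i 1) \<in> borel_measurable (lebesgue_on D)"
        using LU by measurable
      then show "(\<lambda>x. U x $ i) \<in> borel_measurable (lebesgue_on D)" by (simp add: inner_axis)
      show "AE x in lebesgue_on D. norm (U x $ i) \<le> 1 * norm (U x)"
        by (intro AE_I2) (use component_le_norm_cart in simp)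
    qed
    have "(\<integral>x. grad \<psi> x \<bullet> U x \<partial>lebesgue_on D) = (\<integral>x. (\<Sum>i\<in>UNIV. U x $ i * partial_deriv i \<psi> x) \<partial>lebesgue_on D)"
      by (simp add: inner_vec_def mult.commute)
    also have "\<dots> = (\<Sum>i\<in>UNIV. \<integral>x. U x $ i * partial_deriv i \<psi> x \<partial>lebesgue_on D)"
      by (intro Bochner_Integration.integral_sum L2_on_mult_integrable LUi test_function_L2 test_function_partial_deriv t)
    also have "\<dots> = (\<Sum>i\<in>UNIV. - (\<integral>x. u x * partial_deriv i (partial_deriv i \<psi>) x \<partial>lebesgue_on D))"
      using U test_function_partial_deriv[OF t] by (intro sum.cong) (auto simp: H1_gradient_def)
    finally show ?thesis by (simp add: sum_negf)
  qed
  obtain \<psi> where \<psi>: "\<And>n::nat. test_function D (\<psi> n)" "(\<lambda>n. l2 D (\<lambda>x. grad (\<psi> n) x - \<Phi> x)) \<longlonglongrightarrow> 0"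
    by (rule sobolev0_obtain[OF s]) (rule that)
  have L: "L2_on D U" "L2_on D G" using U G by (auto simp: H1_gradient_def)
  have "(\<lambda>n. \<integral>x. grad (\<psi> n) x \<bullet> U x \<partial>lebesgue_on D) \<longlonglongrightarrow> (\<integral>x. \<Phi> x \<bullet> U x \<partial>lebesgue_on D)"
    "(\<lambda>n. \<integral>x. grad (\<psi> n) x \<bullet> G x \<partial>lebesgue_on D) \<longlonglongrightarrow> (\<integral>x. \<Phi> x \<bullet> G x \<partial>lebesgue_on D)"
    by (rule tendsto_inner_L2_left[OF test_function_L2(2)[OF \<psi>(1)] sobolev0_L2(2)[OF s] \<psi>(2)], fact L)+
  then have "(\<integral>x. \<Phi> x \<bullet> U x \<partial>lebesgue_on D) = (\<integral>x. \<Phi> x \<bullet> G x \<partial>lebesgue_on D)"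
    unfolding test[OF U \<psi>(1)] test[OF G \<psi>(1)] by (rule LIMSEQ_unique)
  then show ?thesis by (simp add: inner_commute)
qed

text \<open>The integral in \<open>H10\<close> is the sum of two squared L2 distances, so it tends
  to 0 exactly when both distances do. In the backward direction the limit gradient is
  distributional by \<open>sobolev0_H1_gradient\<close>.\<close>

lemma H10_iff_sobolev0: "u \<in> H10 D \<longleftrightarrow> (\<exists>G. sobolev0 D u G)"
proof
  assume "u \<in> H10 D"
  then obtain G \<phi> where G: "H1_gradient D u G" and \<phi>: "\<And>n::nat. test_function D (\<phi> n)"
    and lim: "(\<lambda>n. \<integral>x. (\<phi> n x - u x)\<^sup>2 + (norm (grad (\<phi> n) x - G x))\<^sup>2 \<partial>lebesgue_on D) \<longlonglongrightarrow> 0"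
    by (auto simp: H10_def)
  have L: "L2_on D u" "L2_on D G" using G by (auto simp: H1_gradient_def)
  have "(\<integral>x. (\<phi> n x - u x)\<^sup>2 + (norm (grad (\<phi> n) x - G x))\<^sup>2 \<partial>lebesgue_on D)
     = (l2 D (\<lambda>x. \<phi> n x - u x))\<^sup>2 + (l2 D (\<lambda>x. grad (\<phi> n) x - G x))\<^sup>2" for n
    unfolding l2_square using L2_on_integrable[OF L2_on_diff[OF test_function_L2(1)[OF \<phi>[of n]] L(1)]]
      L2_on_integrable[OF L2_on_diff[OF test_function_L2(2)[OF \<phi>[of n]] L(2)]] by simp
  then have lim': "(\<lambda>n. (l2 D (\<lambda>x. \<phi> n x - u x))\<^sup>2 + (l2 D (\<lambda>x. grad (\<phi> n) x - G x))\<^sup>2) \<longlonglongrightarrow> 0"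
    using lim by simp
  have "(\<lambda>n. (l2 D (\<lambda>x. \<phi> n x - u x))\<^sup>2) \<longlonglongrightarrow> 0" "(\<lambda>n. (l2 D (\<lambda>x. grad (\<phi> n) x - G x))\<^sup>2) \<longlonglongrightarrow> 0"
    by (rule Lim_null_comparison[OF always_eventually lim'], simp)+
  then have "(\<lambda>n. l2 D (\<lambda>x. \<phi> n x - u x)) \<longlonglongrightarrow> 0" "(\<lambda>n. l2 D (\<lambda>x. grad (\<phi> n) x - G x)) \<longlonglongrightarrow> 0"
    by (auto dest!: tendsto_real_sqrt)
  then have "sobolev0 D u G"
    by (rule sobolev0_closed[OF sobolev0_test_function[OF \<phi>] L])
  then show "\<exists>G. sobolev0 D u G" by blast
next
  assume "\<exists>G. sobolev0 D u G"
  then obtain G where s: "sobolev0 D u G" ..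
  then have L: "L2_on D u" "L2_on D G" by (auto dest: sobolev0_L2)
  obtain \<phi> where \<phi>: "\<And>n::nat. test_function D (\<phi> n)" "(\<lambda>n. l2 D (\<lambda>x. \<phi> n x - u x)) \<longlonglongrightarrow> 0"
    "(\<lambda>n. l2 D (\<lambda>x. grad (\<phi> n) x - G x)) \<longlonglongrightarrow> 0" by (rule sobolev0_obtain[OF s]) (rule that)
  have eq: "(\<integral>x. (\<phi> n x - u x)\<^sup>2 + (norm (grad (\<phi> n) x - G x))\<^sup>2 \<partial>lebesgue_on D)
     = (l2 D (\<lambda>x. \<phi> n x - u x))\<^sup>2 + (l2 D (\<lambda>x. grad (\<phi> n) x - G x))\<^sup>2" for n
    unfolding l2_square using L2_on_integrable[OF L2_on_diff[OF test_function_L2(1)[OF \<phi>(1)[of n]] L(1)]]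
      L2_on_integrable[OF L2_on_diff[OF test_function_L2(2)[OF \<phi>(1)[of n]] L(2)]] by simp
  have "(\<lambda>n. \<integral>x. (\<phi> n x - u x)\<^sup>2 + (norm (grad (\<phi> n) x - G x))\<^sup>2 \<partial>lebesgue_on D) \<longlonglongrightarrow> 0\<^sup>2 + 0\<^sup>2"
    unfolding eq by (intro tendsto_intros \<phi>)
  then show "u \<in> H10 D"
    using sobolev0_H1_gradient[OF s] \<phi>(1) by (auto simp: H10_def)
qed

lemma Poincare_sobolev0:
  obtains C where "C > 0" "\<And>u G. sobolev0 D u G \<Longrightarrow> l2 D u \<le> C * l2 D G"
proof -
  obtain C where C: "C \<ge> 0" "\<And>\<phi>. test_function D \<phi> \<Longrightarrow> l2 D \<phi> \<le> C * l2 D (grad \<phi>)"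
    by (rule Poincare_test_function) (rule that)
  \<comment> \<open>The summand 1 makes the constant strictly positive, so that later estimates may
    divide by it.\<close>
  have "l2 D u \<le> (C + 1) * l2 D G" if s: "sobolev0 D u G" for u G
  proof -
    obtain \<phi> where \<phi>: "\<And>n::nat. test_function D (\<phi> n)" "(\<lambda>n. l2 D (\<lambda>x. \<phi> n x - u x)) \<longlonglongrightarrow> 0"
      "(\<lambda>n. l2 D (\<lambda>x. grad (\<phi> n) x - G x)) \<longlonglongrightarrow> 0" by (rule sobolev0_obtain[OF s]) (rule that)
    have "l2 D u \<le> C * l2 D G"
      using tendsto_l2[OF test_function_L2(1)[OF \<phi>(1)] sobolev0_L2(1)[OF s] \<phi>(2)]
        tendsto_mult_left[OF tendsto_l2[OF test_function_L2(2)[OF \<phi>(1)] sobolev0_L2(2)[OF s] \<phi>(3)], of C]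
      by (rule LIMSEQ_le) (use C(2)[OF \<phi>(1)] in blast)
    also have "\<dots> \<le> (C + 1) * l2 D G" by (intro mult_right_mono) auto
    finally show ?thesis .
  qed
  then show ?thesis using that[of "C + 1"] C(1) by simp
qed

text \<open>Each \<open>u n\<close> is replaced by a test function within \<open>e n\<close> of it
  in value and gradient. The replacements have norms at most \<open>B + 1\<close>, and the errors
  disappear along any subsequence.\<close>

lemma Rellich_sobolev0:
  assumes s: "\<And>n. sobolev0 D (u n) (G n)" and B: "\<And>n. l2 D (u n) \<le> B" "\<And>n. l2 D (G n) \<le> B"
  obtains r v where "strict_mono (r :: nat \<Rightarrow> nat)" "L2_on D v" "(\<lambda>n. l2 D (\<lambda>x. u (r n) x - v x)) \<longlonglongrightarrow> 0"
proof -
  define e where "e n = inverse (real (Suc n))" for n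
  have e: "e \<longlonglongrightarrow> 0" "e n \<le> 1" for n unfolding e_def by (rule LIMSEQ_inverse_real_of_nat) (simp add: field_simps)
  have "\<forall>n. \<exists>\<phi>. test_function D \<phi> \<and> l2 D (\<lambda>x. \<phi> x - u n x) < e n \<and> l2 D (\<lambda>x. grad \<phi> x - G n x) < e n"
    using s by (auto simp: sobolev0_def e_def)
  then obtain \<phi> where \<phi>: "\<And>n. test_function D (\<phi> n)" "\<And>n. l2 D (\<lambda>x. \<phi> n x - u n x) < e n"
      "\<And>n. l2 D (\<lambda>x. grad (\<phi> n) x - G n x) < e n"
    by metis
  note L = sobolev0_L2[OF s] and T = test_function_L2[OF \<phi>(1)]
  have "l2 D (\<phi> n) \<le> B + 1" "l2 D (grad (\<phi> n)) \<le> B + 1" for n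
    using l2_le_diff[OF T(1)[of n] L(1)[of n]] l2_le_diff[OF T(2)[of n] L(2)[of n]] B[of n] \<phi>(2,3)[of n] e(2)[of n]
    by linarith+
  then obtain r v where r: "strict_mono r" "L2_on D v" "(\<lambda>n. l2 D (\<lambda>x. \<phi> (r n) x - v x)) \<longlonglongrightarrow> 0"
    by (rule Rellich_test_function[of \<phi>, OF \<phi>(1)]) (rule that)
  have "(\<lambda>n. l2 D (\<lambda>x. u (r n) x - v x)) \<longlonglongrightarrow> 0"
  proof (rule Lim_null_comparison[OF always_eventually])
    show "\<forall>n. norm (l2 D (\<lambda>x. u (r n) x - v x)) \<le> e (r n) + l2 D (\<lambda>x. \<phi> (r n) x - v x)"
    proof
      fix n
      show "norm (l2 D (\<lambda>x. u (r n) x - v x)) \<le> e (r n) + l2 D (\<lambda>x. \<phi> (r n) x - v x)"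
        using l2_triangle3[OF L(1)[of "r n"] T(1)[of "r n"] r(2)] \<phi>(2)[of "r n"] l2_commute[of D "u (r n)" "\<phi> (r n)"] by simp
    qed
    show "(\<lambda>n. e (r n) + l2 D (\<lambda>x. \<phi> (r n) x - v x)) \<longlonglongrightarrow> 0"
      using tendsto_add[OF LIMSEQ_subseq_LIMSEQ[OF e(1) r(1)] r(3)] by (simp add: o_def)
  qed
  with r show ?thesis by (intro that)
qed

text \<open>Two limits are taken. For a polynomial \<open>P n\<close> in place of \<open>T\<close>,
  the product of \<open>P n (\<psi> x)\<close> with test functions converging to \<open>u\<close>
  consists of test functions. Then \<open>P n\<close> tends to \<open>T\<close> together with its
  derivative, uniformly on the bounded range of \<psi>. Without the factor \<open>u\<close>,
  compactness of the support has to come from \<open>T 0 = 0\<close>.\<close>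

lemma sobolev0_compose_test_function:
  assumes T: "C1_Lipschitz T T' C" and u: "sobolev0 D u G" and t: "test_function D \<psi>"
  shows "sobolev0 D (\<lambda>x. u x * T (\<psi> x)) (\<lambda>x. T (\<psi> x) *\<^sub>R G x + (u x * T' (\<psi> x)) *\<^sub>R grad \<psi> x)"
    and "T 0 = 0 \<Longrightarrow> sobolev0 D (\<lambda>x. T (\<psi> x)) (\<lambda>x. T' (\<psi> x) *\<^sub>R grad \<psi> x)"
proof -
  note sm = test_function_smooth[OF t] and Lt = test_function_L2[OF t] and Lu = sobolev0_L2[OF u]
  note mT = C1_Lipschitz_measurable[OF T]
  note [measurable] = mT test_function_measurable[OF t, THEN borel_measurable_lebesgue_on] sobolev0_measurable[OF u]
  obtain K where K: "compact K" "K \<subseteq> D" "\<And>x. x \<notin> K \<Longrightarrow> \<psi> x = 0" "\<And>x. x \<notin> K \<Longrightarrow> grad \<psi> x = 0"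
    by (rule test_function_grad_support[OF t]) (rule that)
  obtain R where R: "R \<ge> 0" "\<And>x. norm (\<psi> x) \<le> R"
    by (rule compact_support_bounded[OF smooth_continuous[OF sm] K(1,3)]) (assumption, rule that)
  obtain R' where R': "R' \<ge> 0" "\<And>x. norm (grad \<psi> x) \<le> R'"
    by (rule compact_support_bounded[OF grad_continuous[OF sm] K(1,4)]) (assumption, rule that)
  define e where "e n = inverse (real (Suc n))" for n
  have e: "e \<longlonglongrightarrow> 0" "e n > 0" for n unfolding e_def by (rule LIMSEQ_inverse_real_of_nat) simp
  have "\<exists>P p. real_polynomial_function P \<and> (\<forall>t. (P has_real_derivative p t) (at t)) \<and> P 0 = T 0
    \<and> (\<forall>t. \<bar>t\<bar> \<le> R \<longrightarrow> \<bar>P t - T t\<bar> \<le> e n) \<and> (\<forall>t. \<bar>t\<bar> \<le> R \<longrightarrow> \<bar>p t - T' t\<bar> \<le> e n)" for n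
    by (rule C1_polynomial_approximation[OF T R(1) e(2)[of n]]) blast
  then obtain P p where Pp: "\<And>n. real_polynomial_function (P n)" "\<And>n t. (P n has_real_derivative p n t) (at t)"
    "\<And>n. P n 0 = T 0" "\<And>n t. \<bar>t\<bar> \<le> R \<Longrightarrow> \<bar>P n t - T t\<bar> \<le> e n" "\<And>n t. \<bar>t\<bar> \<le> R \<Longrightarrow> \<bar>p n t - T' t\<bar> \<le> e n"
    by metis
  have PT: "\<bar>P n (\<psi> x) - T (\<psi> x)\<bar> \<le> e n" and pT: "\<bar>p n (\<psi> x) - T' (\<psi> x)\<bar> \<le> e n" for n x
    using Pp(4,5) R(2)[of x] by auto
  have smP: "smooth (\<lambda>x. P n (\<psi> x))" for n by (rule smooth_polynomial[OF Pp(1) sm])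
  have gradP: "grad (\<lambda>x. P n (\<psi> x)) = (\<lambda>x. p n (\<psi> x) *\<^sub>R grad \<psi> x)" for n
    by (rule ext, rule grad_compose[OF Pp(2) sm])
  have boundT: "\<bar>T (\<psi> x)\<bar> \<le> \<bar>T 0\<bar> + C * R" and boundT': "\<bar>T' (\<psi> x)\<bar> \<le> C" for x
  proof -
    show "\<bar>T' (\<psi> x)\<bar> \<le> C" using T by (simp add: C1_Lipschitz_def)
    then have "C * \<bar>\<psi> x - 0\<bar> \<le> C * R" using R(2)[of x] by (intro mult_left_mono) auto
    then show "\<bar>T (\<psi> x)\<bar> \<le> \<bar>T 0\<bar> + C * R"
      using C1_Lipschitz_diff_le[OF T, of "\<psi> x" 0] by linarith
  qed
  have measP: "(\<lambda>x. P n (\<psi> x)) \<in> borel_measurable (lebesgue_on D)" for n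
    by (intro borel_measurable_lebesgue_on borel_measurable_continuous_onI smooth_continuous smP)
  have measgradP: "(\<lambda>x. p n (\<psi> x) *\<^sub>R grad \<psi> x) \<in> borel_measurable (lebesgue_on D)" for n
    unfolding gradP[symmetric] by (intro borel_measurable_lebesgue_on borel_measurable_continuous_onI grad_continuous smP)
  have small: "(\<lambda>n. e n * c) \<longlonglongrightarrow> 0" for c using tendsto_mult_left_zero[OF e(1)] .
  \<comment> \<open>Uniform error \<open>e n\<close> times a fixed square integrable majorant: the
    form taken by all the errors of the polynomial approximation.\<close>
  have unif: "(\<lambda>n. l2 D (F n)) \<longlonglongrightarrow> 0"
    if "L2_on D h" "\<And>n. F n \<in> borel_measurable (lebesgue_on D)" "\<And>n x. norm (F n x) \<le> norm (e n *\<^sub>R h x)"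
    for F :: "nat \<Rightarrow> real^'n \<Rightarrow> 'b::euclidean_space" and h :: "real^'n \<Rightarrow> 'c::euclidean_space"
  proof (rule Lim_null_comparison[OF always_eventually small[of "l2 D h"]], rule allI)
    fix n
    have "l2 D (F n) \<le> l2 D (\<lambda>x. e n *\<^sub>R h x)"
      by (rule l2_mono[OF L2_on_scaleR[OF that(1)] that(2)]) (use that(3) in auto)
    then show "norm (l2 D (F n)) \<le> e n * l2 D h" using e(2)[of n] by (simp add: l2_scaleR)
  qed
  have L1: "L2_on D (\<lambda>x. T (\<psi> x) *\<^sub>R G x)"
    by (rule L2_on_mult_bounded[OF Lu(2) _ boundT]) measurable
  have L3: "L2_on D (\<lambda>x. u x * T (\<psi> x))"
    using L2_on_mult_bounded[OF Lu(1) _ boundT] by (simp add: mult.commute)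
  have L2: "L2_on D (\<lambda>x. (u x * T' (\<psi> x)) *\<^sub>R grad \<psi> x)"
  proof (rule L2_on_bound[OF Lu(1), of _ "C * R'"])
    have "norm ((u x * T' (\<psi> x)) *\<^sub>R grad \<psi> x) \<le> C * R' * norm (u x)" for x
      using mult_mono[OF boundT'[of x] R'(2)[of x]] boundT'[of x] abs_ge_zero[of "T' (\<psi> x)"]
      by (simp add: abs_mult mult.assoc mult.commute[of _ "\<bar>u x\<bar>"] mult_left_mono)
    then show "AE x in lebesgue_on D. norm ((u x * T' (\<psi> x)) *\<^sub>R grad \<psi> x) \<le> C * R' * norm (u x)" by simp
  qed measurable
  show "sobolev0 D (\<lambda>x. u x * T (\<psi> x)) (\<lambda>x. T (\<psi> x) *\<^sub>R G x + (u x * T' (\<psi> x)) *\<^sub>R grad \<psi> x)"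
  proof (rule sobolev0_closed[OF _ L3 L2_on_add[OF L1 L2]])
    fix n
    obtain \<phi> where \<phi>: "\<And>n::nat. test_function D (\<phi> n)" "(\<lambda>n. l2 D (\<lambda>x. \<phi> n x - u x)) \<longlonglongrightarrow> 0"
      "(\<lambda>n. l2 D (\<lambda>x. grad (\<phi> n) x - G x)) \<longlonglongrightarrow> 0" by (rule sobolev0_obtain[OF u]) (rule that)
    define A where "A = \<bar>T 0\<bar> + C * R + e n"
    define A' where "A' = (C + e n) * R'"
    have PA: "\<bar>P n (\<psi> x)\<bar> \<le> A" for x using PT[of n x] boundT[of x] by (simp add: A_def)
    have "\<bar>p n (\<psi> x)\<bar> \<le> C + e n" for x using pT[of n x] boundT'[of x] by linarith
    then have gA: "norm (p n (\<psi> x) *\<^sub>R grad \<psi> x) \<le> A'" for x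
      unfolding A'_def norm_scaleR by (intro mult_mono R') (use order_trans[OF abs_ge_zero] in \<open>auto intro: order_trans\<close>)
    have lim: "(\<lambda>k. l2 D (F k)) \<longlonglongrightarrow> 0"
      if h: "\<And>k. L2_on D (h k)" "(\<lambda>k. l2 D (h k)) \<longlonglongrightarrow> 0" "\<And>k. F k \<in> borel_measurable (lebesgue_on D)"
      and le: "\<And>k x. norm (F k x) \<le> B * norm (h k x)"
      for F :: "nat \<Rightarrow> real^'n \<Rightarrow> 'b::euclidean_space" and h :: "nat \<Rightarrow> real^'n \<Rightarrow> 'c::euclidean_space" and B
    proof (rule Lim_null_comparison[OF always_eventually], rule allI)
      fix k
      have "l2 D (F k) \<le> l2 D (\<lambda>x. \<bar>B\<bar> *\<^sub>R h k x)"
        by (rule l2_mono[OF L2_on_scaleR[OF h(1)] h(3)], rule AE_I2)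
          (use order_trans[OF le[of k] mult_right_mono[OF abs_ge_self norm_ge_zero]] in simp)
      then show "norm (l2 D (F k)) \<le> \<bar>B\<bar> * l2 D (h k)" by (simp add: l2_scaleR)
      show "(\<lambda>k. \<bar>B\<bar> * l2 D (h k)) \<longlonglongrightarrow> 0" using tendsto_mult_right_zero[OF h(2)] .
    qed
    note L\<phi> = test_function_L2[OF \<phi>(1)]
    have L\<phi>': "L2_on D (\<lambda>x. \<phi> k x - u x)" "L2_on D (\<lambda>x. grad (\<phi> k) x - G x)" for k
      by (intro L2_on_diff L\<phi> Lu)+
    have g: "sobolev0 D (\<lambda>x. P n (\<psi> x) * \<phi> k x) (\<lambda>x. P n (\<psi> x) *\<^sub>R grad (\<phi> k) x + \<phi> k x *\<^sub>R (p n (\<psi> x) *\<^sub>R grad \<psi> x))" for k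
    proof -
      have "grad (\<lambda>x. P n (\<psi> x) * \<phi> k x) = (\<lambda>x. P n (\<psi> x) *\<^sub>R grad (\<phi> k) x + \<phi> k x *\<^sub>R (p n (\<psi> x) *\<^sub>R grad \<psi> x))"
        using grad_mult[OF smP[of n] test_function_smooth[OF \<phi>(1)[of k]]] by (auto simp: gradP)
      then show ?thesis
        using sobolev0_test_function[OF test_function_mult[OF smP[of n] \<phi>(1)[of k]]] by simp
    qed
    have M: "L2_on D (\<lambda>x. u x *\<^sub>R (p n (\<psi> x) *\<^sub>R grad \<psi> x))"
    proof (rule L2_on_bound[OF Lu(1), of _ A'])
      show "(\<lambda>x. u x *\<^sub>R (p n (\<psi> x) *\<^sub>R grad \<psi> x)) \<in> borel_measurable (lebesgue_on D)"
        using measgradP[of n] by measurable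
      show "AE x in lebesgue_on D. norm (u x *\<^sub>R (p n (\<psi> x) *\<^sub>R grad \<psi> x)) \<le> A' * norm (u x)"
        using gA by (intro AE_I2) (rule norm_scaleR_le)
    qed
    show "sobolev0 D (\<lambda>x. P n (\<psi> x) * u x) (\<lambda>x. P n (\<psi> x) *\<^sub>R G x + u x *\<^sub>R (p n (\<psi> x) *\<^sub>R grad \<psi> x))"
    proof (rule sobolev0_closed[OF g])
      show "L2_on D (\<lambda>x. P n (\<psi> x) * u x)"
        using L2_on_mult_bounded[OF Lu(1) measP PA] by simp
      show "L2_on D (\<lambda>x. P n (\<psi> x) *\<^sub>R G x + u x *\<^sub>R (p n (\<psi> x) *\<^sub>R grad \<psi> x))"
        by (intro L2_on_add L2_on_mult_bounded[OF Lu(2) measP PA] M)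
      show "(\<lambda>k. l2 D (\<lambda>x. P n (\<psi> x) * \<phi> k x - P n (\<psi> x) * u x)) \<longlonglongrightarrow> 0"
      proof (rule lim[OF L\<phi>'(1) \<phi>(2), of _ A])
        fix k show "(\<lambda>x. P n (\<psi> x) * \<phi> k x - P n (\<psi> x) * u x) \<in> borel_measurable (lebesgue_on D)"
          using measP[of n] L\<phi>(1)[of k] Lu(1) by measurable
        fix x show "norm (P n (\<psi> x) * \<phi> k x - P n (\<psi> x) * u x) \<le> A * norm (\<phi> k x - u x)"
          using PA[of x] by (simp add: abs_mult mult_right_mono flip: right_diff_distrib)
      qed
      have l1: "(\<lambda>k. l2 D (\<lambda>x. P n (\<psi> x) *\<^sub>R (grad (\<phi> k) x - G x))) \<longlonglongrightarrow> 0"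
      proof (rule lim[OF L\<phi>'(2) \<phi>(3), of _ A])
        fix k show "(\<lambda>x. P n (\<psi> x) *\<^sub>R (grad (\<phi> k) x - G x)) \<in> borel_measurable (lebesgue_on D)"
          using measP[of n] L\<phi>(2)[of k] Lu(2) by measurable
        fix x show "norm (P n (\<psi> x) *\<^sub>R (grad (\<phi> k) x - G x)) \<le> A * norm (grad (\<phi> k) x - G x)"
          using PA[of x] by (simp add: mult_right_mono)
      qed
      have l2: "(\<lambda>k. l2 D (\<lambda>x. (\<phi> k x - u x) *\<^sub>R (p n (\<psi> x) *\<^sub>R grad \<psi> x))) \<longlonglongrightarrow> 0"
      proof (rule lim[OF L\<phi>'(1) \<phi>(2), of _ A'])
        fix k show "(\<lambda>x. (\<phi> k x - u x) *\<^sub>R (p n (\<psi> x) *\<^sub>R grad \<psi> x)) \<in> borel_measurable (lebesgue_on D)"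
          using measgradP[of n] L\<phi>(1)[of k] Lu(1) by measurable
        fix x show "norm ((\<phi> k x - u x) *\<^sub>R (p n (\<psi> x) *\<^sub>R grad \<psi> x)) \<le> A' * norm (\<phi> k x - u x)"
          by (rule norm_scaleR_le[OF gA])
      qed
      have 0: "(\<lambda>k. l2 D (\<lambda>x. P n (\<psi> x) *\<^sub>R (grad (\<phi> k) x - G x)) + l2 D (\<lambda>x. (\<phi> k x - u x) *\<^sub>R (p n (\<psi> x) *\<^sub>R grad \<psi> x))) \<longlonglongrightarrow> 0"
        using tendsto_add[OF l1 l2] by (simp only: add_0_right)
      show "(\<lambda>k. l2 D (\<lambda>x. (P n (\<psi> x) *\<^sub>R grad (\<phi> k) x + \<phi> k x *\<^sub>R (p n (\<psi> x) *\<^sub>R grad \<psi> x))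
             - (P n (\<psi> x) *\<^sub>R G x + u x *\<^sub>R (p n (\<psi> x) *\<^sub>R grad \<psi> x)))) \<longlonglongrightarrow> 0"
      proof (rule Lim_null_comparison[OF always_eventually 0], rule allI)
        fix k
        have "L2_on D (\<lambda>x. (\<phi> k x - u x) *\<^sub>R (p n (\<psi> x) *\<^sub>R grad \<psi> x))"
        proof (rule L2_on_bound[OF L\<phi>'(1)[of k], of _ A'])
          show "(\<lambda>x. (\<phi> k x - u x) *\<^sub>R (p n (\<psi> x) *\<^sub>R grad \<psi> x)) \<in> borel_measurable (lebesgue_on D)"
            using measgradP[of n] L\<phi>(1)[of k] Lu(1) by measurable
          show "AE x in lebesgue_on D. norm ((\<phi> k x - u x) *\<^sub>R (p n (\<psi> x) *\<^sub>R grad \<psi> x)) \<le> A' * norm (\<phi> k x - u x)"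
            using gA by (intro AE_I2) (rule norm_scaleR_le)
        qed
        from l2_triangle[OF L2_on_mult_bounded[OF L\<phi>'(2)[of k] measP[of n] PA] this]
        show "norm (l2 D (\<lambda>x. (P n (\<psi> x) *\<^sub>R grad (\<phi> k) x + \<phi> k x *\<^sub>R (p n (\<psi> x) *\<^sub>R grad \<psi> x))
             - (P n (\<psi> x) *\<^sub>R G x + u x *\<^sub>R (p n (\<psi> x) *\<^sub>R grad \<psi> x))))
           \<le> l2 D (\<lambda>x. P n (\<psi> x) *\<^sub>R (grad (\<phi> k) x - G x)) + l2 D (\<lambda>x. (\<phi> k x - u x) *\<^sub>R (p n (\<psi> x) *\<^sub>R grad \<psi> x))"
          by (simp add: algebra_simps)
      qed
    qed
  next
    show "(\<lambda>n. l2 D (\<lambda>x. P n (\<psi> x) * u x - u x * T (\<psi> x))) \<longlonglongrightarrow> 0"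
    proof (rule unif[OF Lu(1)])
      fix n show "(\<lambda>x. P n (\<psi> x) * u x - u x * T (\<psi> x)) \<in> borel_measurable (lebesgue_on D)"
        using measP[of n] by measurable
      fix x
      have "P n (\<psi> x) * u x - u x * T (\<psi> x) = (P n (\<psi> x) - T (\<psi> x)) * u x" by (simp add: algebra_simps)
      then show "norm (P n (\<psi> x) * u x - u x * T (\<psi> x)) \<le> norm (e n *\<^sub>R u x)"
        using PT[of n x] e(2)[of n] by (simp add: abs_mult mult_right_mono)
    qed
    show "(\<lambda>n. l2 D (\<lambda>x. (P n (\<psi> x) *\<^sub>R G x + u x *\<^sub>R (p n (\<psi> x) *\<^sub>R grad \<psi> x))
        - (T (\<psi> x) *\<^sub>R G x + (u x * T' (\<psi> x)) *\<^sub>R grad \<psi> x))) \<longlonglongrightarrow> 0"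
    proof (rule unif)
      show "L2_on D (\<lambda>x. norm (G x) + R' * norm (u x))"
        using L2_on_add[OF L2_on_norm[OF Lu(2)] L2_on_scaleR[OF L2_on_norm[OF Lu(1)], of R']] by simp
      fix n show "(\<lambda>x. (P n (\<psi> x) *\<^sub>R G x + u x *\<^sub>R (p n (\<psi> x) *\<^sub>R grad \<psi> x))
        - (T (\<psi> x) *\<^sub>R G x + (u x * T' (\<psi> x)) *\<^sub>R grad \<psi> x)) \<in> borel_measurable (lebesgue_on D)"
        using measP[of n] measgradP[of n] by measurable
      fix x
      have "(P n (\<psi> x) *\<^sub>R G x + u x *\<^sub>R (p n (\<psi> x) *\<^sub>R grad \<psi> x)) - (T (\<psi> x) *\<^sub>R G x + (u x * T' (\<psi> x)) *\<^sub>R grad \<psi> x)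
        = (P n (\<psi> x) - T (\<psi> x)) *\<^sub>R G x + (u x * (p n (\<psi> x) - T' (\<psi> x))) *\<^sub>R grad \<psi> x"
        by (simp add: algebra_simps)
      also have "norm \<dots> \<le> e n * norm (G x) + (\<bar>u x\<bar> * e n) * R'"
        using e(2)[of n] PT[of n x] pT[of n x] R'
        by (intro order_trans[OF norm_triangle_ineq] add_mono)
          (auto simp: abs_mult intro!: mult_mono mult_left_mono)
      finally show "norm ((P n (\<psi> x) *\<^sub>R G x + u x *\<^sub>R (p n (\<psi> x) *\<^sub>R grad \<psi> x)) - (T (\<psi> x) *\<^sub>R G x + (u x * T' (\<psi> x)) *\<^sub>R grad \<psi> x))
         \<le> norm (e n *\<^sub>R (norm (G x) + R' * norm (u x)))"
        using e(2)[of n] R'(1) by (simp add: algebra_simps)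
    qed
  qed
  assume T0: "T 0 = 0"
  show "sobolev0 D (\<lambda>x. T (\<psi> x)) (\<lambda>x. T' (\<psi> x) *\<^sub>R grad \<psi> x)"
  proof (rule sobolev0_closed)
    show "sobolev0 D (\<lambda>x. P n (\<psi> x)) (\<lambda>x. p n (\<psi> x) *\<^sub>R grad \<psi> x)" for n
      unfolding gradP[symmetric] using Pp(3)[of n] T0
      by (intro sobolev0_test_function test_function_polynomial[OF Pp(1) _ t]) simp
    show "L2_on D (\<lambda>x. T (\<psi> x))"
      by (rule L2_on_bounded[of _ "\<bar>T 0\<bar> + C * R"]) (use boundT in \<open>auto intro: measurable_compose[OF _ mT(1)]\<close>)
    show "L2_on D (\<lambda>x. T' (\<psi> x) *\<^sub>R grad \<psi> x)"
      by (rule L2_on_mult_bounded[OF Lt(2) _ boundT']) measurable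
    show "(\<lambda>n. l2 D (\<lambda>x. P n (\<psi> x) - T (\<psi> x))) \<longlonglongrightarrow> 0"
    proof (rule unif[OF L2_on_const[of "1::real"]])
      show "(\<lambda>x. P n (\<psi> x) - T (\<psi> x)) \<in> borel_measurable (lebesgue_on D)" for n using measP[of n] by measurable
      show "norm (P n (\<psi> x) - T (\<psi> x)) \<le> norm (e n *\<^sub>R (1::real))" for n x using PT[of n x] by simp
    qed
    show "(\<lambda>n. l2 D (\<lambda>x. p n (\<psi> x) *\<^sub>R grad \<psi> x - T' (\<psi> x) *\<^sub>R grad \<psi> x)) \<longlonglongrightarrow> 0"
    proof (rule unif[OF Lt(2)])
      show "(\<lambda>x. p n (\<psi> x) *\<^sub>R grad \<psi> x - T' (\<psi> x) *\<^sub>R grad \<psi> x) \<in> borel_measurable (lebesgue_on D)" for n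
        using measgradP[of n] by measurable
      show "norm (p n (\<psi> x) *\<^sub>R grad \<psi> x - T' (\<psi> x) *\<^sub>R grad \<psi> x) \<le> norm (e n *\<^sub>R grad \<psi> x)" for n x
        using pT[of n x] e(2)[of n] by (simp add: mult_right_mono flip: scaleR_diff_left)
    qed
  qed
qed

text \<open>The error splits into \<open>?F\<close>, the gradient error under a bounded factor, and
  \<open>?E\<close>, the error of \<open>T'\<close> along an almost everywhere convergent sequence,
  treated by domination. The bounded multiplier \<open>a\<close> is there to serve both the chain
  rule, where it is 1, and the product rule, where it is the bounded factor
  \<open>u\<close>.\<close>

lemma sobolev0_compose_approximation:
  assumes T: "C1_Lipschitz T T' C" and v: "sobolev0 D v H"
  obtains \<psi> where "\<And>n::nat. test_function D (\<psi> n)" "(\<lambda>n. l2 D (\<lambda>x. \<psi> n x - v x)) \<longlonglongrightarrow> 0"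
    "AE x in lebesgue_on D. (\<lambda>n. \<psi> n x) \<longlonglongrightarrow> v x"
    "\<forall>(a :: real^'n \<Rightarrow> real) A. a \<in> borel_measurable (lebesgue_on D) \<longrightarrow> (\<forall>x. \<bar>a x\<bar> \<le> A) \<longrightarrow>
       L2_on D (\<lambda>x. (a x * T' (v x)) *\<^sub>R H x) \<and>
       (\<lambda>n. l2 D (\<lambda>x. (a x * T' (\<psi> n x)) *\<^sub>R grad (\<psi> n) x - (a x * T' (v x)) *\<^sub>R H x)) \<longlonglongrightarrow> 0"
proof -
  note Lv = sobolev0_L2[OF v] and mT = C1_Lipschitz_measurable[OF T]
  note [measurable] = mT sobolev0_measurable[OF v]
  obtain \<phi> where \<phi>: "\<And>n::nat. test_function D (\<phi> n)" "(\<lambda>n. l2 D (\<lambda>x. \<phi> n x - v x)) \<longlonglongrightarrow> 0"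
    "(\<lambda>n. l2 D (\<lambda>x. grad (\<phi> n) x - H x)) \<longlonglongrightarrow> 0" by (rule sobolev0_obtain[OF v]) (rule that)
  obtain r where r: "strict_mono r" "AE x in lebesgue_on D. (\<lambda>n. \<phi> (r n) x) \<longlonglongrightarrow> v x"
    by (rule L2_tendsto_AE_subseq[OF test_function_L2(1)[OF \<phi>(1)] Lv(1) \<phi>(2)]) (rule that)
  define \<psi> where "\<psi> n = \<phi> (r n)" for n
  have \<psi>: "test_function D (\<psi> n)" "(\<lambda>n. l2 D (\<lambda>x. \<psi> n x - v x)) \<longlonglongrightarrow> 0"
    "(\<lambda>n. l2 D (\<lambda>x. grad (\<psi> n) x - H x)) \<longlonglongrightarrow> 0" "AE x in lebesgue_on D. (\<lambda>n. \<psi> n x) \<longlonglongrightarrow> v x" for n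
    unfolding \<psi>_def using \<phi>(1) LIMSEQ_subseq_LIMSEQ[OF \<phi>(2) r(1)] LIMSEQ_subseq_LIMSEQ[OF \<phi>(3) r(1)] r(2)
    by (simp_all add: o_def)
  note [measurable] = test_function_measurable[OF \<psi>(1), THEN borel_measurable_lebesgue_on]
  have T'C: "\<bar>T' t\<bar> \<le> C" for t using T by (simp add: C1_Lipschitz_def)
  then have C0: "C \<ge> 0" using order_trans[OF abs_ge_zero] by blast
  have "L2_on D (\<lambda>x. (a x * T' (v x)) *\<^sub>R H x) \<and>
       (\<lambda>n. l2 D (\<lambda>x. (a x * T' (\<psi> n x)) *\<^sub>R grad (\<psi> n) x - (a x * T' (v x)) *\<^sub>R H x)) \<longlonglongrightarrow> 0"
    if [measurable]: "a \<in> borel_measurable (lebesgue_on D)" and A: "\<And>x. \<bar>a x\<bar> \<le> A" for a A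
  proof
    have A0: "A \<ge> 0" using A order_trans[OF abs_ge_zero] by blast
    have aT: "\<bar>a x * T' t\<bar> \<le> A * C" for x t
      unfolding abs_mult by (intro mult_mono A T'C A0 abs_ge_zero)
    show "L2_on D (\<lambda>x. (a x * T' (v x)) *\<^sub>R H x)"
      by (rule L2_on_mult_bounded[OF Lv(2) _ aT]) measurable
    let ?d = "\<lambda>n x. grad (\<psi> n) x - H x"
    let ?F = "\<lambda>n x. (a x * T' (\<psi> n x)) *\<^sub>R ?d n x"
    let ?E = "\<lambda>n x. (a x * (T' (\<psi> n x) - T' (v x))) *\<^sub>R H x"
    have d: "L2_on D (?d n)" for n by (rule L2_on_diff[OF test_function_L2(2)[OF \<psi>(1)] Lv(2)])
    have LF: "L2_on D (?F n)" for n
      by (rule L2_on_mult_bounded[OF d _ aT]) measurable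
    have boundE: "\<bar>a x * (T' s - T' t)\<bar> \<le> 2 * A * C" for x s t
      using aT[of x s] aT[of x t] by (simp add: right_diff_distrib)
    have LE: "L2_on D (?E n)" for n
      by (rule L2_on_mult_bounded[OF Lv(2) _ boundE]) measurable
    have limF: "(\<lambda>n. l2 D (?F n)) \<longlonglongrightarrow> 0"
    proof (rule Lim_null_comparison[OF always_eventually tendsto_mult_right_zero[OF \<psi>(3), of "A * C"]], rule allI)
      fix n
      have "l2 D (?F n) \<le> l2 D (\<lambda>x. (A * C) *\<^sub>R ?d n x)"
        using aT A0 C0 LF[of n] by (intro l2_mono L2_on_scaleR d AE_I2) (auto intro!: mult_right_mono simp: L2_on_measurable)
      then show "norm (l2 D (?F n)) \<le> A * C * l2 D (?d n)" using A0 C0 by (simp add: l2_scaleR)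
    qed
    have limE: "(\<lambda>n. l2 D (?E n)) \<longlonglongrightarrow> 0"
    proof (rule l2_tendsto_dominated[OF L2_on_scaleR[OF Lv(2), of "2 * A * C"] L2_on_measurable[OF LE]])
      show "AE x in lebesgue_on D. norm (?E n x) \<le> norm ((2 * A * C) *\<^sub>R H x)" for n
        using boundE A0 C0 by (intro AE_I2) (auto intro!: mult_right_mono)
      show "AE x in lebesgue_on D. (\<lambda>n. ?E n x) \<longlonglongrightarrow> 0"
        using \<psi>(4)
      proof eventually_elim
        case (elim x)
        have "(\<lambda>n. ?E n x) \<longlonglongrightarrow> (a x * (T' (v x) - T' (v x))) *\<^sub>R H x"
          by (intro tendsto_intros C1_Lipschitz_tendsto(2)[OF T elim])
        then show ?case by simp
      qed
    qed
    have lim: "(\<lambda>n. l2 D (?F n) + l2 D (?E n)) \<longlonglongrightarrow> 0"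
      using tendsto_add[OF limF limE] by (simp only: add_0_right)
    show "(\<lambda>n. l2 D (\<lambda>x. (a x * T' (\<psi> n x)) *\<^sub>R grad (\<psi> n) x - (a x * T' (v x)) *\<^sub>R H x)) \<longlonglongrightarrow> 0"
    proof (rule Lim_null_comparison[OF always_eventually lim], rule allI)
      fix n
      have "(\<lambda>x. (a x * T' (\<psi> n x)) *\<^sub>R grad (\<psi> n) x - (a x * T' (v x)) *\<^sub>R H x) = (\<lambda>x. ?F n x + ?E n x)"
        by (simp add: algebra_simps fun_eq_iff)
      then show "norm (l2 D (\<lambda>x. (a x * T' (\<psi> n x)) *\<^sub>R grad (\<psi> n) x - (a x * T' (v x)) *\<^sub>R H x)) \<le> l2 D (?F n) + l2 D (?E n)"
        using l2_triangle[OF LF LE, of n n] by simp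
    qed
  qed
  then have "\<forall>(a :: real^'n \<Rightarrow> real) A. a \<in> borel_measurable (lebesgue_on D) \<longrightarrow> (\<forall>x. \<bar>a x\<bar> \<le> A) \<longrightarrow>
       L2_on D (\<lambda>x. (a x * T' (v x)) *\<^sub>R H x) \<and>
       (\<lambda>n. l2 D (\<lambda>x. (a x * T' (\<psi> n x)) *\<^sub>R grad (\<psi> n) x - (a x * T' (v x)) *\<^sub>R H x)) \<longlonglongrightarrow> 0"
    by blast
  with \<psi>(1,2,4) show ?thesis by (intro that[of \<psi>])
qed

lemma sobolev0_compose:
  assumes T: "C1_Lipschitz T T' C" and T0: "T 0 = 0" and v: "sobolev0 D v H"
  shows "sobolev0 D (\<lambda>x. T (v x)) (\<lambda>x. T' (v x) *\<^sub>R H x)"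
proof -
  note Lv = sobolev0_L2[OF v] and mT = C1_Lipschitz_measurable[OF T]
  obtain \<psi> where \<psi>: "\<And>n::nat. test_function D (\<psi> n)" "(\<lambda>n. l2 D (\<lambda>x. \<psi> n x - v x)) \<longlonglongrightarrow> 0"
    "AE x in lebesgue_on D. (\<lambda>n. \<psi> n x) \<longlonglongrightarrow> v x"
    "\<forall>(a :: real^'n \<Rightarrow> real) A. a \<in> borel_measurable (lebesgue_on D) \<longrightarrow> (\<forall>x. \<bar>a x\<bar> \<le> A) \<longrightarrow>
       L2_on D (\<lambda>x. (a x * T' (v x)) *\<^sub>R H x) \<and>
       (\<lambda>n. l2 D (\<lambda>x. (a x * T' (\<psi> n x)) *\<^sub>R grad (\<psi> n) x - (a x * T' (v x)) *\<^sub>R H x)) \<longlonglongrightarrow> 0"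
    by (rule sobolev0_compose_approximation[OF T v]) (rule that)
  have C0: "C \<ge> 0" using T order_trans[OF abs_ge_zero] unfolding C1_Lipschitz_def by blast
  have mv: "(\<lambda>x. T (v x)) \<in> borel_measurable (lebesgue_on D)"
    by (rule measurable_compose[OF L2_on_measurable[OF Lv(1)] mT(1)])
  have LT: "L2_on D (\<lambda>x. T (v x))"
    using C1_Lipschitz_diff_le[OF T, of _ 0] T0 by (intro L2_on_bound[OF Lv(1) mv, of C]) simp
  have one: "L2_on D (\<lambda>x. T' (v x) *\<^sub>R H x)"
    "(\<lambda>n. l2 D (\<lambda>x. T' (\<psi> n x) *\<^sub>R grad (\<psi> n) x - T' (v x) *\<^sub>R H x)) \<longlonglongrightarrow> 0"
    using \<psi>(4)[rule_format, of "\<lambda>_. 1" 1] by simp_all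
  show ?thesis
  proof (rule sobolev0_closed[OF sobolev0_compose_test_function(2)[OF T v \<psi>(1) T0] LT one(1) _ one(2)])
    show "(\<lambda>n. l2 D (\<lambda>x. T (\<psi> n x) - T (v x))) \<longlonglongrightarrow> 0"
    proof (rule Lim_null_comparison[OF always_eventually tendsto_mult_right_zero[OF \<psi>(2), of C]], rule allI)
      fix n
      have m: "(\<lambda>x. T (\<psi> n x)) \<in> borel_measurable (lebesgue_on D)"
        by (rule measurable_compose[OF L2_on_measurable[OF test_function_L2(1)[OF \<psi>(1)]] mT(1)])
      have "l2 D (\<lambda>x. T (\<psi> n x) - T (v x)) \<le> l2 D (\<lambda>x. C *\<^sub>R (\<psi> n x - v x))"
        using C1_Lipschitz_diff_le[OF T] C0 m mv
        by (intro l2_mono L2_on_scaleR L2_on_diff test_function_L2 \<psi> Lv AE_I2) (auto simp: abs_mult)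
      then show "norm (l2 D (\<lambda>x. T (\<psi> n x) - T (v x))) \<le> C * l2 D (\<lambda>x. \<psi> n x - v x)"
        using C0 l2_scaleR[of D C "\<lambda>x. \<psi> n x - v x"] by simp
    qed
  qed
qed

text \<open>The bound on \<open>u\<close> keeps the term with \<open>T'\<close> and the gradient of
  \<open>v\<close> square integrable; the bound on \<open>T\<close> does the same for the term with
  the gradient of \<open>u\<close>. Its purpose is to admit a bounded function times a ramp of the
  state as a test function.\<close>

lemma sobolev0_mult_compose:
  assumes T: "C1_Lipschitz T T' C" and B: "\<And>t. \<bar>T t\<bar> \<le> B"
    and u: "sobolev0 D u G" and A: "\<And>x. \<bar>u x\<bar> \<le> A" and v: "sobolev0 D v H"
  shows "sobolev0 D (\<lambda>x. u x * T (v x)) (\<lambda>x. T (v x) *\<^sub>R G x + (u x * T' (v x)) *\<^sub>R H x)"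
proof -
  note Lu = sobolev0_L2[OF u] and Lv = sobolev0_L2[OF v] and mT = C1_Lipschitz_measurable[OF T]
  note [measurable] = mT sobolev0_measurable[OF u] sobolev0_measurable[OF v]
  obtain \<psi> where \<psi>: "\<And>n::nat. test_function D (\<psi> n)" "(\<lambda>n. l2 D (\<lambda>x. \<psi> n x - v x)) \<longlonglongrightarrow> 0"
    "AE x in lebesgue_on D. (\<lambda>n. \<psi> n x) \<longlonglongrightarrow> v x"
    "\<forall>(a :: real^'n \<Rightarrow> real) A. a \<in> borel_measurable (lebesgue_on D) \<longrightarrow> (\<forall>x. \<bar>a x\<bar> \<le> A) \<longrightarrow>
       L2_on D (\<lambda>x. (a x * T' (v x)) *\<^sub>R H x) \<and>
       (\<lambda>n. l2 D (\<lambda>x. (a x * T' (\<psi> n x)) *\<^sub>R grad (\<psi> n) x - (a x * T' (v x)) *\<^sub>R H x)) \<longlonglongrightarrow> 0"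
    by (rule sobolev0_compose_approximation[OF T v]) (rule that)
  note [measurable] = test_function_measurable[OF \<psi>(1), THEN borel_measurable_lebesgue_on]
  note P = \<psi>(4)[rule_format, OF sobolev0_measurable(1)[OF u] A]
  have LE: "L2_on D (\<lambda>x. (u x * T' (\<psi> n x)) *\<^sub>R grad (\<psi> n) x)" for n
  proof (rule L2_on_bound[OF test_function_L2(2)[OF \<psi>(1)[of n]], of _ "A * C"])
    have "\<bar>u x * T' (\<psi> n x)\<bar> \<le> A * C" for x
      unfolding abs_mult using T order_trans[OF abs_ge_zero A]
      by (intro mult_mono A) (auto simp: C1_Lipschitz_def)
    then show "AE x in lebesgue_on D. norm ((u x * T' (\<psi> n x)) *\<^sub>R grad (\<psi> n) x) \<le> A * C * norm (grad (\<psi> n) x)"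
      by (intro AE_I2) (simp add: mult_right_mono)
  qed measurable
  have LT: "L2_on D (\<lambda>x. T (v x) *\<^sub>R G x)" by (rule L2_on_mult_bounded[OF Lu(2) _ B]) measurable
  have LT': "L2_on D (\<lambda>x. T (\<psi> n x) *\<^sub>R G x)" for n by (rule L2_on_mult_bounded[OF Lu(2) _ B]) measurable
  have dom: "(\<lambda>n. l2 D (\<lambda>x. T (\<psi> n x) *\<^sub>R F x - T (v x) *\<^sub>R F x)) \<longlonglongrightarrow> 0" if F: "L2_on D F"
    for F :: "real^'n \<Rightarrow> 'b::euclidean_space"
  proof (rule l2_tendsto_dominated[OF L2_on_scaleR[OF F, of "2 * B"]])
    note [measurable] = L2_on_measurable[OF F]
    show "(\<lambda>x. T (\<psi> n x) *\<^sub>R F x - T (v x) *\<^sub>R F x) \<in> borel_measurable (lebesgue_on D)" for n by measurable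
    have "norm ((T s - T t) *\<^sub>R w) \<le> norm ((2 * B) *\<^sub>R w)" for s t and w :: 'b
      using B[of s] B[of t] by (auto intro!: mult_right_mono)
    then show "AE x in lebesgue_on D. norm (T (\<psi> n x) *\<^sub>R F x - T (v x) *\<^sub>R F x) \<le> norm ((2 * B) *\<^sub>R F x)" for n
      by (intro AE_I2) (simp flip: scaleR_diff_left)
    show "AE x in lebesgue_on D. (\<lambda>n. T (\<psi> n x) *\<^sub>R F x - T (v x) *\<^sub>R F x) \<longlonglongrightarrow> 0"
      using \<psi>(3)
    proof eventually_elim
      case (elim x)
      have "(\<lambda>n. T (\<psi> n x) *\<^sub>R F x - T (v x) *\<^sub>R F x) \<longlonglongrightarrow> T (v x) *\<^sub>R F x - T (v x) *\<^sub>R F x"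
        by (intro tendsto_intros C1_Lipschitz_tendsto(1)[OF T elim])
      then show ?case by simp
    qed
  qed
  show ?thesis
  proof (rule sobolev0_closed[OF sobolev0_compose_test_function(1)[OF T u \<psi>(1)]])
    show "L2_on D (\<lambda>x. u x * T (v x))"
      using L2_on_mult_bounded[OF Lu(1) _ B, of "\<lambda>x. v x"] by (simp add: mult.commute)
    show "L2_on D (\<lambda>x. T (v x) *\<^sub>R G x + (u x * T' (v x)) *\<^sub>R H x)"
      using P by (intro L2_on_add LT) simp
    show "(\<lambda>n. l2 D (\<lambda>x. u x * T (\<psi> n x) - u x * T (v x))) \<longlonglongrightarrow> 0"
      using dom[OF Lu(1)] by (simp add: mult.commute)
    have lim: "(\<lambda>n. l2 D (\<lambda>x. T (\<psi> n x) *\<^sub>R G x - T (v x) *\<^sub>R G x)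
        + l2 D (\<lambda>x. (u x * T' (\<psi> n x)) *\<^sub>R grad (\<psi> n) x - (u x * T' (v x)) *\<^sub>R H x)) \<longlonglongrightarrow> 0"
      using tendsto_add[OF dom[OF Lu(2)] conjunct2[OF P]] by (simp only: add_0_right)
    show "(\<lambda>n. l2 D (\<lambda>x. (T (\<psi> n x) *\<^sub>R G x + (u x * T' (\<psi> n x)) *\<^sub>R grad (\<psi> n) x)
        - (T (v x) *\<^sub>R G x + (u x * T' (v x)) *\<^sub>R H x))) \<longlonglongrightarrow> 0"
    proof (rule Lim_null_comparison[OF always_eventually lim], rule allI)
      fix n
      have "l2 D (\<lambda>x. (T (\<psi> n x) *\<^sub>R G x - T (v x) *\<^sub>R G x) + ((u x * T' (\<psi> n x)) *\<^sub>R grad (\<psi> n) x - (u x * T' (v x)) *\<^sub>R H x))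
         \<le> l2 D (\<lambda>x. T (\<psi> n x) *\<^sub>R G x - T (v x) *\<^sub>R G x)
        + l2 D (\<lambda>x. (u x * T' (\<psi> n x)) *\<^sub>R grad (\<psi> n) x - (u x * T' (v x)) *\<^sub>R H x)"
        by (intro l2_triangle L2_on_diff LT LT' LE conjunct1[OF P])
      then show "norm (l2 D (\<lambda>x. (T (\<psi> n x) *\<^sub>R G x + (u x * T' (\<psi> n x)) *\<^sub>R grad (\<psi> n) x)
        - (T (v x) *\<^sub>R G x + (u x * T' (v x)) *\<^sub>R H x)))
        \<le> l2 D (\<lambda>x. T (\<psi> n x) *\<^sub>R G x - T (v x) *\<^sub>R G x)
        + l2 D (\<lambda>x. (u x * T' (\<psi> n x)) *\<^sub>R grad (\<psi> n) x - (u x * T' (v x)) *\<^sub>R H x)"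
        by (simp add: add_diff_add)
    qed
  qed
qed

text \<open>By Poincare, convergence of the gradients alone makes the functions Cauchy. This
  recovers the state when a compactness argument has been run on gradients only.\<close>

lemma sobolev0_limit:
  assumes s: "\<And>n. sobolev0 D (u n) (G n)" and H: "L2_on D H" "(\<lambda>n. l2 D (\<lambda>x. G n x - H x)) \<longlonglongrightarrow> 0"
  obtains v where "sobolev0 D v H" "(\<lambda>n. l2 D (\<lambda>x. u n x - v x)) \<longlonglongrightarrow> 0"
proof -
  obtain C where C: "C > 0" "\<And>u G. sobolev0 D u G \<Longrightarrow> l2 D u \<le> C * l2 D G"
    by (rule Poincare_sobolev0) (rule that)
  note L = sobolev0_L2[OF s]
  have "\<exists>N. \<forall>m\<ge>N. \<forall>n\<ge>N. l2 D (\<lambda>x. u m x - u n x) < e" if "e > 0" for e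
  proof -
    have "e / (2 * C) > 0" using C(1) that by simp
    then obtain N where N: "\<And>n. n \<ge> N \<Longrightarrow> l2 D (\<lambda>x. G n x - H x) < e / (2 * C)"
      using order_tendstoD(2)[OF H(2)] unfolding eventually_sequentially by meson
    have "l2 D (\<lambda>x. u m x - u n x) < e" if "m \<ge> N" "n \<ge> N" for m n
    proof -
      have "l2 D (\<lambda>x. u m x - u n x) \<le> C * l2 D (\<lambda>x. G m x - G n x)"
        by (rule C(2)[OF sobolev0_diff[OF s s]])
      also have "\<dots> \<le> C * (l2 D (\<lambda>x. G m x - H x) + l2 D (\<lambda>x. G n x - H x))"
        using l2_triangle3[OF L(2)[of m] H(1) L(2)[of n]] l2_commute[of D H "G n"] C(1) by simp
      also have "\<dots> < C * (e / (2 * C) + e / (2 * C))"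
        using N[OF that(1)] N[OF that(2)] C(1) by (intro mult_strict_left_mono add_strict_mono)
      also have "\<dots> = e" using C(1) by (simp add: field_simps)
      finally show ?thesis .
    qed
    then show ?thesis by blast
  qed
  then obtain v where v: "L2_on D v" "(\<lambda>n. l2 D (\<lambda>x. u n x - v x)) \<longlonglongrightarrow> 0"
    by (rule L2_complete[of u, OF L(1)]) (assumption, rule that)
  with sobolev0_closed[OF s v(1) H(1) v(2) H(2)] show ?thesis by (intro that)
qed

end

section \<open>Convex compactness and the state equation\<close>

text \<open>A decreasing bijection from [0,\<infinity>] onto [0,1], sending \<infinity> to 0. It
  turns potentials with infinite values into bounded real functions, for which completeness of L2 is
  available.\<close>

definition potential_weight :: "ennreal \<Rightarrow> real" where
  "potential_weight V = enn2real (inverse (1 + V))"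

lemma potential_weight_ennreal [simp]: "v \<ge> 0 \<Longrightarrow> potential_weight (ennreal v) = 1 / (1 + v)"
  by (simp add: potential_weight_def inverse_ennreal inverse_eq_divide flip: ennreal_plus ennreal_1)

lemma potential_weight_top [simp]: "potential_weight top = 0"
  by (simp add: potential_weight_def)

lemma potential_weight_bounds: "0 \<le> potential_weight V" "potential_weight V \<le> 1"
  by (cases V; simp)+

lemma ennreal_potential_weight: "ennreal (potential_weight V) = inverse (1 + V)"
  by (cases V) (simp_all add: inverse_ennreal inverse_eq_divide flip: ennreal_plus ennreal_1)

lemma potential_weight_measurable [measurable]: "potential_weight \<in> borel_measurable borel"
  unfolding potential_weight_def[abs_def] by measurable

text \<open>Uniform convexity of \<open>V \<mapsto> 1/(1+V)\<close>, measured in the variable \<open>1/(1+V)\<close> itself.\<close>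

lemma potential_weight_midpoint:
  "potential_weight ((V + W) / 2) \<le> (potential_weight V + potential_weight W) / 2
     - (potential_weight V - potential_weight W)\<^sup>2 / 4"
proof -
  \<comment> \<open>If one potential is \<infinity>, so is the midpoint, with weight 0; the claim
    then concerns only the weight \<open>q\<close> of the other one.\<close>
  have top: "0 \<le> q / 2 - q\<^sup>2 / 4" if "0 \<le> q" "q \<le> 1" for q :: real
    using mult_left_mono[OF that(2,1)] that by (simp add: power2_eq_square)
  show ?thesis
  proof (cases "V = top \<or> W = top")
    case True
    then show ?thesis
      using top[OF potential_weight_bounds(1)[of V] potential_weight_bounds(2)[of V]]
        top[OF potential_weight_bounds(1)[of W] potential_weight_bounds(2)[of W]]
      by (auto simp: ennreal_top_divide)
  next
    case False
    then obtain v w where vw: "V = ennreal v" "W = ennreal w" "v \<ge> 0" "w \<ge> 0"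
      by (metis ennreal_cases)
    define a b where "a = 1 + v" and "b = 1 + w"
    have ab: "a \<ge> 1" "b \<ge> 1" using vw by (auto simp: a_def b_def)
    have mid: "(V + W) / 2 = ennreal ((v + w) / 2)"
      using vw by (simp add: ennreal_divide_numeral flip: ennreal_plus)
    have pos: "0 < a * b * (a + b)" "0 < a * b" using ab by auto
    \<comment> \<open>The exact convexity gap of the reciprocal is
      \<open>(a - b)\<^sup>2 / (2 * (a * b) * (a + b))\<close>. It dominates the required square
      because \<open>a\<close> and \<open>b\<close> are at least 1, which is the reason for the
      shift by 1 in the weight.\<close>
    have "(a + b) / 2 \<le> a * b"
      using mult_nonneg_nonneg[of "a - 1" "b - 1"] mult_left_mono[of 1 b a] mult_left_mono[of 1 a b] ab
      by (simp add: algebra_simps)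
    then have "(a - b)\<^sup>2 * (a + b) \<le> (a - b)\<^sup>2 * (2 * (a * b))"
      by (intro mult_left_mono) auto
    then have key: "(a - b)\<^sup>2 / (4 * (a * b)\<^sup>2) \<le> (a - b)\<^sup>2 / (2 * (a * b) * (a + b))"
      using pos ab by (simp add: divide_simps power2_eq_square) (simp add: algebra_simps)
    have "(1 / a - 1 / b)\<^sup>2 / 4 = (a - b)\<^sup>2 / (4 * (a * b)\<^sup>2)"
      using ab by (simp add: field_simps power2_eq_square)
    moreover have "(1 / a + 1 / b) / 2 - 2 / (a + b) = (a - b)\<^sup>2 / (2 * (a * b) * (a + b))"
      using ab by (simp add: field_simps power2_eq_square)
    ultimately have "2 / (a + b) \<le> (1 / a + 1 / b) / 2 - (1 / a - 1 / b)\<^sup>2 / 4"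
      using key by linarith
    moreover have "potential_weight ((V + W) / 2) = 2 / (a + b)"
      using vw unfolding mid by (simp add: a_def b_def field_simps)
    ultimately show ?thesis using vw by (simp add: a_def b_def)
  qed
qed

text \<open>The weight \<open>q\<close> belongs to the potential 1/q - 1, with \<open>q = 0\<close>
  giving \<infinity>. Inversion is continuous and yields convergence of \<open>1 + V n\<close>; the
  summand 1 is then cancelled in the order topology.\<close>

lemma potential_weight_tendsto:
  assumes "(\<lambda>n. potential_weight (V n)) \<longlonglongrightarrow> q"
  shows "V \<longlonglongrightarrow> inverse (ennreal q) - 1"
proof -
  have q: "q \<ge> 0" "q \<le> 1"
    using assms potential_weight_bounds by (auto intro: LIMSEQ_le_const LIMSEQ_le_const2)
  define W where "W = inverse (ennreal q) - 1"
  have "(1 :: ennreal) \<le> inverse (ennreal q)"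
    using q by (cases "q = 0") (auto simp: inverse_ennreal one_le_inverse_iff simp flip: ennreal_1 intro!: ennreal_leI)
  then have W1: "1 + W = inverse (ennreal q)" by (simp add: W_def add_diff_inverse_ennreal)
  have "(\<lambda>n. inverse (ennreal (potential_weight (V n)))) \<longlonglongrightarrow> inverse (ennreal q)"
    using assms by (intro continuous_on_tendsto_compose[OF continuous_on_inverse_ennreal[OF continuous_on_id[of UNIV]]] tendsto_ennrealI) auto
  then have lim: "(\<lambda>n. 1 + V n) \<longlonglongrightarrow> 1 + W"
    using one_divide_one_divide_ennreal by (simp add: W1 ennreal_potential_weight divide_ennreal_def)
  show ?thesis unfolding W_def[symmetric]
  proof (rule order_tendstoI)
    fix a assume "a < W"
    then have "1 + a < 1 + W" by (simp add: ennreal_add_left_cancel_less)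
    from order_tendstoD(1)[OF lim this] show "eventually (\<lambda>n. a < V n) sequentially"
      by eventually_elim (simp add: ennreal_add_left_cancel_less)
  next
    fix a assume "W < a"
    then have "1 + W < 1 + a" by (simp add: ennreal_add_left_cancel_less)
    from order_tendstoD(2)[OF lim this] show "eventually (\<lambda>n. V n < a) sequentially"
      by eventually_elim (simp add: ennreal_add_left_cancel_less)
  qed
qed

text \<open>Written as a midpoint identity with a defect of one quarter of a square, the same shape
  as \<open>potential_weight_midpoint\<close>, so that the two can be added in one
  functional.\<close>

lemma l2_parallelogram:
  assumes y: "L2_on D y" and z: "L2_on D z"
  shows "(l2 D (\<lambda>x. (1/2) *\<^sub>R (y x + z x)))\<^sup>2 = ((l2 D y)\<^sup>2 + (l2 D z)\<^sup>2) / 2 - (l2 D (\<lambda>x. y x - z x))\<^sup>2 / 4"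
proof -
  have pt: "(norm ((1/2) *\<^sub>R (a + b)))\<^sup>2 = ((norm a)\<^sup>2 + (norm b)\<^sup>2) / 2 - (norm (a - b))\<^sup>2 / 4" for a b :: 'b
  proof -
    have "(norm ((1/2) *\<^sub>R (a + b)))\<^sup>2 = (norm (a + b))\<^sup>2 / 4" by (simp add: power_divide)
    moreover have "(norm (a - b))\<^sup>2 = (norm a)\<^sup>2 - 2 * (a \<bullet> b) + (norm b)\<^sup>2"
      using norm_add_square[of a "- b"] by simp
    ultimately show ?thesis by (simp only: norm_add_square) (simp add: field_simps)
  qed
  show ?thesis
    unfolding l2_square pt
    using L2_on_integrable[OF y] L2_on_integrable[OF z] L2_on_integrable[OF L2_on_diff[OF y z]] by simp
qed

lemma nn_integral_Fatou_AE:
  assumes "\<And>n. F n \<in> borel_measurable M" "AE x in M. (\<lambda>n. F n x) \<longlonglongrightarrow> f x"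
    and "\<And>n. (\<integral>\<^sup>+x. F n x \<partial>M) \<le> b n" "b \<longlonglongrightarrow> (c::ennreal)"
  shows "(\<integral>\<^sup>+x. f x \<partial>M) \<le> c"
proof -
  have "(\<integral>\<^sup>+x. f x \<partial>M) = (\<integral>\<^sup>+x. liminf (\<lambda>n. F n x) \<partial>M)"
    using assms(2) by (intro nn_integral_cong_AE, eventually_elim) (simp add: lim_imp_Liminf)
  also have "\<dots> \<le> liminf (\<lambda>n. \<integral>\<^sup>+x. F n x \<partial>M)" by (rule nn_integral_liminf[OF assms(1)])
  also have "\<dots> \<le> liminf b" by (rule Liminf_mono) (simp add: assms(3))
  also have "\<dots> = c" using assms(4) by (intro lim_imp_Liminf) auto
  finally show ?thesis .
qed

context bounded_open
begin

text \<open>Almost minimisers of the uniformly convex functional \<open>\<integral>|y|\<^sup>2 + \<integral>1/(1+V)\<close> over \<open>K n\<close> form a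
  Cauchy sequence.\<close>

lemma convex_compactness:
  fixes K :: "nat \<Rightarrow> ((real^'n \<Rightarrow> 'b::euclidean_space) \<times> (real^'n \<Rightarrow> ennreal)) set"
  assumes ne: "\<And>n. K n \<noteq> {}" and dec: "\<And>m n. m \<le> n \<Longrightarrow> K n \<subseteq> K m"
    and mid: "\<And>n y V z W. (y, V) \<in> K n \<Longrightarrow> (z, W) \<in> K n \<Longrightarrow>
      (\<lambda>x. (1/2) *\<^sub>R (y x + z x), \<lambda>x. (V x + W x) / 2) \<in> K n"
    and L: "\<And>n y V. (y, V) \<in> K n \<Longrightarrow> L2_on D y" and B: "\<And>n y V. (y, V) \<in> K n \<Longrightarrow> l2 D y \<le> B"
    and meas: "\<And>n y V. (y, V) \<in> K n \<Longrightarrow> V \<in> borel_measurable (lebesgue_on D)"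
  obtains y V z W where "\<And>n. (y n, V n) \<in> K n" "L2_on D z" "(\<lambda>n. l2 D (\<lambda>x. y n x - z x)) \<longlonglongrightarrow> 0"
    "W \<in> borel_measurable (lebesgue_on D)" "AE x in lebesgue_on D. (\<lambda>n. V n x) \<longlonglongrightarrow> W x"
proof -
  define Q where "Q V = (\<lambda>x. potential_weight (V x))" for V :: "real^'n \<Rightarrow> ennreal"
  have Qm: "Q V \<in> borel_measurable (lebesgue_on D)" if "(y, V) \<in> K n" for y V n
    unfolding Q_def by (rule measurable_compose[OF meas[OF that] potential_weight_measurable])
  have QL: "L2_on D (Q V)" if "(y, V) \<in> K n" for y V n
    by (rule L2_on_bounded[OF Qm[OF that], of 1]) (use potential_weight_bounds in \<open>auto simp: Q_def\<close>)
  note Qi = L2_on_integrable1[OF QL]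
  define F where "F c = (case c of (y, V) \<Rightarrow> (l2 D y)\<^sup>2 + (\<integral>x. Q V x \<partial>lebesgue_on D))"
    for c :: "(real^'n \<Rightarrow> 'b) \<times> (real^'n \<Rightarrow> ennreal)"
  define \<mu> where "\<mu> = (\<integral>x. (1::real) \<partial>lebesgue_on D)"
  have B0: "B \<ge> 0"
  proof -
    obtain y V where "(y, V) \<in> K 0" using ne[of 0] by fastforce
    then show ?thesis using order_trans[OF l2_nonneg B] by blast
  qed
  have F0: "F c \<ge> 0" for c
    by (auto simp: F_def Q_def potential_weight_bounds split: prod.split intro!: add_nonneg_nonneg Bochner_Integration.integral_nonneg)
  have FB: "F c \<le> B\<^sup>2 + \<mu>" if "c \<in> K n" for c n
  proof -
    obtain y V where c: "c = (y, V)" by (cases c)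
    have "(\<integral>x. Q V x \<partial>lebesgue_on D) \<le> \<mu>"
      unfolding \<mu>_def using Qi that c by (intro integral_mono) (auto simp: Q_def potential_weight_bounds)
    moreover have "(l2 D y)\<^sup>2 \<le> B\<^sup>2" using B that c by (intro power_mono) auto
    ultimately show ?thesis by (simp add: F_def c)
  qed
  \<comment> \<open>The midpoint of two pairs stays in \<open>K n\<close>, so its value is at least
    \<open>t\<close>; the convexity gaps of both parts are therefore paid for by the excess of the
    two values over \<open>t\<close>.\<close>
  have key: "(l2 D (\<lambda>x. y x - z x))\<^sup>2 / 4 + (l2 D (\<lambda>x. Q V x - Q W x))\<^sup>2 / 4 \<le> (F (y, V) + F (z, W)) / 2 - t"
    if c: "(y, V) \<in> K n" "(z, W) \<in> K n" and t: "\<And>c. c \<in> K n \<Longrightarrow> t \<le> F c" for y V z W n t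
  proof -
    let ?V = "\<lambda>x. (V x + W x) / 2"
    have i: "integrable (lebesgue_on D) (\<lambda>x. (Q V x - Q W x)\<^sup>2)"
      using L2_on_integrable[OF L2_on_diff[OF QL[OF c(1)] QL[OF c(2)]]] by simp
    have "(\<integral>x. Q ?V x \<partial>lebesgue_on D) \<le> (\<integral>x. (Q V x + Q W x) / 2 - (Q V x - Q W x)\<^sup>2 / 4 \<partial>lebesgue_on D)"
      using Qi[OF mid[OF c]] Qi[OF c(1)] Qi[OF c(2)] i
      by (intro integral_mono) (auto simp: Q_def potential_weight_midpoint)
    also have "\<dots> = ((\<integral>x. Q V x \<partial>lebesgue_on D) + (\<integral>x. Q W x \<partial>lebesgue_on D)) / 2 - (l2 D (\<lambda>x. Q V x - Q W x))\<^sup>2 / 4"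
      using Qi[OF c(1)] Qi[OF c(2)] i by (simp add: l2_square)
    finally have "F (\<lambda>x. (1/2) *\<^sub>R (y x + z x), ?V) \<le> (F (y, V) + F (z, W)) / 2
        - (l2 D (\<lambda>x. y x - z x))\<^sup>2 / 4 - (l2 D (\<lambda>x. Q V x - Q W x))\<^sup>2 / 4"
      using l2_parallelogram[OF L[OF c(1)] L[OF c(2)]] unfolding F_def prod.case by argo
    with t[OF mid[OF c]] show ?thesis by linarith
  qed
  define I where "I n = Inf (F ` K n)" for n
  have bdd: "bdd_below (F ` K n)" for n using F0 by (auto intro!: bdd_belowI[of _ 0])
  have I_le: "I n \<le> F c" if "c \<in> K n" for c n
    unfolding I_def using that by (intro cInf_lower bdd) auto
  \<comment> \<open>Infima over shrinking sets increase, and they are bounded by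
    \<open>B\<^sup>2 + \<mu>\<close>; the resulting convergence lets pairs from different sets
    \<open>K n\<close> be compared.\<close>
  have inc: "incseq I"
    unfolding incseq_def I_def using ne dec bdd by (intro allI impI cInf_superset_mono) (auto simp: image_mono)
  have "I n \<le> B\<^sup>2 + \<mu>" for n
  proof -
    obtain c where "c \<in> K n" using ne[of n] by auto
    then show ?thesis using I_le FB order_trans by blast
  qed
  then have "\<forall>n. I n \<le> B\<^sup>2 + \<mu>" by blast
  from incseq_convergent[OF inc this] obtain l where l: "I \<longlonglongrightarrow> l" "\<And>n. I n \<le> l"
    by blast
  define e where "e n = inverse (real (Suc n))" for n
  have e: "e \<longlonglongrightarrow> 0" "e n > 0" "m \<le> n \<Longrightarrow> e n \<le> e m" for m n
    unfolding e_def by (rule LIMSEQ_inverse_real_of_nat) (auto simp: field_simps)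
  have "\<exists>c\<in>K n. F c < I n + e n" for n
    using cInf_lessD[of "F ` K n" "I n + e n"] ne[of n] e(2)[of n] by (auto simp: I_def)
  then obtain c where c: "\<And>n. c n \<in> K n" "\<And>n. F (c n) < I n + e n" by metis
  define y where "y n = fst (c n)" for n
  define V where "V n = snd (c n)" for n
  have yV: "(y n, V n) \<in> K n" "F (y n, V n) < I n + e n" for n
    using c[of n] by (simp_all add: y_def V_def)
  \<comment> \<open>Both pairs lie in \<open>K N\<close> and their values are at most
    \<open>l + e N\<close>, whereas no value on \<open>K N\<close> is below
    \<open>I N\<close>.\<close>
  have close: "(l2 D (\<lambda>x. y m x - y n x))\<^sup>2 / 4 + (l2 D (\<lambda>x. Q (V m) x - Q (V n) x))\<^sup>2 / 4 \<le> l - I N + e N"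
    if "m \<ge> N" "n \<ge> N" for m n N
  proof -
    have "(y m, V m) \<in> K N" "(y n, V n) \<in> K N" using yV(1) dec that by blast+
    from key[OF this I_le] have "(l2 D (\<lambda>x. y m x - y n x))\<^sup>2 / 4 + (l2 D (\<lambda>x. Q (V m) x - Q (V n) x))\<^sup>2 / 4
       \<le> (F (y m, V m) + F (y n, V n)) / 2 - I N" .
    also have "\<dots> \<le> l - I N + e N"
      using yV(2)[of m] yV(2)[of n] l(2)[of m] l(2)[of n] e(3)[OF that(1)] e(3)[OF that(2)] by argo
    finally show ?thesis .
  qed
  have lim0: "(\<lambda>N. l - I N + e N) \<longlonglongrightarrow> l - l + 0" by (intro tendsto_intros l e)
  have small: "\<exists>N. \<forall>m\<ge>N. \<forall>n\<ge>N. l2 D (\<lambda>x. y m x - y n x) < \<epsilon> \<and> l2 D (\<lambda>x. Q (V m) x - Q (V n) x) < \<epsilon>" if "\<epsilon> > 0" for \<epsilon>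
  proof -
    have "\<epsilon>\<^sup>2 / 4 > l - l + 0" using that by simp
    then obtain N where N: "l - I N + e N < \<epsilon>\<^sup>2 / 4"
      using order_tendstoD(2)[OF lim0] unfolding eventually_sequentially by blast
    have "l2 D (\<lambda>x. y m x - y n x) < \<epsilon> \<and> l2 D (\<lambda>x. Q (V m) x - Q (V n) x) < \<epsilon>" if "m \<ge> N" "n \<ge> N" for m n
    proof -
      have "(l2 D (\<lambda>x. y m x - y n x))\<^sup>2 < \<epsilon>\<^sup>2" "(l2 D (\<lambda>x. Q (V m) x - Q (V n) x))\<^sup>2 < \<epsilon>\<^sup>2"
        using close[OF that] N zero_le_power2[of "l2 D (\<lambda>x. y m x - y n x)"]
          zero_le_power2[of "l2 D (\<lambda>x. Q (V m) x - Q (V n) x)"] by linarith+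
      then show ?thesis using \<open>\<epsilon> > 0\<close> by (auto intro: power2_less_imp_less)
    qed
    then show ?thesis by blast
  qed
  have "\<exists>N. \<forall>m\<ge>N. \<forall>n\<ge>N. l2 D (\<lambda>x. y m x - y n x) < \<epsilon>" if "\<epsilon> > 0" for \<epsilon>
    using small[OF that] by blast
  then obtain z where z: "L2_on D z" "(\<lambda>n. l2 D (\<lambda>x. y n x - z x)) \<longlonglongrightarrow> 0"
    by (rule L2_complete[of y, OF L[OF yV(1)]]) (assumption, rule that)
  have "\<exists>N. \<forall>m\<ge>N. \<forall>n\<ge>N. l2 D (\<lambda>x. Q (V m) x - Q (V n) x) < \<epsilon>" if "\<epsilon> > 0" for \<epsilon>
    using small[OF that] by blast
  then obtain q where q: "L2_on D q" "(\<lambda>n. l2 D (\<lambda>x. Q (V n) x - q x)) \<longlonglongrightarrow> 0"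
    by (rule L2_complete[of "\<lambda>n. Q (V n)", OF QL[OF yV(1)]]) (assumption, rule that)
  obtain r where r: "strict_mono r" "AE x in lebesgue_on D. (\<lambda>n. Q (V (r n)) x) \<longlonglongrightarrow> q x"
    by (rule L2_tendsto_AE_subseq[OF QL[OF yV(1)] q]) (rule that)
  define W where "W x = inverse (ennreal (q x)) - 1" for x
  show ?thesis
  proof (rule that)
    \<comment> \<open>A subsequence moves to larger indices, and the sets decrease, so membership in
      \<open>K n\<close> is retained.\<close>
    show "(y (r n), V (r n)) \<in> K n" for n
      using yV(1)[of "r n"] dec[OF seq_suble[OF r(1), of n]] by blast
    show "L2_on D z" by (rule z)
    show "(\<lambda>n. l2 D (\<lambda>x. y (r n) x - z x)) \<longlonglongrightarrow> 0"
      using LIMSEQ_subseq_LIMSEQ[OF z(2) r(1)] by (simp add: o_def)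
    show "W \<in> borel_measurable (lebesgue_on D)"
      unfolding W_def[abs_def] using L2_on_measurable[OF q(1)] by measurable
    show "AE x in lebesgue_on D. (\<lambda>n. V (r n) x) \<longlonglongrightarrow> W x"
      using r(2) unfolding W_def Q_def by eventually_elim (rule potential_weight_tendsto)
  qed
qed

section \<open>Potential energies and solvability of the state equation\<close>

definition sqrt_potential :: "(real^'n \<Rightarrow> ennreal) \<Rightarrow> real^'n \<Rightarrow> real" where
  "sqrt_potential V x = sqrt (enn2real (V x))"

lemma sqrt_potential_square: "sqrt_potential V x * sqrt_potential V x = enn2real (V x)"
  by (simp add: sqrt_potential_def)

lemma sqrt_potential_measurable:
  "V \<in> borel_measurable (lebesgue_on D) \<Longrightarrow> sqrt_potential V \<in> borel_measurable (lebesgue_on D)"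
  unfolding sqrt_potential_def[abs_def] by measurable

text \<open>Multiplication by the square root of \<open>V\<close> turns the potential energy into an
  L2 norm. As \<open>enn2real\<close> sends \<infinity> to 0, this norm does not see the set where
  \<open>V\<close> is infinite; vanishing of \<open>u\<close> there is the separate condition that
  restores equality.\<close>

lemma potential_energy_finite_iff:
  assumes V: "V \<in> borel_measurable (lebesgue_on D)" and u: "u \<in> borel_measurable (lebesgue_on D)"
  shows "(\<integral>\<^sup>+x. V x * ennreal ((u x)\<^sup>2) \<partial>lebesgue_on D) < \<infinity> \<longleftrightarrow>
    L2_on D (\<lambda>x. sqrt_potential V x * u x) \<and> (AE x in lebesgue_on D. V x = \<infinity> \<longrightarrow> u x = 0)" (is "?E < \<infinity> \<longleftrightarrow> _")
    and "L2_on D (\<lambda>x. sqrt_potential V x * u x) \<Longrightarrow> AE x in lebesgue_on D. V x = \<infinity> \<longrightarrow> u x = 0 \<Longrightarrow>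
       (\<integral>\<^sup>+x. V x * ennreal ((u x)\<^sup>2) \<partial>lebesgue_on D) = ennreal ((l2 D (\<lambda>x. sqrt_potential V x * u x))\<^sup>2)"
proof -
  note [measurable] = V u sqrt_potential_measurable[OF V]
  have m: "(\<lambda>x. sqrt_potential V x * u x) \<in> borel_measurable (lebesgue_on D)" by measurable
  have eq: "?E = (\<integral>\<^sup>+x. ennreal ((norm (sqrt_potential V x * u x))\<^sup>2) \<partial>lebesgue_on D)"
    if "AE x in lebesgue_on D. V x = \<infinity> \<longrightarrow> u x = 0"
    using that
  proof (intro nn_integral_cong_AE, eventually_elim)
    case (elim x)
    show ?case
    proof (cases "V x")
      case (real v)
      then show ?thesis by (simp add: sqrt_potential_def power_mult_distrib ennreal_mult)
    qed (use elim in \<open>simp add: sqrt_potential_def\<close>)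
  qed
  show "L2_on D (\<lambda>x. sqrt_potential V x * u x) \<Longrightarrow> AE x in lebesgue_on D. V x = \<infinity> \<longrightarrow> u x = 0 \<Longrightarrow>
       ?E = ennreal ((l2 D (\<lambda>x. sqrt_potential V x * u x))\<^sup>2)"
    using eq ennreal_l2_square[of "\<lambda>x. sqrt_potential V x * u x"] by metis
  then have "L2_on D (\<lambda>x. sqrt_potential V x * u x) \<and> (AE x in lebesgue_on D. V x = \<infinity> \<longrightarrow> u x = 0) \<Longrightarrow> ?E < \<infinity>"
    by (metis ennreal_less_top infinity_ennreal_def)
  moreover have "L2_on D (\<lambda>x. sqrt_potential V x * u x) \<and> (AE x in lebesgue_on D. V x = \<infinity> \<longrightarrow> u x = 0)" if fin: "?E < \<infinity>"
  proof
    have "AE x in lebesgue_on D. V x * ennreal ((u x)\<^sup>2) \<noteq> \<infinity>"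
      using fin by (intro nn_integral_PInf_AE) auto
    then show ae: "AE x in lebesgue_on D. V x = \<infinity> \<longrightarrow> u x = 0"
      by eventually_elim (auto simp: ennreal_mult_eq_top_iff)
    show "L2_on D (\<lambda>x. sqrt_potential V x * u x)"
      unfolding L2_on_def
    proof
      show "integrable (lebesgue_on D) (\<lambda>x. (norm (sqrt_potential V x * u x))\<^sup>2)"
        using fin m unfolding eq[OF ae] by (intro integrableI_bounded) auto
    qed (rule m)
  qed
  ultimately show "?E < \<infinity> \<longleftrightarrow> L2_on D (\<lambda>x. sqrt_potential V x * u x) \<and> (AE x in lebesgue_on D. V x = \<infinity> \<longrightarrow> u x = 0)"
    by blast
qed

lemma energy_spaceI:
  assumes "sobolev0 D u G" "(\<integral>\<^sup>+x. V x * ennreal ((u x)\<^sup>2) \<partial>lebesgue_on D) < \<infinity>"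
  shows "u \<in> energy_space D V"
  using assms H10_iff_sobolev0 by (auto simp: energy_space_def)

lemma energy_space_L2:
  assumes "V \<in> borel_measurable (lebesgue_on D)" "u \<in> energy_space D V"
  shows "L2_on D (\<lambda>x. sqrt_potential V x * u x)" "AE x in lebesgue_on D. V x = \<infinity> \<longrightarrow> u x = 0"
    "(\<integral>\<^sup>+x. V x * ennreal ((u x)\<^sup>2) \<partial>lebesgue_on D) = ennreal ((l2 D (\<lambda>x. sqrt_potential V x * u x))\<^sup>2)"
    "u \<in> borel_measurable (lebesgue_on D)"
proof -
  show m: "u \<in> borel_measurable (lebesgue_on D)"
    using assms(2) H10_iff_sobolev0 sobolev0_measurable(1) by (auto simp: energy_space_def)
  show 1: "L2_on D (\<lambda>x. sqrt_potential V x * u x)" "AE x in lebesgue_on D. V x = \<infinity> \<longrightarrow> u x = 0"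
    using potential_energy_finite_iff(1)[OF assms(1) m] assms(2) by (auto simp: energy_space_def)
  show "(\<integral>\<^sup>+x. V x * ennreal ((u x)\<^sup>2) \<partial>lebesgue_on D) = ennreal ((l2 D (\<lambda>x. sqrt_potential V x * u x))\<^sup>2)"
    by (rule potential_energy_finite_iff(2)[OF assms(1) m 1])
qed

lemma energy_space_lincomb:
  assumes V: "V \<in> borel_measurable (lebesgue_on D)"
    and u: "u \<in> energy_space D V" and v: "v \<in> energy_space D V"
  shows "(\<lambda>x. a * u x + b * v x) \<in> energy_space D V"
proof -
  obtain G H where GH: "sobolev0 D u G" "sobolev0 D v H"
    using u v H10_iff_sobolev0 by (auto simp: energy_space_def)
  note s = sobolev0_lincomb[OF GH, of a b]
  note Eu = energy_space_L2[OF V u] and Ev = energy_space_L2[OF V v]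
  have "L2_on D (\<lambda>x. sqrt_potential V x * (a * u x + b * v x))"
    using L2_on_add[OF L2_on_scaleR[OF Eu(1), of a] L2_on_scaleR[OF Ev(1), of b]] by (simp add: algebra_simps)
  moreover have "AE x in lebesgue_on D. V x = \<infinity> \<longrightarrow> a * u x + b * v x = 0"
    using Eu(2) Ev(2) by eventually_elim auto
  ultimately have "(\<integral>\<^sup>+x. V x * ennreal ((a * u x + b * v x)\<^sup>2) \<partial>lebesgue_on D) < \<infinity>"
    using potential_energy_finite_iff(1)[OF V sobolev0_measurable(1)[OF s]] by blast
  with s show ?thesis by (rule energy_spaceI)
qed

text \<open>Truncated test functions enter the state equation this way: a multiple of a function of
  finite energy controls both the finite part of \<open>V\<close> and the vanishing on the infinite
  part.\<close>

lemma energy_space_dominated: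
  assumes V: "V \<in> borel_measurable (lebesgue_on D)" and s: "sobolev0 D v H"
    and u: "u \<in> energy_space D V" and le: "AE x in lebesgue_on D. \<bar>v x\<bar> \<le> c * \<bar>u x\<bar>"
  shows "v \<in> energy_space D V"
proof (rule energy_spaceI[OF s], subst potential_energy_finite_iff(1)[OF V sobolev0_measurable(1)[OF s]], intro conjI)
  note Eu = energy_space_L2[OF V u]
  note [measurable] = sqrt_potential_measurable[OF V] sobolev0_measurable(1)[OF s]
  show "L2_on D (\<lambda>x. sqrt_potential V x * v x)"
  proof (rule L2_on_bound[OF Eu(1), of _ c])
    show "AE x in lebesgue_on D. norm (sqrt_potential V x * v x) \<le> c * norm (sqrt_potential V x * u x)"
      using le
    proof eventually_elim
      case (elim x)
      then have "\<bar>sqrt_potential V x\<bar> * \<bar>v x\<bar> \<le> \<bar>sqrt_potential V x\<bar> * (c * \<bar>u x\<bar>)" by (intro mult_left_mono) auto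
      then show ?case by (simp add: abs_mult mult_ac)
    qed
  qed measurable
  show "AE x in lebesgue_on D. V x = \<infinity> \<longrightarrow> v x = 0"
    using Eu(2) le by eventually_elim auto
qed

text \<open>Links the Bochner integral of the state equation with the nonnegative integral, to which
  Fatou's lemma applies. Where \<open>V\<close> is infinite the product \<open>u x * v x\<close> is
  0, so there both integrands vanish.\<close>

lemma potential_form:
  assumes V: "V \<in> borel_measurable (lebesgue_on D)"
    and u: "u \<in> energy_space D V" and v: "v \<in> energy_space D V"
  shows "(\<integral>x. enn2real (V x) * u x * v x \<partial>lebesgue_on D)
      = (\<integral>x. (sqrt_potential V x * u x) \<bullet> (sqrt_potential V x * v x) \<partial>lebesgue_on D)"
    and "integrable (lebesgue_on D) (\<lambda>x. enn2real (V x) * u x * v x)"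
    and "AE x in lebesgue_on D. 0 \<le> u x * v x \<Longrightarrow>
      (\<integral>\<^sup>+x. V x * ennreal (u x * v x) \<partial>lebesgue_on D) = ennreal (\<integral>x. enn2real (V x) * u x * v x \<partial>lebesgue_on D)"
proof -
  note Eu = energy_space_L2[OF V u] and Ev = energy_space_L2[OF V v]
  have eq: "(\<lambda>x. enn2real (V x) * u x * v x) = (\<lambda>x. (sqrt_potential V x * u x) \<bullet> (sqrt_potential V x * v x))"
    by (auto simp: fun_eq_iff sqrt_potential_square[symmetric] mult_ac)
  show "(\<integral>x. enn2real (V x) * u x * v x \<partial>lebesgue_on D)
      = (\<integral>x. (sqrt_potential V x * u x) \<bullet> (sqrt_potential V x * v x) \<partial>lebesgue_on D)"
    unfolding eq ..
  show i: "integrable (lebesgue_on D) (\<lambda>x. enn2real (V x) * u x * v x)"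
    unfolding eq by (rule L2_on_inner_integrable[OF Eu(1) Ev(1)])
  assume pos: "AE x in lebesgue_on D. 0 \<le> u x * v x"
  have "(\<integral>\<^sup>+x. V x * ennreal (u x * v x) \<partial>lebesgue_on D) = (\<integral>\<^sup>+x. ennreal (enn2real (V x) * u x * v x) \<partial>lebesgue_on D)"
    using Eu(2) pos
  proof (intro nn_integral_cong_AE, eventually_elim)
    case (elim x)
    show ?case
    proof (cases "V x")
      case (real r)
      then show ?thesis using elim by (simp add: ennreal_mult mult.assoc)
    qed (use elim in simp)
  qed
  also have "\<dots> = ennreal (\<integral>x. enn2real (V x) * u x * v x \<partial>lebesgue_on D)"
  proof (rule nn_integral_eq_integral[OF i])
    show "AE x in lebesgue_on D. 0 \<le> enn2real (V x) * u x * v x"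
      using pos by eventually_elim (simp add: mult.assoc)
  qed
  finally show "(\<integral>\<^sup>+x. V x * ennreal (u x * v x) \<partial>lebesgue_on D) = ennreal (\<integral>x. enn2real (V x) * u x * v x \<partial>lebesgue_on D)" .
qed

lemma l2_add_scaleR_square:
  assumes y: "L2_on D y" and z: "L2_on D z"
  shows "(l2 D (\<lambda>x. y x + t *\<^sub>R z x))\<^sup>2 = (l2 D y)\<^sup>2 + 2 * t * (\<integral>x. y x \<bullet> z x \<partial>lebesgue_on D) + t\<^sup>2 * (l2 D z)\<^sup>2"
proof -
  have "(norm (y x + t *\<^sub>R z x))\<^sup>2 = (norm (y x))\<^sup>2 + 2 * t * (y x \<bullet> z x) + t\<^sup>2 * (norm (z x))\<^sup>2" for x
    by (simp add: norm_add_square power_mult_distrib)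
  then show ?thesis
    unfolding l2_square using L2_on_integrable[OF y] L2_on_integrable[OF z] L2_on_inner_integrable[OF y z] by simp
qed

text \<open>At \<open>t = - a / c\<close> with \<open>c = \<bar>b\<bar> + 1\<close> the expression
  is at most \<open>- (a / c)\<^sup>2\<close>, which forces \<open>a = 0\<close>. It extracts the
  Euler-Lagrange equation from minimality.\<close>

lemma linear_term_eq_0:
  fixes a b :: real
  assumes "\<And>t. 0 \<le> t * a + t\<^sup>2 * b" shows "a = 0"
proof -
  define c where "c = \<bar>b\<bar> + 1"
  have c: "c > 0" "b \<le> c - 1" by (auto simp: c_def)
  have "0 \<le> (- a / c) * a + (- a / c)\<^sup>2 * b" by (rule assms)
  also have "\<dots> \<le> (- a / c) * a + (- a / c)\<^sup>2 * (c - 1)"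
    using c by (intro add_left_mono mult_left_mono) auto
  also have "\<dots> = - (a / c)\<^sup>2"
    using c by (simp add: power2_eq_square field_simps)
  finally show ?thesis using c by simp
qed

text \<open>The direct method for the quadratic energy \<open>J\<close>. Its sublevel sets are
  closed under midpoints, so \<open>convex_compactness\<close> supplies a minimising sequence with
  strongly converging gradients; Poincare gives the limit state, Fatou the lower semicontinuity of
  the potential energy, and the first variation the equation.\<close>

lemma weak_solution_exists:
  assumes V: "V \<in> borel_measurable (lebesgue_on D)" and f: "L2_on D f"
  shows "\<exists>u. weak_solution D V f u"
proof -
  define J where "J u G = ((l2 D G)\<^sup>2 + (l2 D (\<lambda>x. sqrt_potential V x * u x))\<^sup>2) / 2 - (\<integral>x. f x * u x \<partial>lebesgue_on D)"
    for u and G :: "real^'n \<Rightarrow> real^'n"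
  define A where "A u G \<longleftrightarrow> sobolev0 D u G \<and> u \<in> energy_space D V" for u G
  obtain C where C: "C > 0" "\<And>u G. sobolev0 D u G \<Longrightarrow> l2 D u \<le> C * l2 D G"
    by (rule Poincare_sobolev0) (rule that)
  define F where "F = l2 D f * C"
  have AL: "L2_on D u" "L2_on D G" "L2_on D (\<lambda>x. sqrt_potential V x * u x)" if "A u G" for u G
    using that sobolev0_L2 energy_space_L2(1)[OF V] unfolding A_def by blast+
  \<comment> \<open>Coercivity: Poincare bounds the load term by \<open>F\<close> times the norm of
    \<open>G\<close>, and \<open>(l2 D G / 2 - F)\<^sup>2 \<ge> 0\<close> splits this
    product.\<close>
  have lower: "(l2 D G)\<^sup>2 / 4 - F\<^sup>2 \<le> J u G" if a: "A u G" for u G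
  proof -
    have "(\<integral>x. f x * u x \<partial>lebesgue_on D) \<le> l2 D f * l2 D u"
      using l2_Cauchy_Schwarz_real[OF f AL(1)[OF a]] by linarith
    also have "\<dots> \<le> l2 D f * (C * l2 D G)"
      using a C(2) by (intro mult_left_mono) (auto simp: A_def)
    also have "\<dots> \<le> (l2 D G)\<^sup>2 / 4 + F\<^sup>2"
      using zero_le_power2[of "l2 D G / 2 - F"] by (simp add: F_def power2_diff power_divide mult_ac)
    finally show ?thesis
      using zero_le_power2[of "l2 D (\<lambda>x. sqrt_potential V x * u x)"] unfolding J_def by argo
  qed
  have A0: "A (\<lambda>_. 0) (\<lambda>_. 0)"
  proof -
    have "sobolev0 D (\<lambda>_. 0) (grad (\<lambda>_. 0))" by (rule sobolev0_test_function[OF test_function_zero])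
    moreover have "grad (\<lambda>_::real^'n. 0) = (\<lambda>_. 0)" by (simp add: fun_eq_iff vec_eq_iff)
    ultimately show ?thesis unfolding A_def by (auto intro!: energy_spaceI)
  qed
  have J0: "J (\<lambda>_. 0) (\<lambda>_. 0) = 0" by (simp add: J_def)
  define S where "S = {J u G | u G. A u G}"
  define j where "j = Inf S"
  have S0: "0 \<in> S" unfolding S_def using A0 J0[symmetric] by blast
  have bdd: "bdd_below S"
    unfolding S_def by (rule bdd_belowI[of _ "- F\<^sup>2"]) (use lower in \<open>force intro: order_trans[rotated]\<close>)
  have j_le: "j \<le> J u G" if "A u G" for u G
    unfolding j_def using that by (intro cInf_lower bdd) (auto simp: S_def)
  have j0: "j \<le> 0" unfolding j_def by (rule cInf_lower[OF S0 bdd])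
  define e where "e n = inverse (real (Suc n))" for n
  have e: "e \<longlonglongrightarrow> 0" "e n > 0" "e n \<le> 1" "m \<le> n \<Longrightarrow> e n \<le> e m" for m n
    unfolding e_def by (rule LIMSEQ_inverse_real_of_nat) (auto simp: field_simps)
  have mid: "A (\<lambda>x. (1/2) * (u x + v x)) (\<lambda>x. (1/2) *\<^sub>R (G x + H x)) \<and>
      J (\<lambda>x. (1/2) * (u x + v x)) (\<lambda>x. (1/2) *\<^sub>R (G x + H x)) \<le> (J u G + J v H) / 2"
    if a: "A u G" "A v H" for u G v H
  proof
    show "A (\<lambda>x. (1/2) * (u x + v x)) (\<lambda>x. (1/2) *\<^sub>R (G x + H x))"
      using a sobolev0_lincomb[of u G v H "1/2" "1/2"] energy_space_lincomb[OF V, of u v "1/2" "1/2"]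
      by (simp add: A_def algebra_simps add_divide_distrib)
    have s: "(\<lambda>x. sqrt_potential V x * ((1/2) * (u x + v x))) = (\<lambda>x. (1/2) *\<^sub>R (sqrt_potential V x * u x + sqrt_potential V x * v x))"
      by (simp add: fun_eq_iff algebra_simps)
    have "(\<integral>x. f x * ((1/2) * (u x + v x)) \<partial>lebesgue_on D) = ((\<integral>x. f x * u x \<partial>lebesgue_on D) + (\<integral>x. f x * v x \<partial>lebesgue_on D)) / 2"
      using L2_on_mult_integrable[OF f AL(1)[OF a(1)]] L2_on_mult_integrable[OF f AL(1)[OF a(2)]]
      by (simp add: distrib_left add_divide_distrib)
    then show "J (\<lambda>x. (1/2) * (u x + v x)) (\<lambda>x. (1/2) *\<^sub>R (G x + H x)) \<le> (J u G + J v H) / 2"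
      using zero_le_power2[of "l2 D (\<lambda>x. G x - H x)"]
        zero_le_power2[of "l2 D (\<lambda>x. sqrt_potential V x * u x - sqrt_potential V x * v x)"]
      unfolding J_def s l2_parallelogram[OF AL(2)[OF a(1)] AL(2)[OF a(2)]]
        l2_parallelogram[OF AL(3)[OF a(1)] AL(3)[OF a(2)]] by argo
  qed
  \<comment> \<open>The potential component is frozen at \<open>V\<close>; only the compactness of
    the gradients is exploited here.\<close>
  define K where "K n = {(G, W). W = V \<and> (\<exists>u. A u G \<and> J u G \<le> j + e n)}" for n
  obtain G W G0 W0 where GK: "\<And>n::nat. (G n, W n) \<in> K n" and G0: "L2_on D G0" "(\<lambda>n. l2 D (\<lambda>x. G n x - G0 x)) \<longlonglongrightarrow> 0"
  proof (rule convex_compactness[of K "2 * sqrt (1 + F\<^sup>2)"])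
    fix n
    have "\<exists>c\<in>S. c < j + e n" using cInf_lessD[of S "j + e n"] S0 e(2)[of n] by (auto simp: j_def)
    then show "K n \<noteq> {}" unfolding K_def S_def by (force intro: less_imp_le)
  next
    fix m n :: nat assume "m \<le> n"
    then show "K n \<subseteq> K m" using e(4)[of m n] unfolding K_def by (auto intro: order_trans)
  next
    fix n G W H Y assume "(G, W) \<in> K n" "(H, Y) \<in> K n"
    then obtain u v where uv: "W = V" "Y = V" "A u G" "J u G \<le> j + e n" "A v H" "J v H \<le> j + e n"
      by (auto simp: K_def)
    have "(V x + V x) / 2 = V x" for x
      by (simp add: mult_2[symmetric] mult.commute[of 2] ennreal_mult_divide_eq)
    then show "(\<lambda>x. (1/2) *\<^sub>R (G x + H x), \<lambda>x. (W x + Y x) / 2) \<in> K n"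
      using mid[OF uv(3,5)] uv unfolding K_def by (auto intro!: exI[of _ "\<lambda>x. (1/2) * (u x + v x)"])
  next
    fix n H Y assume "(H, Y) \<in> K n"
    then obtain u where u: "Y = V" "A u H" "J u H \<le> j + e n" by (auto simp: K_def)
    show "L2_on D H" by (rule AL(2)[OF u(2)])
    show "Y \<in> borel_measurable (lebesgue_on D)" using V u by simp
    \<comment> \<open>The zero function shows \<open>j \<le> 0\<close> and
      \<open>e n \<le> 1\<close>, so coercivity bounds the squared gradient norm by
      \<open>4 * (1 + F\<^sup>2)\<close>.\<close>
    have "(l2 D H)\<^sup>2 / 4 \<le> 1 + F\<^sup>2" using lower[OF u(2)] u(3) j0 e(3)[of n] by linarith
    then have "(l2 D H)\<^sup>2 \<le> (2 * sqrt (1 + F\<^sup>2))\<^sup>2" by (simp add: power_mult_distrib)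
    then show "l2 D H \<le> 2 * sqrt (1 + F\<^sup>2)" by (rule power2_le_imp_le) simp
  qed (rule that)
  then have "\<forall>n. \<exists>u. A u (G n) \<and> J u (G n) \<le> j + e n" by (auto simp: K_def)
  then obtain u where u: "\<And>n. A (u n) (G n)" "\<And>n. J (u n) (G n) \<le> j + e n" by metis
  have us: "sobolev0 D (u n) (G n)" "u n \<in> energy_space D V" for n using u(1) by (auto simp: A_def)
  obtain v where v: "sobolev0 D v G0" "(\<lambda>n. l2 D (\<lambda>x. u n x - v x)) \<longlonglongrightarrow> 0"
    by (rule sobolev0_limit[OF us(1) G0]) (rule that)
  note Lv = sobolev0_L2[OF v(1)] and Lu = AL[OF u(1)]
  obtain r where r: "strict_mono r" "AE x in lebesgue_on D. (\<lambda>n. u (r n) x) \<longlonglongrightarrow> v x"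
    by (rule L2_tendsto_AE_subseq[OF Lu(1) Lv(1) v(2)]) (rule that)
  \<comment> \<open>The inequality \<open>J (u n) (G n) \<le> j + e n\<close> solved for the
    potential energy; every term on the right converges, which gives Fatou a convergent
    bound.\<close>
  define b where "b n = 2 * (j + e n) - (l2 D (G n))\<^sup>2 + 2 * (\<integral>x. f x * u n x \<partial>lebesgue_on D)" for n
  define b0 where "b0 = 2 * j - (l2 D G0)\<^sup>2 + 2 * (\<integral>x. f x * v x \<partial>lebesgue_on D)"
  have "(\<lambda>n. \<integral>x. u n x \<bullet> f x \<partial>lebesgue_on D) \<longlonglongrightarrow> (\<integral>x. v x \<bullet> f x \<partial>lebesgue_on D)"
    by (rule tendsto_inner_L2_left[OF Lu(1) Lv(1) v(2) f])
  then have fu: "(\<lambda>n. \<integral>x. f x * u n x \<partial>lebesgue_on D) \<longlonglongrightarrow> (\<integral>x. f x * v x \<partial>lebesgue_on D)"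
    by (simp add: mult.commute)
  have "b \<longlonglongrightarrow> 2 * (j + 0) - (l2 D G0)\<^sup>2 + 2 * (\<integral>x. f x * v x \<partial>lebesgue_on D)"
    unfolding b_def[abs_def] by (intro tendsto_intros e fu tendsto_l2[OF Lu(2) Lv(2) G0(2)])
  then have b: "b \<longlonglongrightarrow> b0" by (simp add: b0_def)
  have Eb: "(l2 D (\<lambda>x. sqrt_potential V x * u n x))\<^sup>2 \<le> b n" for n
    using u(2)[of n] unfolding J_def b_def by argo
  then have b_pos: "0 \<le> b n" for n using order_trans[OF zero_le_power2] by blast
  have b0_pos: "0 \<le> b0" by (rule LIMSEQ_le_const[OF b]) (use b_pos in blast)
  have "(\<integral>\<^sup>+x. V x * ennreal ((v x)\<^sup>2) \<partial>lebesgue_on D) \<le> ennreal b0"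
  proof (rule nn_integral_Fatou_AE)
    show "(\<lambda>x. V x * ennreal ((u (r n) x)\<^sup>2)) \<in> borel_measurable (lebesgue_on D)" for n
      using V L2_on_measurable[OF Lu(1)[of "r n"]] by measurable
    show "AE x in lebesgue_on D. (\<lambda>n. V x * ennreal ((u (r n) x)\<^sup>2)) \<longlonglongrightarrow> V x * ennreal ((v x)\<^sup>2)"
    proof -
      \<comment> \<open>Multiplication by \<infinity> is discontinuous at 0. Where \<open>V\<close>
        is infinite, however, all the \<open>u n\<close> vanish outside one common null set, and so
        does the limit.\<close>
      have "AE x in lebesgue_on D. \<forall>n. V x = \<infinity> \<longrightarrow> u (r n) x = 0"
        unfolding AE_all_countable using energy_space_L2(2)[OF V us(2)] by blast
      then show ?thesis using r(2)
      proof eventually_elim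
        case (elim x)
        show ?case
        proof (cases "V x = \<infinity>")
          case True
          then have "(\<lambda>n. u (r n) x) = (\<lambda>_. 0)" using elim by auto
          then have "v x = 0" using elim(2) by (simp add: LIMSEQ_const_iff)
          then show ?thesis using elim(1) True by simp
        next
          case False
          then show ?thesis
            by (intro ennreal_tendsto_cmult tendsto_ennrealI tendsto_power elim(2)) (simp add: less_top)
        qed
      qed
    qed
    show "(\<integral>\<^sup>+x. V x * ennreal ((u (r n) x)\<^sup>2) \<partial>lebesgue_on D) \<le> ennreal (b (r n))" for n
      using Eb[of "r n"] by (simp add: energy_space_L2(3)[OF V us(2)] ennreal_leI)
    show "(\<lambda>n. ennreal (b (r n))) \<longlonglongrightarrow> ennreal b0"
      using LIMSEQ_subseq_LIMSEQ[OF b r(1)] by (auto simp: o_def)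
  qed
  note Ev_le = this
  then have Ev: "v \<in> energy_space D V"
    by (intro energy_spaceI[OF v(1)]) (auto intro: le_less_trans)
  have Av: "A v G0" using v(1) Ev by (simp add: A_def)
  have "(l2 D (\<lambda>x. sqrt_potential V x * v x))\<^sup>2 \<le> b0"
    using Ev_le b0_pos unfolding energy_space_L2(3)[OF V Ev] by simp
  then have Jv: "J v G0 \<le> j" unfolding J_def b0_def by argo
  have EL: "(\<integral>x. G0 x \<bullet> \<Phi> x \<partial>lebesgue_on D) + (\<integral>x. enn2real (V x) * v x * \<phi> x \<partial>lebesgue_on D) = (\<integral>x. f x * \<phi> x \<partial>lebesgue_on D)"
    if \<phi>: "sobolev0 D \<phi> \<Phi>" "\<phi> \<in> energy_space D V" for \<phi> \<Phi>
  proof -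
    have a\<phi>: "A \<phi> \<Phi>" using \<phi> by (simp add: A_def)
    let ?sv = "\<lambda>x. sqrt_potential V x * v x" and ?s\<phi> = "\<lambda>x. sqrt_potential V x * \<phi> x"
    let ?a = "(\<integral>x. G0 x \<bullet> \<Phi> x \<partial>lebesgue_on D) + (\<integral>x. ?sv x \<bullet> ?s\<phi> x \<partial>lebesgue_on D) - (\<integral>x. f x * \<phi> x \<partial>lebesgue_on D)"
    have "0 \<le> t * ?a + t\<^sup>2 * (((l2 D \<Phi>)\<^sup>2 + (l2 D ?s\<phi>)\<^sup>2) / 2)" for t
    proof -
      have "A (\<lambda>x. v x + t * \<phi> x) (\<lambda>x. G0 x + t *\<^sub>R \<Phi> x)"
        using sobolev0_lincomb[OF v(1) \<phi>(1), of 1 t] energy_space_lincomb[OF V Ev \<phi>(2), of 1 t] by (simp add: A_def)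
      then have m1: "J v G0 \<le> J (\<lambda>x. v x + t * \<phi> x) (\<lambda>x. G0 x + t *\<^sub>R \<Phi> x)"
        by (intro order_trans[OF Jv] j_le)
      have m2: "(\<integral>x. f x * (v x + t * \<phi> x) \<partial>lebesgue_on D) = (\<integral>x. f x * v x \<partial>lebesgue_on D) + t * (\<integral>x. f x * \<phi> x \<partial>lebesgue_on D)"
        using L2_on_mult_integrable[OF f Lv(1)] L2_on_mult_integrable[OF f AL(1)[OF a\<phi>]]
        by (simp add: distrib_left mult.left_commute[of _ t])
      have m3: "(\<lambda>x. sqrt_potential V x * (v x + t * \<phi> x)) = (\<lambda>x. ?sv x + t *\<^sub>R ?s\<phi> x)"
        by (simp add: fun_eq_iff algebra_simps)
      have alg: "((X + 2 * t * a1 + t\<^sup>2 * b1) + (Y + 2 * t * a2 + t\<^sup>2 * b2)) / 2 - (c1 + t * c2)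
          = ((X + Y) / 2 - c1) + (t * (a1 + a2 - c2) + t\<^sup>2 * ((b1 + b2) / 2))" for X Y a1 a2 b1 b2 c1 c2 :: real
        by (simp add: field_simps)
      from m1 show ?thesis
        unfolding J_def m2 m3 l2_add_scaleR_square[OF Lv(2) AL(2)[OF a\<phi>]]
          l2_add_scaleR_square[OF AL(3)[OF Av] AL(3)[OF a\<phi>]] alg by simp
    qed
    then have "?a = 0" by (rule linear_term_eq_0)
    then show ?thesis unfolding potential_form(1)[OF V Ev \<phi>(2)] by simp
  qed
  have "weak_solution D V f v"
    unfolding weak_solution_def
  proof (intro conjI Ev exI[of _ G0] allI impI sobolev0_H1_gradient v(1))
    fix \<phi> \<Phi> assume *: "\<phi> \<in> energy_space D V \<and> H1_gradient D \<phi> \<Phi>"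
    then obtain \<Phi>' where \<Phi>': "sobolev0 D \<phi> \<Phi>'" using H10_iff_sobolev0 by (auto simp: energy_space_def)
    \<comment> \<open>\<open>weak_solution\<close> quantifies over every distributional gradient of
      the test function; it is replaced by the one that is a limit of test gradients.\<close>
    have "(\<integral>x. \<Phi> x \<bullet> G0 x \<partial>lebesgue_on D) = (\<integral>x. \<Phi>' x \<bullet> G0 x \<partial>lebesgue_on D)"
      using * by (intro integral_inner_gradient_eq[OF _ sobolev0_H1_gradient[OF \<Phi>'] v(1)]) simp
    then show "(\<integral>x. G0 x \<bullet> \<Phi> x \<partial>lebesgue_on D) + (\<integral>x. enn2real (V x) * v x * \<phi> x \<partial>lebesgue_on D) = (\<integral>x. f x * \<phi> x \<partial>lebesgue_on D)"
      using EL[OF \<Phi>'] * by (simp add: inner_commute)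
  qed
  then show ?thesis by blast
qed

lemma resolvent_weak_solution:
  assumes "V \<in> borel_measurable (lebesgue_on D)" "L2_on D f"
  shows "weak_solution D V f (resolvent D V f)"
  unfolding resolvent_def using weak_solution_exists[OF assms] by (rule someI_ex)

text \<open>Exchanges the distributional gradient of the state for a \<open>sobolev0\<close>
  gradient, which is the form in which the chain rules can be used on the state and on test
  functions built from it.\<close>

lemma resolvent_equation:
  assumes V: "V \<in> borel_measurable (lebesgue_on D)" and f: "L2_on D f"
  obtains G where "sobolev0 D (resolvent D V f) G" "resolvent D V f \<in> energy_space D V"
    "\<And>\<phi> \<Phi>. sobolev0 D \<phi> \<Phi> \<Longrightarrow> \<phi> \<in> energy_space D V \<Longrightarrow>
      (\<integral>x. G x \<bullet> \<Phi> x \<partial>lebesgue_on D) + (\<integral>x. enn2real (V x) * resolvent D V f x * \<phi> x \<partial>lebesgue_on D)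
        = (\<integral>x. f x * \<phi> x \<partial>lebesgue_on D)"
proof -
  let ?u = "resolvent D V f"
  from resolvent_weak_solution[OF assms] obtain U where E: "?u \<in> energy_space D V" and U: "H1_gradient D ?u U"
    and eq: "\<And>\<phi> \<Phi>. \<phi> \<in> energy_space D V \<Longrightarrow> H1_gradient D \<phi> \<Phi> \<Longrightarrow>
       (\<integral>x. U x \<bullet> \<Phi> x \<partial>lebesgue_on D) + (\<integral>x. enn2real (V x) * ?u x * \<phi> x \<partial>lebesgue_on D) = (\<integral>x. f x * \<phi> x \<partial>lebesgue_on D)"
    by (auto simp: weak_solution_def)
  obtain G where G: "sobolev0 D ?u G" using E H10_iff_sobolev0 by (auto simp: energy_space_def)
  show ?thesis
  proof (rule that[OF G E])
    fix \<phi> \<Phi> assume \<phi>: "sobolev0 D \<phi> \<Phi>" "\<phi> \<in> energy_space D V"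
    show "(\<integral>x. G x \<bullet> \<Phi> x \<partial>lebesgue_on D) + (\<integral>x. enn2real (V x) * ?u x * \<phi> x \<partial>lebesgue_on D) = (\<integral>x. f x * \<phi> x \<partial>lebesgue_on D)"
      using eq[OF \<phi>(2) sobolev0_H1_gradient[OF \<phi>(1)]]
        integral_inner_gradient_eq[OF U sobolev0_H1_gradient[OF G] \<phi>(1)] by simp
  qed
qed

end

section \<open>Truncations and the weight function\<close>

text \<open>Left of 0 the composition is constant; \<open>k' 0 = 0\<close> makes the one-sided
  derivatives agree at 0, where the difference quotients are dominated by those of
  \<open>k\<close>.\<close>

lemma DERIV_compose_positive_part:
  assumes k: "\<And>s. (k has_real_derivative k' s) (at s)" and "k' 0 = 0"
  shows "((\<lambda>t. k (max t 0)) has_real_derivative k' (max t 0)) (at t)"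
proof -
  consider "t > 0" | "t < 0" | "t = 0" by linarith
  then show ?thesis
  proof cases
    case 1
    have "((\<lambda>t. k (max t 0)) has_real_derivative k' t) (at t)"
      by (rule has_field_derivative_transform_within_open[OF k, of "{0<..}"]) (use 1 in auto)
    then show ?thesis using 1 by simp
  next
    case 2
    have "((\<lambda>t. k (max t 0)) has_real_derivative 0) (at t)"
      by (rule has_field_derivative_transform_within_open[OF DERIV_const[of "k 0"], of "{..<0}"]) (use 2 in auto)
    then show ?thesis using 2 assms(2) by simp
  next
    case 3
    have "((\<lambda>h. (k (0 + h) - k 0) / h) \<longlongrightarrow> 0) (at 0)"
      using k[of 0] assms(2) by (simp add: DERIV_def)
    then have lim: "((\<lambda>h. \<bar>(k (0 + h) - k 0) / h\<bar>) \<longlongrightarrow> 0) (at 0)" by (rule tendsto_rabs_zero)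
    have "norm ((k (max (0 + h) 0) - k (max 0 0)) / h) \<le> \<bar>(k (0 + h) - k 0) / h\<bar>" for h
    proof (cases "h \<ge> 0")
      case False
      then have "max (0 + h) 0 = max 0 0" by simp
      then show ?thesis by (simp only: diff_self div_0 norm_zero abs_ge_zero)
    qed simp
    then have "((\<lambda>h. (k (max (0 + h) 0) - k (max 0 0)) / h) \<longlongrightarrow> 0) (at 0)"
      by (intro Lim_null_comparison[OF always_eventually lim] allI)
    then show ?thesis using 3 assms(2) by (simp add: DERIV_def)
  qed
qed

text \<open>The square removes the kink of the positive part, so this is C1 with an explicit
  rational derivative. It takes values in [0,1) and is positive exactly on the positive half
  line.\<close>

definition ramp :: "real \<Rightarrow> real" where
  "ramp t = (max t 0)\<^sup>2 / (1 + (max t 0)\<^sup>2)"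

definition ramp' :: "real \<Rightarrow> real" where
  "ramp' t = 2 * max t 0 / (1 + (max t 0)\<^sup>2)\<^sup>2"

lemma one_plus_square_pos: "1 + s\<^sup>2 > (0::real)"
  using zero_le_power2[of s] by linarith

lemma ramp_C1: "C1_Lipschitz ramp ramp' 1"
  unfolding C1_Lipschitz_def
proof (intro conjI allI)
  fix t
  have "((\<lambda>s. s\<^sup>2 / (1 + s\<^sup>2)) has_real_derivative 2 * s / (1 + s\<^sup>2)\<^sup>2) (at s)" for s :: real
    using one_plus_square_pos[of s]
    by (auto intro!: derivative_eq_intros simp: power2_eq_square) (simp add: algebra_simps)
  from DERIV_compose_positive_part[OF this, of t] show "(ramp has_real_derivative ramp' t) (at t)"
    by (simp add: ramp_def[abs_def] ramp'_def)
  define s where "s = max t 0"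
  have s: "s \<ge> 0" by (simp add: s_def)
  have "2 * s \<le> 1 + s\<^sup>2" using zero_le_power2[of "s - 1"] by (simp add: power2_diff)
  also have "\<dots> \<le> (1 + s\<^sup>2)\<^sup>2" by (rule self_le_power) auto
  finally show "\<bar>ramp' t\<bar> \<le> 1" using s one_plus_square_pos[of s] by (simp add: ramp'_def s_def[symmetric] abs_divide)
next
  have "(1 + (max t 0)\<^sup>2)\<^sup>2 \<noteq> 0" for t :: real using one_plus_square_pos[of "max t 0"] by simp
  then show "continuous_on UNIV ramp'"
    unfolding ramp'_def[abs_def] by (intro continuous_intros) auto
qed

lemma ramp_bounds: "0 \<le> ramp t" "ramp t \<le> 1" "t \<le> 0 \<Longrightarrow> ramp t = 0" "t > 0 \<Longrightarrow> ramp t > 0" "0 \<le> ramp' t"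
  using one_plus_square_pos[of "max t 0"] by (auto simp: ramp_def ramp'_def divide_le_eq zero_less_divide_iff)

lemma ramp_tendsto_1:
  assumes "s > 0" shows "(\<lambda>n. ramp (real (Suc n) * s)) \<longlonglongrightarrow> 1"
proof -
  have eq: "ramp (real (Suc n) * s) = 1 - 1 / (1 + (real (Suc n) * s)\<^sup>2)" for n
    using assms one_plus_square_pos[of "real (Suc n) * s"] by (simp add: ramp_def field_simps)
  have "(\<lambda>n. 1 / (1 + (real (Suc n) * s)\<^sup>2)) \<longlonglongrightarrow> 0"
  proof (rule Lim_null_comparison[OF always_eventually], rule allI)
    fix n
    have "real (Suc n) * s\<^sup>2 \<le> (real (Suc n))\<^sup>2 * s\<^sup>2"
      by (intro mult_right_mono self_le_power) auto
    then have "real (Suc n) * s\<^sup>2 \<le> 1 + (real (Suc n) * s)\<^sup>2"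
      unfolding power_mult_distrib by linarith
    then have "1 / (1 + (real (Suc n) * s)\<^sup>2) \<le> 1 / (real (Suc n) * s\<^sup>2)"
      using assms by (intro divide_left_mono) (auto simp del: of_nat_Suc intro!: mult_pos_pos one_plus_square_pos)
    then show "norm (1 / (1 + (real (Suc n) * s)\<^sup>2)) \<le> inverse (real (Suc n)) * (1 / s\<^sup>2)"
      using one_plus_square_pos[of "real (Suc n) * s"] by (simp add: field_simps del: of_nat_Suc)
    show "(\<lambda>n. inverse (real (Suc n)) * (1 / s\<^sup>2)) \<longlonglongrightarrow> 0"
      by (rule tendsto_mult_left_zero[OF LIMSEQ_inverse_real_of_nat])
  qed
  from tendsto_diff[OF tendsto_const[of 1] this] show ?thesis unfolding eq by simp
qed

text \<open>\<open>negative_ramp m\<close> increases to the indicator of \<open>{t. t < 0}\<close> as \<open>m \<longrightarrow> \<infinity>\<close>, and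
  \<open>negative_ramp_primitive m\<close> converges to \<open>min t 0\<close>.\<close>

definition negative_ramp :: "real \<Rightarrow> real \<Rightarrow> real" where
  "negative_ramp m t = ramp (m * (- t))"

definition negative_ramp' :: "real \<Rightarrow> real \<Rightarrow> real" where
  "negative_ramp' m t = - m * ramp' (m * (- t))"

definition negative_ramp_primitive :: "real \<Rightarrow> real \<Rightarrow> real" where
  "negative_ramp_primitive m t = arctan (m * max (- t) 0) / m - max (- t) 0"

lemma negative_ramp_C1:
  assumes "m > 0" shows "C1_Lipschitz (negative_ramp m) (negative_ramp' m) m"
  unfolding C1_Lipschitz_def
proof (intro conjI allI)
  fix t
  have r: "(ramp has_real_derivative ramp' s) (at s)" for s using ramp_C1 by (simp add: C1_Lipschitz_def)
  have "((\<lambda>t. ramp (m * (- t))) has_real_derivative ramp' (m * (- t)) * (- m)) (at t)"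
    by (rule DERIV_chain2[OF r]) (auto intro!: derivative_eq_intros)
  then show "(negative_ramp m has_real_derivative negative_ramp' m t) (at t)"
    by (simp add: negative_ramp_def[abs_def] negative_ramp'_def mult.commute)
  have "\<bar>ramp' (m * (- t))\<bar> \<le> 1" using ramp_C1 unfolding C1_Lipschitz_def by blast
  then show "\<bar>negative_ramp' m t\<bar> \<le> m"
    using assms by (simp add: negative_ramp'_def abs_mult mult_left_le)
next
  have c: "continuous_on UNIV ramp'" "continuous_on UNIV (\<lambda>t. m * (- t))"
    using ramp_C1 by (auto simp: C1_Lipschitz_def intro!: continuous_intros)
  have "continuous_on UNIV (\<lambda>t. ramp' (m * (- t)))"
    by (rule continuous_on_compose2[OF c]) simp
  then show "continuous_on UNIV (negative_ramp' m)"
    unfolding negative_ramp'_def[abs_def] by (intro continuous_on_mult continuous_on_const)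
qed

text \<open>The sign of the derivative permits dropping the gradient term when the state equation is
  tested. The last bound, by the Lipschitz constant \<open>m\<close> and the value 0 at 0, keeps
  such test functions in the energy space.\<close>

lemma negative_ramp_bounds:
  assumes "m > 0"
  shows "0 \<le> negative_ramp m t" "negative_ramp m t \<le> 1" "t \<ge> 0 \<Longrightarrow> negative_ramp m t = 0" "negative_ramp' m t \<le> 0"
    "\<bar>negative_ramp m t\<bar> \<le> m * \<bar>t\<bar>"
proof -
  show 0: "t \<ge> 0 \<Longrightarrow> negative_ramp m t = 0" for t
    using assms ramp_bounds(3)[of "- (m * t)"] by (simp add: negative_ramp_def)
  show "0 \<le> negative_ramp m t" "negative_ramp m t \<le> 1" "negative_ramp' m t \<le> 0"
    using assms ramp_bounds by (auto simp: negative_ramp_def negative_ramp'_def)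
  show "\<bar>negative_ramp m t\<bar> \<le> m * \<bar>t\<bar>"
    using C1_Lipschitz_diff_le[OF negative_ramp_C1[OF assms], of t 0] 0[of 0] by simp
qed

lemma negative_ramp_tendsto:
  "(\<lambda>n. negative_ramp (real (Suc n)) t) \<longlonglongrightarrow> (if t < 0 then 1 else 0)"
  using ramp_tendsto_1[of "- t"] negative_ramp_bounds(3)[of "real (Suc _)" t]
  by (auto simp: negative_ramp_def simp del: of_nat_Suc)

text \<open>With \<open>s = max (- t) 0\<close> the ramp equals
  \<open>1 - 1 / (1 + (m * s)\<^sup>2)\<close>, whence the arctangent in its antiderivative. The
  derivative vanishes at \<open>s = 0\<close>, so the positive part may be composed in.\<close>

lemma negative_ramp_primitive_C1:
  assumes "m > 0" shows "C1_Lipschitz (negative_ramp_primitive m) (negative_ramp m) 1"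
  unfolding C1_Lipschitz_def
proof (intro conjI allI)
  fix t
  define k where "k s = arctan (m * s) / m - s" for s
  define k' where "k' s = 1 / (1 + (m * s)\<^sup>2) - 1" for s
  have dk: "(k has_real_derivative k' s) (at s)" for s
  proof -
    have "((\<lambda>s. arctan (m * s)) has_real_derivative inverse (1 + (m * s)\<^sup>2) * m) (at s)"
      by (rule DERIV_chain2[OF DERIV_arctan]) (auto intro!: derivative_eq_intros)
    from DERIV_diff[OF DERIV_cdivide[OF this, of m] DERIV_ident] show ?thesis
      using assms unfolding k_def[abs_def] k'_def by (simp add: inverse_eq_divide)
  qed
  have k0: "k' 0 = 0" by (simp add: k'_def)
  have "((\<lambda>t. k (max (- t) 0)) has_real_derivative k' (max (- t) 0) * (- 1)) (at t)"
    by (rule DERIV_chain2[OF DERIV_compose_positive_part[OF dk k0]]) (auto intro!: derivative_eq_intros)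
  moreover have "k' (max (- t) 0) * (- 1) = negative_ramp m t"
  proof -
    have "max (m * (- t)) 0 = m * max (- t) 0"
      using assms by (simp add: max_mult_distrib_left)
    then show ?thesis using one_plus_square_pos[of "m * max (- t) 0"]
      by (simp add: k'_def negative_ramp_def ramp_def field_simps)
  qed
  ultimately show "(negative_ramp_primitive m has_real_derivative negative_ramp m t) (at t)"
    by (simp add: k_def negative_ramp_primitive_def[abs_def])
  show "\<bar>negative_ramp m t\<bar> \<le> 1" using negative_ramp_bounds(1,2)[OF assms, of t] by simp
next
  have "continuous_on UNIV (negative_ramp m)"
    using negative_ramp_C1[OF assms] DERIV_isCont unfolding C1_Lipschitz_def
    by (blast intro: continuous_at_imp_continuous_on)
  then show "continuous_on UNIV (negative_ramp m)" .
qed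

lemma negative_ramp_primitive_tendsto:
  "(\<lambda>n. negative_ramp_primitive (real (Suc n)) t) \<longlonglongrightarrow> min t 0"
proof -
  define s where "s = max (- t) 0"
  have "(\<lambda>n. arctan (real (Suc n) * s) / real (Suc n)) \<longlonglongrightarrow> 0"
  proof (rule Lim_null_comparison[OF always_eventually], rule allI)
    fix n
    have "\<bar>arctan (real (Suc n) * s)\<bar> \<le> pi / 2"
      using arctan_bounded[of "real (Suc n) * s"] by linarith
    then show "norm (arctan (real (Suc n) * s) / real (Suc n)) \<le> inverse (real (Suc n)) * (pi / 2)"
      by (simp add: abs_divide field_simps del: of_nat_Suc)
    show "(\<lambda>n. inverse (real (Suc n)) * (pi / 2)) \<longlonglongrightarrow> 0"
      by (rule tendsto_mult_left_zero[OF LIMSEQ_inverse_real_of_nat])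
  qed
  then have "(\<lambda>n. negative_ramp_primitive (real (Suc n)) t) \<longlonglongrightarrow> 0 - s"
    unfolding negative_ramp_primitive_def s_def by (intro tendsto_diff tendsto_const)
  moreover have "0 - s = min t 0" by (auto simp: s_def max_def min_def)
  ultimately show ?thesis by (simp only:)
qed

section \<open>Limits of products with values in [0,\<infinity>]\<close>

lemma ennreal_tendsto_mult:
  fixes f g :: "'a \<Rightarrow> ennreal"
  assumes "(f \<longlongrightarrow> a) F" "(g \<longlongrightarrow> b) F" "\<not> (a = 0 \<and> b = top)" "\<not> (a = top \<and> b = 0)"
  shows "((\<lambda>x. f x * g x) \<longlongrightarrow> a * b) F"
proof -
  have z: "enn2ereal c = 0 \<longleftrightarrow> c = 0" for c by (metis enn2ereal_inject zero_ennreal.rep_eq)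
  have t: "\<bar>enn2ereal c\<bar> = \<infinity> \<longleftrightarrow> c = top" for c by (cases c) auto
  have "((\<lambda>x. enn2ereal (f x) * enn2ereal (g x)) \<longlongrightarrow> enn2ereal a * enn2ereal b) F"
    by (rule tendsto_mult_ereal) (use assms in \<open>auto simp: z t\<close>)
  then show ?thesis by (simp flip: times_ennreal.rep_eq)
qed

lemma INF_tail_tendsto:
  fixes h :: "nat \<Rightarrow> ennreal"
  assumes "h \<longlonglongrightarrow> l"
  shows "(\<lambda>n. INF k\<in>{n..}. h k) \<longlonglongrightarrow> l" and "(INF k\<in>{n..}. h k) \<le> l"
proof -
  have l: "l = (SUP n. INF k\<in>{n..}. h k)"
    using lim_imp_Liminf[OF _ assms] by (simp add: liminf_SUP_INF)
  have "incseq (\<lambda>n. INF k\<in>{n..}. h k)"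
    by (auto simp: incseq_def intro!: INF_superset_mono)
  then show "(\<lambda>n. INF k\<in>{n..}. h k) \<longlonglongrightarrow> l" unfolding l by (rule LIMSEQ_SUP)
  show "(INF k\<in>{n..}. h k) \<le> l" unfolding l by (rule SUP_upper) simp
qed

text \<open>The infimum over the tail of \<open>h\<close> allows \<open>V n\<close> to be a convex combination of potentials with indices
  at least \<open>n\<close>.\<close>

lemma nn_integral_mult_lsc:
  fixes V h :: "nat \<Rightarrow> 'a \<Rightarrow> ennreal"
  assumes [measurable]: "\<And>n. V n \<in> borel_measurable M" "\<And>n. h n \<in> borel_measurable M"
    and lim: "AE x in M. (\<lambda>n. V n x) \<longlonglongrightarrow> W x" "AE x in M. (\<lambda>n. h n x) \<longlonglongrightarrow> l x" "\<And>x. l x < top"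
    and b: "\<And>n. n \<ge> N \<Longrightarrow> (\<integral>\<^sup>+x. V n x * (INF k\<in>{n..}. h k x) \<partial>M) \<le> b n" "b \<longlonglongrightarrow> c"
  shows "(\<integral>\<^sup>+x. W x * l x \<partial>M) \<le> c"
proof (rule nn_integral_Fatou_AE)
  have [measurable]: "(\<lambda>x. INF k\<in>{n..}. h k x) \<in> borel_measurable M" for n
    by (intro borel_measurable_INF) auto
  show "(\<lambda>x. V (n + N) x * (INF k\<in>{n + N..}. h k x)) \<in> borel_measurable M" for n
    by measurable
  show "AE x in M. (\<lambda>n. V (n + N) x * (INF k\<in>{n + N..}. h k x)) \<longlonglongrightarrow> W x * l x"
    using lim(1,2)
  proof eventually_elim
    case (elim x)
    note I = INF_tail_tendsto[OF elim(2)]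
    have "(\<lambda>n. V n x * (INF k\<in>{n..}. h k x)) \<longlonglongrightarrow> W x * l x"
    proof (cases "l x = 0")
      case True
      \<comment> \<open>The tail infimum never exceeds the limit, so all products are exactly 0 even
        where \<open>W x\<close> is infinite. The weights \<open>h n\<close> themselves could tend
        to 0 while their products with \<open>V n\<close> do not.\<close>
      then have "(INF k\<in>{n..}. h k x) = 0" for n using I(2)[of n] by simp
      then show ?thesis using True by simp
    next
      case False
      then show ?thesis using lim(3)[of x] by (intro ennreal_tendsto_mult elim(1) I(1)) auto
    qed
    then show ?case by (rule LIMSEQ_ignore_initial_segment)
  qed
  show "(\<integral>\<^sup>+x. V (n + N) x * (INF k\<in>{n + N..}. h k x) \<partial>M) \<le> b (n + N)" for n by (rule b(1)) simp
  show "(\<lambda>n. b (n + N)) \<longlonglongrightarrow> c" by (rule LIMSEQ_ignore_initial_segment[OF b(2)])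
qed

section \<open>Consequences of the hypotheses on \<Psi>: semicontinuity and convexity\<close>

locale convex_weight =
  fixes \<Psi> :: "ennreal \<Rightarrow> ennreal" and p :: real
  assumes decreasing: "strict_antimono_on UNIV \<Psi>" and p: "p > 1"
    and convex: "ennreal_convex_on {s. ennreal_powr s p \<in> range \<Psi>} (\<lambda>s. inv \<Psi> (ennreal_powr s p))"
begin

lemma strictly_decreasing: "a < b \<Longrightarrow> \<Psi> b < \<Psi> a"
  using decreasing by (auto simp: monotone_on_def)

lemma antimono_Psi: "a \<le> b \<Longrightarrow> \<Psi> b \<le> \<Psi> a"
  using strictly_decreasing[of a b] by (auto simp: order.order_iff_strict)

lemma less_if_Psi_less: "\<Psi> a < \<Psi> b \<Longrightarrow> b < a"
  using antimono_Psi[of a b] by (meson not_le)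

lemma inj_Psi: "inj \<Psi>"
proof (rule injI)
  fix a b assume "\<Psi> a = \<Psi> b"
  then show "a = b"
    using strictly_decreasing[of a b] strictly_decreasing[of b a] by (cases a b rule: linorder_cases) simp_all
qed

definition proot :: "ennreal \<Rightarrow> ennreal" where
  "proot c = ennreal_powr c (1 / p)"

lemma powr_proot: "ennreal_powr (proot c) p = c"
  using p by (cases c) (auto simp: proot_def ennreal_powr_def powr_powr)

lemma proot_mono: "c \<le> d \<Longrightarrow> proot c \<le> proot d"
  using p by (cases c; cases d) (auto simp: proot_def ennreal_powr_def top_unique intro!: ennreal_leI powr_mono2)

text \<open>The convexity hypothesis includes that the set of all \<open>s\<close> with
  \<open>s\<close> to the power \<open>p\<close> in the range of \<Psi> is an interval; the monotone
  \<open>p\<close>-th root transports this to the range itself. A decreasing function with this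
  property has no jumps.\<close>

lemma range_interval:
  assumes "a \<in> range \<Psi>" "b \<in> range \<Psi>" "a \<le> c" "c \<le> b" shows "c \<in> range \<Psi>"
proof -
  have "proot a \<in> {s. ennreal_powr s p \<in> range \<Psi>}" "proot b \<in> {s. ennreal_powr s p \<in> range \<Psi>}"
    using assms by (simp_all add: powr_proot)
  then have "{proot a..proot b} \<subseteq> {s. ennreal_powr s p \<in> range \<Psi>}"
    using convex unfolding ennreal_convex_on_def by blast
  moreover have "proot c \<in> {proot a..proot b}" using assms proot_mono by auto
  ultimately show ?thesis using powr_proot by auto
qed

text \<open>Since \<Psi> decreases, lower semicontinuity can fail at \<open>x\<close> only by a drop
  immediately to the right. An intermediate value \<open>c'\<close> has a preimage \<open>z\<close>
  beyond \<open>x\<close>, and the whole ray below \<open>z\<close> stays above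
  \<open>c\<close>.\<close>

lemma open_superlevel: "open {x. c < \<Psi> x}"
proof (subst open_subopen, rule ballI)
  fix x assume "x \<in> {x. c < \<Psi> x}"
  then have c: "c < \<Psi> x" by simp
  show "\<exists>T. open T \<and> x \<in> T \<and> T \<subseteq> {x. c < \<Psi> x}"
  proof (cases "x = top")
    case True
    then have "c < \<Psi> y" for y using c antimono_Psi[of y top] by auto
    then show ?thesis by (intro exI[of _ UNIV]) auto
  next
    case False
    then have "\<Psi> top < \<Psi> x" by (intro strictly_decreasing) (simp add: less_top)
    \<comment> \<open>The maximum with \<open>\<Psi> top\<close> places \<open>c'\<close> between
      two values of \<Psi>, as the interval property requires.\<close>
    with c obtain c' where c': "max c (\<Psi> top) < c'" "c' < \<Psi> x" using dense[of "max c (\<Psi> top)" "\<Psi> x"] by auto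
    then have "c' \<in> range \<Psi>" by (intro range_interval[OF rangeI[of _ top] rangeI[of _ x]]) auto
    then obtain z where z: "c' = \<Psi> z" by blast
    have "x < z" by (rule less_if_Psi_less) (use c'(2) z in simp)
    have "c < \<Psi> z" using c'(1) unfolding z by simp
    then have "c < \<Psi> y" if "y < z" for y using strictly_decreasing[OF that] by (rule less_trans)
    then have "{..<z} \<subseteq> {x. c < \<Psi> x}" by blast
    then show ?thesis using \<open>x < z\<close> by (intro exI[of _ "{..<z}"]) simp
  qed
qed

lemma Psi_measurable [measurable]: "\<Psi> \<in> borel_measurable borel"
  by (rule borel_measurableI_greater) (use open_superlevel in simp)

lemma Psi_lsc: assumes "x \<longlonglongrightarrow> l" shows "\<Psi> l \<le> liminf (\<lambda>n. \<Psi> (x n))"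
  unfolding le_Liminf_iff
proof (intro allI impI)
  fix c assume "c < \<Psi> l"
  then show "eventually (\<lambda>n. c < \<Psi> (x n)) sequentially"
    using topological_tendstoD[OF assms open_superlevel[of c]] by simp
qed

text \<open>If one argument is 0, the claim amounts to the bound of 2 to the power \<open>p\<close>
  below by 2; positive arguments use convexity of the power function.\<close>

lemma powr_midpoint:
  fixes a b :: real
  assumes "a \<ge> 0" "b \<ge> 0"
  shows "((a + b) / 2) powr p \<le> (a powr p + b powr p) / 2"
proof (cases "a = 0 \<or> b = 0")
  case True
  have "(c / 2) powr p \<le> c powr p / 2" if "c \<ge> 0" for c :: real
  proof -
    have "(c / 2) powr p = c powr p / 2 powr p" using that by (simp add: powr_divide)
    also have "\<dots> \<le> c powr p / 2 powr 1" using p powr_mono[of 1 p 2] by (intro divide_left_mono) auto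
    finally show ?thesis by simp
  qed
  with True assms show ?thesis by auto
next
  case False
  then have "a > 0" "b > 0" using assms by auto
  then show ?thesis
    using convex_onD[OF powr_convex[of p], of "1/2" a b] p by (simp add: field_simps)
qed

text \<open>Let \<sigma> and \<tau> be the \<open>p\<close>-th roots of \<open>\<Psi> a\<close> and
  \<open>\<Psi> b\<close>, so that \<open>a\<close> and \<open>b\<close> are the values of the
  convex function at them. Convexity places the value at the midpoint below
  \<open>(a + b) / 2\<close>; applying the decreasing \<Psi> bounds
  \<open>\<Psi> ((a + b) / 2)\<close> by the \<open>p\<close>-th power of
  \<open>(\<sigma> + \<tau>) / 2\<close>, and convexity of the power finishes.\<close>

lemma Psi_midpoint: "\<Psi> ((a + b) / 2) \<le> (\<Psi> a + \<Psi> b) / 2"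
proof (cases "\<Psi> a = top \<or> \<Psi> b = top")
  case True
  then show ?thesis by (auto simp: ennreal_top_divide)
next
  case False
  obtain \<alpha> where "\<Psi> a = ennreal \<alpha>" "\<alpha> \<ge> 0" using False by (cases "\<Psi> a") auto
  moreover obtain \<beta> where "\<Psi> b = ennreal \<beta>" "\<beta> \<ge> 0" using False by (cases "\<Psi> b") auto
  ultimately have ab: "\<Psi> a = ennreal \<alpha>" "\<alpha> \<ge> 0" "\<Psi> b = ennreal \<beta>" "\<beta> \<ge> 0" by simp_all
  define \<sigma> \<tau> where "\<sigma> = \<alpha> powr (1 / p)" and "\<tau> = \<beta> powr (1 / p)"
  have st: "ennreal_powr (ennreal \<sigma>) p = \<Psi> a" "ennreal_powr (ennreal \<tau>) p = \<Psi> b" "\<sigma> \<ge> 0" "\<tau> \<ge> 0"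
    "\<sigma> powr p = \<alpha>" "\<tau> powr p = \<beta>"
    using p ab by (auto simp: ennreal_powr_def \<sigma>_def \<tau>_def powr_powr)
  let ?I = "{s. ennreal_powr s p \<in> range \<Psi>}" and ?F = "\<lambda>s. inv \<Psi> (ennreal_powr s p)"
  define m where "m = ennreal ((\<sigma> + \<tau>) / 2)"
  have I: "ennreal \<sigma> \<in> ?I" "ennreal \<tau> \<in> ?I" using st by simp_all
  have "m \<in> {ennreal \<sigma>..ennreal \<tau>} \<union> {ennreal \<tau>..ennreal \<sigma>}"
    using st by (cases "\<sigma> \<le> \<tau>") (auto simp: m_def intro!: ennreal_leI)
  \<comment> \<open>The interval property puts the midpoint into the domain, so that
    \<open>inv\<close> really inverts \<Psi> at its \<open>p\<close>-th power.\<close>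
  then have mI: "m \<in> ?I" using I convex unfolding ennreal_convex_on_def by blast
  have "ennreal (1 - 1/2) * ennreal \<sigma> + ennreal (1/2) * ennreal \<tau> = m"
  proof -
    have lin: "ennreal c * ennreal \<sigma> + ennreal d * ennreal \<tau> = ennreal (c * \<sigma> + d * \<tau>)" if "c \<ge> 0" "d \<ge> 0" for c d
      using that st by (simp add: ennreal_mult)
    show ?thesis by (subst lin) (auto simp: m_def add_divide_distrib)
  qed
  then have "?F m \<le> ennreal (1 - 1/2) * ?F (ennreal \<sigma>) + ennreal (1/2) * ?F (ennreal \<tau>)"
  proof -
    have conv: "\<forall>s\<in>?I. \<forall>t\<in>?I. \<forall>\<theta>::real. 0 < \<theta> \<and> \<theta> < 1 \<longrightarrow>
        ?F (ennreal (1 - \<theta>) * s + ennreal \<theta> * t) \<le> ennreal (1 - \<theta>) * ?F s + ennreal \<theta> * ?F t"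
      using convex unfolding ennreal_convex_on_def by (rule conjunct2)
    have "?F (ennreal (1 - 1/2) * ennreal \<sigma> + ennreal (1/2) * ennreal \<tau>)
        \<le> ennreal (1 - 1/2) * ?F (ennreal \<sigma>) + ennreal (1/2) * ?F (ennreal \<tau>)"
      by (rule conv[rule_format, OF I]) simp
    then show ?thesis by (simp only: \<open>ennreal (1 - 1/2) * ennreal \<sigma> + ennreal (1/2) * ennreal \<tau> = m\<close>)
  qed
  also have "\<dots> = ennreal (1/2) * a + ennreal (1/2) * b" using st inj_Psi by simp
  also have "\<dots> = (a + b) / 2" by (simp add: divide_ennreal_def distrib_right mult.commute)
  finally have "\<Psi> ((a + b) / 2) \<le> \<Psi> (?F m)" by (rule antimono_Psi)
  also have "\<Psi> (?F m) = ennreal_powr m p" using mI by (intro f_inv_into_f) simp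
  also have "\<dots> = ennreal (((\<sigma> + \<tau>) / 2) powr p)" using st by (simp add: m_def ennreal_powr_def)
  also have "\<dots> \<le> ennreal ((\<alpha> + \<beta>) / 2)" using powr_midpoint[OF st(3,4)] st by (intro ennreal_leI) simp
  also have "\<dots> = (\<Psi> a + \<Psi> b) / 2" using ab by (simp add: ennreal_divide_numeral flip: ennreal_plus)
  finally show ?thesis .
qed

end

section \<open>Stability of the state inequality\<close>

text \<open>Dyadic convex combinations, generated by midpoints because
  \<open>convex_compactness\<close> asks for nothing else. Field and potential are averaged as a
  pair, hence with the same coefficients; inequalities that couple them depend on this.\<close>

inductive_set midpoint_hull :: "(('a \<Rightarrow> 'b::real_vector) \<times> ('a \<Rightarrow> ennreal)) set \<Rightarrow> (('a \<Rightarrow> 'b) \<times> ('a \<Rightarrow> ennreal)) set"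
  for X where
  base: "c \<in> X \<Longrightarrow> c \<in> midpoint_hull X"
| midpoint: "(y, V) \<in> midpoint_hull X \<Longrightarrow> (z, W) \<in> midpoint_hull X \<Longrightarrow>
    (\<lambda>x. (1/2) *\<^sub>R (y x + z x), \<lambda>x. (V x + W x) / 2) \<in> midpoint_hull X"

lemma midpoint_hull_mono: "X \<subseteq> Y \<Longrightarrow> midpoint_hull X \<subseteq> midpoint_hull Y"
proof
  fix c assume "X \<subseteq> Y" "c \<in> midpoint_hull X"
  from this(2,1) show "c \<in> midpoint_hull Y"
    by (induction rule: midpoint_hull.induct) (auto intro: midpoint_hull.intros)
qed

lemma midpoint_hull_induct [consumes 1, case_names base midpoint]:
  assumes "(y, V) \<in> midpoint_hull X"
    and "\<And>y V. (y, V) \<in> X \<Longrightarrow> P y V"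
    and "\<And>y V z W. P y V \<Longrightarrow> P z W \<Longrightarrow> P (\<lambda>x. (1/2) *\<^sub>R (y x + z x)) (\<lambda>x. (V x + W x) / 2)"
  shows "P y V"
proof -
  have "case_prod P c" if "c \<in> midpoint_hull X" for c
    using that by (induction rule: midpoint_hull.induct) (use assms(2,3) in auto)
  from this[OF assms(1)] show ?thesis by simp
qed

context convex_weight
begin

lemma midpoint_hull_admissible:
  assumes "(y, V) \<in> midpoint_hull X"
    and X: "\<And>y V. (y, V) \<in> X \<Longrightarrow> V \<in> borel_measurable M \<and> (\<integral>\<^sup>+x. \<Psi> (V x) \<partial>M) \<le> 1"
  shows "V \<in> borel_measurable M \<and> (\<integral>\<^sup>+x. \<Psi> (V x) \<partial>M) \<le> 1"
  using assms(1)
proof (induction rule: midpoint_hull_induct)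
  case (midpoint y V z W)
  then have [measurable]: "V \<in> borel_measurable M" "W \<in> borel_measurable M" by simp_all
  have "(\<integral>\<^sup>+x. \<Psi> ((V x + W x) / 2) \<partial>M) \<le> (\<integral>\<^sup>+x. (\<Psi> (V x) + \<Psi> (W x)) / 2 \<partial>M)"
    by (intro nn_integral_mono Psi_midpoint)
  also have "\<dots> = ((\<integral>\<^sup>+x. \<Psi> (V x) \<partial>M) + (\<integral>\<^sup>+x. \<Psi> (W x) \<partial>M)) / 2"
    by (simp add: nn_integral_divide nn_integral_add)
  also have "\<dots> \<le> (1 + 1) / 2"
    using midpoint by (intro divide_right_mono_ennreal add_mono) auto
  finally show ?case by simp
qed (rule X)

end

context bounded_open
begin

lemma sobolev0_midpoint:
  "sobolev0 D u G \<Longrightarrow> sobolev0 D v H \<Longrightarrow> sobolev0 D (\<lambda>x. (1/2) * (u x + v x)) (\<lambda>x. (1/2) *\<^sub>R (G x + H x))"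
  using sobolev0_lincomb[of u G v H "1/2" "1/2"] by (simp add: algebra_simps add_divide_distrib)

text \<open>The hull records gradients but not the functions; the functions are averaged along with
  them and remain in a ball around \<open>u0\<close> by the triangle inequality.\<close>

lemma midpoint_hull_sobolev0:
  assumes "(H, W) \<in> midpoint_hull X" and L: "L2_on D u0"
    and X: "\<And>H W. (H, W) \<in> X \<Longrightarrow> \<exists>z. sobolev0 D z H \<and> l2 D (\<lambda>x. z x - u0 x) \<le> e"
  shows "\<exists>z. sobolev0 D z H \<and> l2 D (\<lambda>x. z x - u0 x) \<le> e"
  using assms(1)
proof (induction rule: midpoint_hull_induct)
  case (midpoint G V H W)
  then obtain y z where yz: "sobolev0 D y G" "l2 D (\<lambda>x. y x - u0 x) \<le> e" "sobolev0 D z H" "l2 D (\<lambda>x. z x - u0 x) \<le> e" by blast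
  have "(\<lambda>x. (1/2) * (y x + z x) - u0 x) = (\<lambda>x. (1/2) *\<^sub>R ((y x - u0 x) + (z x - u0 x)))"
    by (simp add: fun_eq_iff algebra_simps)
  then have "l2 D (\<lambda>x. (1/2) * (y x + z x) - u0 x) = (1/2) * l2 D (\<lambda>x. (y x - u0 x) + (z x - u0 x))"
    by (simp only: l2_scaleR)
  also have "\<dots> \<le> (1/2) * (l2 D (\<lambda>x. y x - u0 x) + l2 D (\<lambda>x. z x - u0 x))"
    by (intro mult_left_mono l2_triangle L2_on_diff sobolev0_L2[OF yz(1)] sobolev0_L2[OF yz(3)] L) simp
  also have "\<dots> \<le> e" using yz by simp
  finally show ?case using sobolev0_midpoint[OF yz(1,3)] by blast
qed (rule X)

text \<open>For fixed \<open>a\<close> and \<open>h\<close> both sides are affine in the pair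
  \<open>(H, W)\<close>, so averaging preserves the inequality. Nonnegativity of the real right-hand
  side is carried along because \<open>ennreal\<close> would truncate a negative value to 0.\<close>

lemma midpoint_hull_inequality:
  assumes "(H, W) \<in> midpoint_hull X" and a: "L2_on D a" and [measurable]: "h \<in> borel_measurable (lebesgue_on D)"
    and X: "\<And>H W. (H, W) \<in> X \<Longrightarrow> L2_on D H \<and> W \<in> borel_measurable (lebesgue_on D) \<and>
      0 \<le> (\<integral>x. a x \<bullet> H x \<partial>lebesgue_on D) + c \<and>
      (\<integral>\<^sup>+x. W x * h x \<partial>lebesgue_on D) \<le> ennreal ((\<integral>x. a x \<bullet> H x \<partial>lebesgue_on D) + c)"
  shows "L2_on D H \<and> W \<in> borel_measurable (lebesgue_on D) \<and>
      0 \<le> (\<integral>x. a x \<bullet> H x \<partial>lebesgue_on D) + c \<and>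
      (\<integral>\<^sup>+x. W x * h x \<partial>lebesgue_on D) \<le> ennreal ((\<integral>x. a x \<bullet> H x \<partial>lebesgue_on D) + c)"
  using assms(1)
proof (induction rule: midpoint_hull_induct)
  case (midpoint G V H W)
  then have [measurable]: "V \<in> borel_measurable (lebesgue_on D)" "W \<in> borel_measurable (lebesgue_on D)"
    and L: "L2_on D G" "L2_on D H" by simp_all
  let ?L = "\<lambda>H. (\<integral>x. a x \<bullet> H x \<partial>lebesgue_on D) + c"
  have lin: "?L (\<lambda>x. (1/2) *\<^sub>R (G x + H x)) = (?L G + ?L H) / 2"
    using L2_on_inner_integrable[OF a L(1)] L2_on_inner_integrable[OF a L(2)]
    by (simp add: inner_add_right add_divide_distrib)
  have "(\<integral>\<^sup>+x. (V x + W x) / 2 * h x \<partial>lebesgue_on D) = (\<integral>\<^sup>+x. (V x * h x + W x * h x) / 2 \<partial>lebesgue_on D)"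
    by (intro nn_integral_cong) (simp add: divide_ennreal_def algebra_simps)
  also have "\<dots> = ((\<integral>\<^sup>+x. V x * h x \<partial>lebesgue_on D) + (\<integral>\<^sup>+x. W x * h x \<partial>lebesgue_on D)) / 2"
    by (simp add: nn_integral_divide nn_integral_add)
  also have "\<dots> \<le> (ennreal (?L G) + ennreal (?L H)) / 2"
    using midpoint by (intro divide_right_mono_ennreal add_mono) auto
  also have "\<dots> = ennreal ((?L G + ?L H) / 2)"
    using midpoint by (simp add: ennreal_divide_numeral flip: ennreal_plus)
  finally have "(\<integral>\<^sup>+x. (V x + W x) / 2 * h x \<partial>lebesgue_on D) \<le> ennreal (?L (\<lambda>x. (1/2) *\<^sub>R (G x + H x)))"
    unfolding lin .
  moreover have "0 \<le> ?L (\<lambda>x. (1/2) *\<^sub>R (G x + H x))" unfolding lin using midpoint by simp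
  moreover have "L2_on D (\<lambda>x. (1/2) *\<^sub>R (G x + H x))" by (intro L2_on_scaleR L2_on_add L)
  ultimately show ?case by simp
qed (rule X)

text \<open>The given inequalities have coefficients depending on \<open>k\<close> and cannot be
  averaged directly. For \<open>k \<ge> n\<close> the weight \<open>h k\<close> is lowered to the
  tail infimum \<open>t n\<close>, and \<open>R k\<close> is replaced by one affine functional up to
  an error \<open>e\<close>. The inequality is then common to all generators, passes to the hull,
  and to the limit by \<open>nn_integral_mult_lsc\<close>; at the end \<open>e\<close> tends to
  0.\<close>

lemma midpoint_hull_limit_inequality:
  fixes G H :: "nat \<Rightarrow> real^'n \<Rightarrow> 'b::euclidean_space" and V W :: "nat \<Rightarrow> real^'n \<Rightarrow> ennreal"
  assumes hull: "\<And>n. (H n, W n) \<in> midpoint_hull {(G k, V k) | k. n \<le> k}"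
    and G: "\<And>k. L2_on D (G k)" and V: "\<And>k. V k \<in> borel_measurable (lebesgue_on D)"
    and H0: "L2_on D H0" "(\<lambda>n. l2 D (\<lambda>x. H n x - H0 x)) \<longlonglongrightarrow> 0"
    and W0: "AE x in lebesgue_on D. (\<lambda>n. W n x) \<longlonglongrightarrow> W0 x"
    and h: "\<And>k. h k \<in> borel_measurable (lebesgue_on D)" "AE x in lebesgue_on D. (\<lambda>k. h k x) \<longlonglongrightarrow> h0 x" "\<And>x. h0 x < top"
    and a: "L2_on D a"
    and base: "\<And>k. 0 \<le> R k \<and> (\<integral>\<^sup>+x. V k x * h k x \<partial>lebesgue_on D) \<le> ennreal (R k)"
    and err: "(\<lambda>k. R k - ((\<integral>x. a x \<bullet> G k x \<partial>lebesgue_on D) + c)) \<longlonglongrightarrow> 0"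
  shows "0 \<le> (\<integral>x. a x \<bullet> H0 x \<partial>lebesgue_on D) + c"
    and "(\<integral>\<^sup>+x. W0 x * h0 x \<partial>lebesgue_on D) \<le> ennreal ((\<integral>x. a x \<bullet> H0 x \<partial>lebesgue_on D) + c)"
proof -
  let ?L = "\<lambda>H. (\<integral>x. a x \<bullet> H x \<partial>lebesgue_on D) + c"
  define t where "t n x = (INF k\<in>{n..}. h k x)" for n x
  have t_meas: "t n \<in> borel_measurable (lebesgue_on D)" for n
    unfolding t_def[abs_def] by (intro borel_measurable_INF h(1)) auto
  have meas: "L2_on D (H n) \<and> W n \<in> borel_measurable (lebesgue_on D)" for n
    using hull[of n] by (induction rule: midpoint_hull_induct) (auto intro!: L2_on_scaleR L2_on_add G V)
  have L_lim: "(\<lambda>n. ?L (H n)) \<longlonglongrightarrow> ?L H0"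
  proof -
    have comm: "(\<integral>x. y x \<bullet> a x \<partial>lebesgue_on D) = (\<integral>x. a x \<bullet> y x \<partial>lebesgue_on D)" for y
      by (intro Bochner_Integration.integral_cong refl inner_commute)
    show ?thesis
      using tendsto_inner_L2_left[OF conjunct1[OF meas] H0 a] unfolding comm by (intro tendsto_add tendsto_const)
  qed
  have step: "0 \<le> ?L H0 + e \<and> (\<integral>\<^sup>+x. W0 x * h0 x \<partial>lebesgue_on D) \<le> ennreal (?L H0 + e)" if "e > 0" for e
  proof -
    obtain N where N: "\<And>k. k \<ge> N \<Longrightarrow> \<bar>R k - ?L (G k)\<bar> < e"
      using LIMSEQ_D[OF err \<open>e > 0\<close>] by auto
    have n: "0 \<le> ?L (H n) + e \<and> (\<integral>\<^sup>+x. W n x * t n x \<partial>lebesgue_on D) \<le> ennreal (?L (H n) + e)" if "n \<ge> N" for n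
    proof -
      have X: "L2_on D G' \<and> V' \<in> borel_measurable (lebesgue_on D) \<and> 0 \<le> (\<integral>x. a x \<bullet> G' x \<partial>lebesgue_on D) + (c + e) \<and>
          (\<integral>\<^sup>+x. V' x * t n x \<partial>lebesgue_on D) \<le> ennreal ((\<integral>x. a x \<bullet> G' x \<partial>lebesgue_on D) + (c + e))"
        if X: "(G', V') \<in> {(G k, V k) | k. n \<le> k}" for G' V'
      proof -
        obtain k where k: "n \<le> k" "G' = G k" "V' = V k" using X by auto
        have le: "R k \<le> (\<integral>x. a x \<bullet> G k x \<partial>lebesgue_on D) + (c + e)" using N[of k] k \<open>n \<ge> N\<close> by simp
        have "(\<integral>\<^sup>+x. V k x * t n x \<partial>lebesgue_on D) \<le> (\<integral>\<^sup>+x. V k x * h k x \<partial>lebesgue_on D)"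
          unfolding t_def using k(1) by (intro nn_integral_mono mult_left_mono INF_lower) auto
        also have "\<dots> \<le> ennreal (R k)" using base by blast
        also have "\<dots> \<le> ennreal ((\<integral>x. a x \<bullet> G k x \<partial>lebesgue_on D) + (c + e))" by (rule ennreal_leI[OF le])
        finally show ?thesis using le base[of k] G V k by simp
      qed
      show ?thesis using midpoint_hull_inequality[OF hull[of n] a t_meas X] by (simp add: add.assoc)
    qed
    have lim: "(\<lambda>n. ?L (H n) + e) \<longlonglongrightarrow> ?L H0 + e" by (intro tendsto_add L_lim tendsto_const)
    have "0 \<le> ?L H0 + e" by (rule LIMSEQ_le_const[OF lim]) (use n in blast)
    moreover have "(\<integral>\<^sup>+x. W0 x * h0 x \<partial>lebesgue_on D) \<le> ennreal (?L H0 + e)"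
    proof (rule nn_integral_mult_lsc[where V = W and h = h and N = N, OF conjunct2[OF meas] h(1) W0 h(2,3)])
      show "(\<integral>\<^sup>+x. W n x * (INF k\<in>{n..}. h k x) \<partial>lebesgue_on D) \<le> ennreal (?L (H n) + e)" if "n \<ge> N" for n
        using n[OF that] unfolding t_def by blast
      show "(\<lambda>n. ennreal (?L (H n) + e)) \<longlonglongrightarrow> ennreal (?L H0 + e)" by (rule tendsto_ennrealI[OF lim])
    qed
    ultimately show ?thesis by blast
  qed
  show pos: "0 \<le> ?L H0" by (rule field_le_epsilon) (use step in blast)
  show "(\<integral>\<^sup>+x. W0 x * h0 x \<partial>lebesgue_on D) \<le> ennreal (?L H0)"
  proof (rule ennreal_le_epsilon)
    fix e :: real assume "e > 0"
    then show "(\<integral>\<^sup>+x. W0 x * h0 x \<partial>lebesgue_on D) \<le> ennreal (?L H0) + ennreal e"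
      using step[of e] pos by (simp flip: ennreal_plus)
  qed
qed

section \<open>Testing with negative ramps, uniform bounds and comparison\<close>

lemma negative_ramp_scaleR_tendsto:
  assumes [measurable]: "u \<in> borel_measurable (lebesgue_on D)" and F: "L2_on D F"
  defines "\<kappa> \<equiv> (\<lambda>x. if u x < 0 then 1 else 0 :: real)"
  shows "\<And>n. L2_on D (\<lambda>x. negative_ramp (real (Suc n)) (u x) *\<^sub>R F x)" and "L2_on D (\<lambda>x. \<kappa> x *\<^sub>R F x)"
    and "(\<lambda>n. l2 D (\<lambda>x. negative_ramp (real (Suc n)) (u x) *\<^sub>R F x - \<kappa> x *\<^sub>R F x)) \<longlonglongrightarrow> 0"
proof -
  let ?m = "\<lambda>n. real (Suc n)"
  have pos: "?m n > 0" for n by simp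
  note [measurable] = C1_Lipschitz_measurable(1)[OF negative_ramp_C1[OF pos]] L2_on_measurable[OF F]
  have [measurable]: "\<kappa> \<in> borel_measurable (lebesgue_on D)" unfolding \<kappa>_def by measurable
  have b1: "\<bar>negative_ramp (?m n) t\<bar> \<le> 1" for n t using negative_ramp_bounds(1,2)[OF pos[of n], of t] by simp
  have b2: "\<bar>\<kappa> x\<bar> \<le> 1" for x by (simp add: \<kappa>_def)
  show L1: "L2_on D (\<lambda>x. negative_ramp (?m n) (u x) *\<^sub>R F x)" for n
    by (rule L2_on_mult_bounded[OF F _ b1]) measurable
  show L2: "L2_on D (\<lambda>x. \<kappa> x *\<^sub>R F x)"
    by (rule L2_on_mult_bounded[OF F _ b2]) measurable
  show "(\<lambda>n. l2 D (\<lambda>x. negative_ramp (?m n) (u x) *\<^sub>R F x - \<kappa> x *\<^sub>R F x)) \<longlonglongrightarrow> 0"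
  proof (rule l2_tendsto_dominated[OF F L2_on_measurable[OF L2_on_diff[OF L1 L2]]])
    have "\<bar>negative_ramp (?m n) (u x) - \<kappa> x\<bar> \<le> 1" for n x
      using negative_ramp_bounds(1,2,3)[OF pos[of n], of "u x"] by (auto simp: \<kappa>_def)
    then have "norm (negative_ramp (?m n) (u x) *\<^sub>R F x - \<kappa> x *\<^sub>R F x) \<le> 1 * norm (F x)" for n x
      unfolding scaleR_diff_left[symmetric] norm_scaleR by (intro mult_right_mono) auto
    then show "AE x in lebesgue_on D. norm (negative_ramp (?m n) (u x) *\<^sub>R F x - \<kappa> x *\<^sub>R F x) \<le> norm (F x)" for n
      by (intro AE_I2) simp
    show "AE x in lebesgue_on D. (\<lambda>n. negative_ramp (?m n) (u x) *\<^sub>R F x - \<kappa> x *\<^sub>R F x) \<longlonglongrightarrow> 0"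
      unfolding \<kappa>_def by (intro AE_I2 LIM_zero tendsto_scaleR negative_ramp_tendsto tendsto_const)
  qed
qed

text \<open>The limit of the chain rule for \<open>negative_ramp_primitive\<close>, a C1
  approximation of the negative part. The factors \<open>negative_ramp\<close> tend to the indicator
  of \<open>u < 0\<close> everywhere, including 0 at \<open>u = 0\<close>, so dominated convergence
  suffices for the gradients.\<close>

lemma sobolev0_negative_part:
  assumes s: "sobolev0 D u G"
  shows "sobolev0 D (\<lambda>x. min (u x) 0) (\<lambda>x. (if u x < 0 then 1 else 0) *\<^sub>R G x)"
proof -
  note [measurable] = sobolev0_measurable[OF s] and L = sobolev0_L2[OF s]
  let ?m = "\<lambda>n. real (Suc n)"
  have pos: "?m n > 0" for n by simp
  note C1 = negative_ramp_C1[OF pos] negative_ramp_primitive_C1[OF pos]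
  note [measurable] = C1_Lipschitz_measurable(1)[OF C1(1)] C1_Lipschitz_measurable(1)[OF C1(2)]
  have zero: "negative_ramp_primitive m 0 = 0" for m by (simp add: negative_ramp_primitive_def)
  have lip: "\<bar>negative_ramp_primitive (?m n) t\<bar> \<le> \<bar>t\<bar>" for n t
    using C1_Lipschitz_diff_le[OF C1(2), of n t 0] by (simp add: zero)
  show ?thesis
  proof (rule sobolev0_closed[OF sobolev0_compose[OF C1(2) zero s]])
    show "L2_on D (\<lambda>x. min (u x) 0)"
      by (rule L2_on_bound[OF L(1), of _ 1]) auto
    show "(\<lambda>n. l2 D (\<lambda>x. negative_ramp_primitive (?m n) (u x) - min (u x) 0)) \<longlonglongrightarrow> 0"
    proof (rule l2_tendsto_dominated[OF L2_on_scaleR[OF L(1), of 2]])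
      show "(\<lambda>x. negative_ramp_primitive (?m n) (u x) - min (u x) 0) \<in> borel_measurable (lebesgue_on D)" for n
        by measurable
      have "norm (negative_ramp_primitive (?m n) t - min t 0) \<le> norm (2 *\<^sub>R t)" for n t
        using lip[of n t] by (auto simp: min_def)
      then show "AE x in lebesgue_on D. norm (negative_ramp_primitive (?m n) (u x) - min (u x) 0) \<le> norm (2 *\<^sub>R u x)" for n
        by (intro AE_I2)
      show "AE x in lebesgue_on D. (\<lambda>n. negative_ramp_primitive (?m n) (u x) - min (u x) 0) \<longlonglongrightarrow> 0"
        by (intro AE_I2 LIM_zero negative_ramp_primitive_tendsto)
    qed
  qed (rule negative_ramp_scaleR_tendsto[OF sobolev0_measurable(1)[OF s] L(2)])+
qed

text \<open>Testing the state equation with \<open>\<phi> negative_ramp m u\<close>: the term containing the derivative of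
  \<open>negative_ramp m\<close> has a sign and is dropped.\<close>

lemma negative_ramp_inequality:
  assumes V: "V \<in> borel_measurable (lebesgue_on D)" and f: "L2_on D f"
    and u: "sobolev0 D u G" "u \<in> energy_space D V"
    and eq: "\<And>\<phi> \<Phi>. sobolev0 D \<phi> \<Phi> \<Longrightarrow> \<phi> \<in> energy_space D V \<Longrightarrow>
      (\<integral>x. G x \<bullet> \<Phi> x \<partial>lebesgue_on D) + (\<integral>x. enn2real (V x) * u x * \<phi> x \<partial>lebesgue_on D)
        = (\<integral>x. f x * \<phi> x \<partial>lebesgue_on D)"
    and \<phi>: "sobolev0 D \<phi> \<Phi>" "\<And>x. 0 \<le> \<phi> x" "\<And>x. \<phi> x \<le> 1" and m: "m > 0"
  defines "R \<equiv> (\<integral>x. (negative_ramp m (u x) *\<^sub>R \<Phi> x) \<bullet> G x \<partial>lebesgue_on D) - (\<integral>x. f x * (\<phi> x * negative_ramp m (u x)) \<partial>lebesgue_on D)"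
  shows "0 \<le> R \<and> (\<integral>\<^sup>+x. V x * ennreal (max (- u x) 0 * \<phi> x * negative_ramp m (u x)) \<partial>lebesgue_on D) \<le> ennreal R"
proof -
  let ?\<theta> = "\<lambda>x. negative_ramp m (u x)" and ?\<theta>' = "\<lambda>x. negative_ramp' m (u x)"
  define \<psi> where "\<psi> x = \<phi> x * ?\<theta> x" for x
  note C1 = negative_ramp_C1[OF m] and nr = negative_ramp_bounds[OF m]
  note [measurable] = sobolev0_measurable[OF u(1)] sobolev0_measurable[OF \<phi>(1)] C1_Lipschitz_measurable[OF C1]
  have b\<theta>: "\<bar>negative_ramp m t\<bar> \<le> 1" for t using nr(1,2)[of t] by simp
  have b\<phi>: "\<bar>\<phi> x\<bar> \<le> 1" for x using \<phi>(2,3)[of x] by simp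
  have s\<psi>: "sobolev0 D \<psi> (\<lambda>x. ?\<theta> x *\<^sub>R \<Phi> x + (\<phi> x * ?\<theta>' x) *\<^sub>R G x)"
    unfolding \<psi>_def[abs_def] by (rule sobolev0_mult_compose[OF C1 b\<theta> \<phi>(1) b\<phi> u(1)])
  \<comment> \<open>Domination by a multiple of the state makes \<psi> an admissible test function,
    whatever infinite values \<open>V\<close> takes.\<close>
  have "\<bar>\<psi> x\<bar> \<le> m * \<bar>u x\<bar>" for x
    using mult_mono[OF b\<phi>[of x] nr(5)[of "u x"]] by (simp add: \<psi>_def abs_mult)
  then have E\<psi>: "\<psi> \<in> energy_space D V"
    by (intro energy_space_dominated[OF V s\<psi> u(2), of m] AE_I2)
  have L1: "L2_on D (\<lambda>x. ?\<theta> x *\<^sub>R \<Phi> x)"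
    by (rule L2_on_mult_bounded[OF sobolev0_L2(2)[OF \<phi>(1)] _ b\<theta>]) measurable
  have b': "\<bar>\<phi> x * ?\<theta>' x\<bar> \<le> m" for x
    using mult_mono[OF b\<phi>[of x], of "\<bar>?\<theta>' x\<bar>" m] C1 m by (simp add: abs_mult C1_Lipschitz_def)
  have L2: "L2_on D (\<lambda>x. (\<phi> x * ?\<theta>' x) *\<^sub>R G x)"
    by (rule L2_on_mult_bounded[OF sobolev0_L2(2)[OF u(1)] _ b']) measurable
  note LG = sobolev0_L2(2)[OF u(1)]
  have "(\<integral>x. G x \<bullet> (?\<theta> x *\<^sub>R \<Phi> x + (\<phi> x * ?\<theta>' x) *\<^sub>R G x) \<partial>lebesgue_on D)
      = (\<integral>x. G x \<bullet> (?\<theta> x *\<^sub>R \<Phi> x) \<partial>lebesgue_on D) + (\<integral>x. G x \<bullet> ((\<phi> x * ?\<theta>' x) *\<^sub>R G x) \<partial>lebesgue_on D)"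
    using L2_on_inner_integrable[OF LG L1] L2_on_inner_integrable[OF LG L2]
    unfolding inner_add_right by (rule Bochner_Integration.integral_add)
  moreover have "(\<integral>x. G x \<bullet> ((\<phi> x * ?\<theta>' x) *\<^sub>R G x) \<partial>lebesgue_on D) \<le> 0"
  proof -
    have "G x \<bullet> ((\<phi> x * ?\<theta>' x) *\<^sub>R G x) \<le> 0" for x
      using \<phi>(2)[of x] nr(4)[of "u x"] by (simp add: mult_nonneg_nonpos mult_nonpos_nonneg)
    then have "0 \<le> (\<integral>x. - (G x \<bullet> ((\<phi> x * ?\<theta>' x) *\<^sub>R G x)) \<partial>lebesgue_on D)"
      by (intro Bochner_Integration.integral_nonneg) simp
    then show ?thesis by simp
  qed
  ultimately have le: "- (\<integral>x. enn2real (V x) * u x * \<psi> x \<partial>lebesgue_on D) \<le> R"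
    using eq[OF s\<psi> E\<psi>] unfolding R_def \<psi>_def by (simp add: inner_commute)
  have Eu: "(\<lambda>x. - u x) \<in> energy_space D V"
    using energy_space_lincomb[OF V u(2) u(2), of "-1" 0] by simp
  \<comment> \<open>The ramp vanishes where \<open>u\<close> is nonnegative, so only the negative
    part of the state survives and the potential integrand has a sign.\<close>
  have hx: "(- u x) * \<psi> x = max (- u x) 0 * \<phi> x * ?\<theta> x" for x
    using nr(3)[of "u x"] by (auto simp: \<psi>_def max_def)
  have hpos: "0 \<le> (- u x) * \<psi> x" for x
    unfolding hx using \<phi>(2)[of x] nr(1)[of "u x"] by simp
  have form: "(\<integral>\<^sup>+x. V x * ennreal ((- u x) * \<psi> x) \<partial>lebesgue_on D) = ennreal (\<integral>x. enn2real (V x) * (- u x) * \<psi> x \<partial>lebesgue_on D)"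
    by (rule potential_form(3)[OF V Eu E\<psi>]) (use hpos in auto)
  have eq': "(\<integral>x. enn2real (V x) * (- u x) * \<psi> x \<partial>lebesgue_on D) = - (\<integral>x. enn2real (V x) * u x * \<psi> x \<partial>lebesgue_on D)"
    by simp
  have "0 \<le> (\<integral>x. enn2real (V x) * (- u x) * \<psi> x \<partial>lebesgue_on D)"
  proof (rule Bochner_Integration.integral_nonneg)
    show "0 \<le> enn2real (V x) * (- u x) * \<psi> x" for x
      using mult_nonneg_nonneg[OF enn2real_nonneg hpos[of x], of "V x"] by (simp only: mult.assoc)
  qed
  then have "0 \<le> R" using le eq' by linarith
  moreover have "(\<integral>\<^sup>+x. V x * ennreal (max (- u x) 0 * \<phi> x * ?\<theta> x) \<partial>lebesgue_on D) \<le> ennreal R"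
    using form le unfolding eq' hx by (simp add: ennreal_leI)
  ultimately show ?thesis by blast
qed

lemma sobolev0_closed_approx:
  assumes L: "L2_on D v" "L2_on D H"
    and approx: "\<And>e. e > 0 \<Longrightarrow> \<exists>z G. sobolev0 D z G \<and> l2 D (\<lambda>x. z x - v x) \<le> e \<and> l2 D (\<lambda>x. G x - H x) \<le> e"
  shows "sobolev0 D v H"
proof -
  define e where "e n = inverse (real (Suc n))" for n
  have e: "e \<longlonglongrightarrow> 0" "e n > 0" for n unfolding e_def by (rule LIMSEQ_inverse_real_of_nat) simp
  have "\<forall>n. \<exists>z G. sobolev0 D z G \<and> l2 D (\<lambda>x. z x - v x) \<le> e n \<and> l2 D (\<lambda>x. G x - H x) \<le> e n"
    using approx e(2) by blast
  then obtain z G where zG: "\<And>n. sobolev0 D (z n) (G n)" "\<And>n. l2 D (\<lambda>x. z n x - v x) \<le> e n"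
    "\<And>n. l2 D (\<lambda>x. G n x - H x) \<le> e n" by metis
  show ?thesis
  proof (rule sobolev0_closed[OF zG(1) L])
    show "(\<lambda>n. l2 D (\<lambda>x. z n x - v x)) \<longlonglongrightarrow> 0"
      by (rule Lim_null_comparison[OF always_eventually e(1)]) (use zG(2) in simp)
    show "(\<lambda>n. l2 D (\<lambda>x. G n x - H x)) \<longlonglongrightarrow> 0"
      by (rule Lim_null_comparison[OF always_eventually e(1)]) (use zG(3) in simp)
  qed
qed

text \<open>The state equation with the \<open>sobolev0\<close> gradient of the state made explicit,
  and tested only with functions carrying such a gradient.\<close>

definition state_pair :: "(real^'n \<Rightarrow> real) \<Rightarrow> (real^'n \<Rightarrow> ennreal) \<Rightarrow> (real^'n \<Rightarrow> real) \<Rightarrow> (real^'n \<Rightarrow> real^'n) \<Rightarrow> bool" where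
  "state_pair f V u G \<longleftrightarrow> sobolev0 D u G \<and> u \<in> energy_space D V \<and>
    (\<forall>\<phi> \<Phi>. sobolev0 D \<phi> \<Phi> \<longrightarrow> \<phi> \<in> energy_space D V \<longrightarrow>
      (\<integral>x. G x \<bullet> \<Phi> x \<partial>lebesgue_on D) + (\<integral>x. enn2real (V x) * u x * \<phi> x \<partial>lebesgue_on D)
        = (\<integral>x. f x * \<phi> x \<partial>lebesgue_on D))"

text \<open>Testing with the solution itself bounds the squared gradient norm plus the potential
  energy by \<open>A\<close> times the gradient norm, where \<open>A\<close> depends on
  \<open>f\<close> and the Poincare constant but not on \<open>V\<close>. \<open>B\<close> adds the
  three resulting bounds into one constant.\<close>

lemma resolvent_bound:
  assumes f: "L2_on D f"
  obtains B where "\<And>V. V \<in> borel_measurable (lebesgue_on D) \<Longrightarrow> \<exists>G. state_pair f V (resolvent D V f) G \<and>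
     l2 D (resolvent D V f) \<le> B \<and> l2 D G \<le> B \<and>
     (\<integral>\<^sup>+x. V x * ennreal ((resolvent D V f x)\<^sup>2) \<partial>lebesgue_on D) \<le> ennreal B"
proof -
  obtain C where C: "C > 0" "\<And>u G. sobolev0 D u G \<Longrightarrow> l2 D u \<le> C * l2 D G"
    by (rule Poincare_sobolev0) (rule that)
  define A where "A = l2 D f * C"
  have A0: "A \<ge> 0" using C(1) by (simp add: A_def)
  define B where "B = A + C * A + A\<^sup>2"
  have "\<exists>G. state_pair f V (resolvent D V f) G \<and> l2 D (resolvent D V f) \<le> B \<and> l2 D G \<le> B \<and>
     (\<integral>\<^sup>+x. V x * ennreal ((resolvent D V f x)\<^sup>2) \<partial>lebesgue_on D) \<le> ennreal B"
    if V: "V \<in> borel_measurable (lebesgue_on D)" for V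
  proof -
    let ?u = "resolvent D V f"
    obtain G where G: "sobolev0 D ?u G" "?u \<in> energy_space D V"
      "\<And>\<phi> \<Phi>. sobolev0 D \<phi> \<Phi> \<Longrightarrow> \<phi> \<in> energy_space D V \<Longrightarrow>
      (\<integral>x. G x \<bullet> \<Phi> x \<partial>lebesgue_on D) + (\<integral>x. enn2real (V x) * ?u x * \<phi> x \<partial>lebesgue_on D)
        = (\<integral>x. f x * \<phi> x \<partial>lebesgue_on D)"
      by (rule resolvent_equation[OF V f]) (rule that)
    have "(\<integral>x. G x \<bullet> G x \<partial>lebesgue_on D) = (l2 D G)\<^sup>2"
      unfolding l2_square by (simp add: power2_norm_eq_inner)
    moreover have "(\<integral>x. enn2real (V x) * ?u x * ?u x \<partial>lebesgue_on D) = (l2 D (\<lambda>x. sqrt_potential V x * ?u x))\<^sup>2"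
      unfolding l2_square potential_form(1)[OF V G(2,2)] power2_norm_eq_inner ..
    moreover have "(\<integral>x. f x * ?u x \<partial>lebesgue_on D) \<le> l2 D f * l2 D ?u"
      using l2_Cauchy_Schwarz_real[OF f sobolev0_L2(1)[OF G(1)]] by linarith
    moreover have "l2 D f * l2 D ?u \<le> A * l2 D G"
      using mult_left_mono[OF C(2)[OF G(1)] l2_nonneg[of D f]] by (simp add: A_def mult.assoc)
    ultimately have main: "(l2 D G)\<^sup>2 + (l2 D (\<lambda>x. sqrt_potential V x * ?u x))\<^sup>2 \<le> A * l2 D G"
      using G(3)[OF G(1,2)] by linarith
    have "l2 D G * l2 D G \<le> A * l2 D G"
      using main zero_le_power2[of "l2 D (\<lambda>x. sqrt_potential V x * ?u x)"]
      unfolding power2_eq_square[of "l2 D G"] by linarith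
    then have GA: "l2 D G \<le> A"
      using A0 l2_nonneg[of D G] by (cases "l2 D G = 0") (auto simp: mult_le_cancel_right)
    have uA: "l2 D ?u \<le> C * A"
      using C(2)[OF G(1)] mult_left_mono[OF GA, of C] C(1) by linarith
    have "(l2 D (\<lambda>x. sqrt_potential V x * ?u x))\<^sup>2 \<le> A * A"
      using main zero_le_power2[of "l2 D G"] mult_left_mono[OF GA A0] by linarith
    then have EA: "(\<integral>\<^sup>+x. V x * ennreal ((?u x)\<^sup>2) \<partial>lebesgue_on D) \<le> ennreal (A\<^sup>2)"
      unfolding energy_space_L2(3)[OF V G(2)] by (simp add: power2_eq_square ennreal_leI)
    have "A \<le> B" "C * A \<le> B" "A\<^sup>2 \<le> B" using A0 C(1) by (auto simp: B_def)
    then show ?thesis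
      using G GA uA order_trans[OF EA ennreal_leI] unfolding state_pair_def by (intro exI[of _ G]) auto
  qed
  then show ?thesis by (rule that)
qed

text \<open>Comparison: \<open>min u 0\<close> is a supersolution for the potential \<open>V\<close> equal to \<open>W\<close> on \<open>{u < 0}\<close> and to
  \<open>\<infinity>\<close> elsewhere, as the limit \<open>m \<longrightarrow> \<infinity>\<close> of \<open>ineq\<close> shows; test both equations with \<open>ramp (w - min u 0)\<close>.\<close>

lemma resolvent_le_of_limit_inequality:
  assumes f: "L2_on D f" and u: "sobolev0 D u H" and W[measurable]: "W \<in> borel_measurable (lebesgue_on D)"
    and energy: "(\<integral>\<^sup>+x. W x * ennreal ((u x)\<^sup>2) \<partial>lebesgue_on D) < \<infinity>"
    and ineq: "\<And>\<phi> \<Phi> m. sobolev0 D \<phi> \<Phi> \<Longrightarrow> (\<And>x. 0 \<le> \<phi> x) \<Longrightarrow> (\<And>x. \<phi> x \<le> 1) \<Longrightarrow> m > 0 \<Longrightarrow>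
      0 \<le> (\<integral>x. (negative_ramp m (u x) *\<^sub>R \<Phi> x) \<bullet> H x \<partial>lebesgue_on D) - (\<integral>x. f x * (\<phi> x * negative_ramp m (u x)) \<partial>lebesgue_on D) \<and>
      (\<integral>\<^sup>+x. W x * ennreal (max (- u x) 0 * \<phi> x * negative_ramp m (u x)) \<partial>lebesgue_on D)
       \<le> ennreal ((\<integral>x. (negative_ramp m (u x) *\<^sub>R \<Phi> x) \<bullet> H x \<partial>lebesgue_on D) - (\<integral>x. f x * (\<phi> x * negative_ramp m (u x)) \<partial>lebesgue_on D))"
    and w: "state_pair f (\<lambda>x. if u x < 0 then W x else \<infinity>) w Gw"
  shows "AE x in lebesgue_on D. w x \<le> u x"
proof -
  define V where "V x = (if u x < 0 then W x else \<infinity>)" for x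
  define \<kappa> where "\<kappa> x = (if u x < 0 then 1 else 0 :: real)" for x
  define z where "z x = min (u x) 0" for x
  define Gz where "Gz x = \<kappa> x *\<^sub>R H x" for x
  note [measurable] = sobolev0_measurable[OF u]
  have V_meas[measurable]: "V \<in> borel_measurable (lebesgue_on D)" unfolding V_def[abs_def] by measurable
  have w: "sobolev0 D w Gw" "w \<in> energy_space D V"
    "\<And>\<phi> \<Phi>. sobolev0 D \<phi> \<Phi> \<Longrightarrow> \<phi> \<in> energy_space D V \<Longrightarrow>
      (\<integral>x. Gw x \<bullet> \<Phi> x \<partial>lebesgue_on D) + (\<integral>x. enn2real (V x) * w x * \<phi> x \<partial>lebesgue_on D)
        = (\<integral>x. f x * \<phi> x \<partial>lebesgue_on D)"
    using w unfolding state_pair_def V_def[abs_def] by blast+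
  have sz: "sobolev0 D z Gz"
    using sobolev0_negative_part[OF u] unfolding z_def[abs_def] Gz_def[abs_def] \<kappa>_def .
  have Ez: "z \<in> energy_space D V"
  proof (rule energy_spaceI[OF sz])
    \<comment> \<open>Where \<open>V\<close> was raised to \<infinity> the negative part
      \<open>z\<close> is 0; elsewhere \<open>V\<close> is \<open>W\<close> and \<open>z\<close> is
      \<open>u\<close>.\<close>
    have "(\<integral>\<^sup>+x. V x * ennreal ((z x)\<^sup>2) \<partial>lebesgue_on D) \<le> (\<integral>\<^sup>+x. W x * ennreal ((u x)\<^sup>2) \<partial>lebesgue_on D)"
      by (intro nn_integral_mono) (auto simp: V_def z_def min_def)
    then show "(\<integral>\<^sup>+x. V x * ennreal ((z x)\<^sup>2) \<partial>lebesgue_on D) < \<infinity>" using energy by (rule le_less_trans)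
  qed
  define v where "v x = w x - z x" for x
  define Gv where "Gv x = Gw x - Gz x" for x
  have sv: "sobolev0 D v Gv" unfolding v_def[abs_def] Gv_def[abs_def] by (rule sobolev0_diff[OF w(1) sz])
  have Ev: "v \<in> energy_space D V"
    using energy_space_lincomb[OF V_meas w(2) Ez, of 1 "-1"] by (simp add: v_def[abs_def])
  \<comment> \<open>A bounded C1 substitute for the positive part of \<open>w - z\<close>: its
    values lie in [0,1], as \<open>ineq\<close> demands, and it vanishes exactly where the
    comparison already holds.\<close>
  define \<phi> where "\<phi> x = ramp (v x)" for x
  define \<Phi> where "\<Phi> x = ramp' (v x) *\<^sub>R Gv x" for x
  have ramp0: "ramp 0 = 0" by (simp add: ramp_bounds)
  have s\<phi>: "sobolev0 D \<phi> \<Phi>" unfolding \<phi>_def[abs_def] \<Phi>_def[abs_def] by (rule sobolev0_compose[OF ramp_C1 ramp0 sv])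
  have \<phi>01: "0 \<le> \<phi> x" "\<phi> x \<le> 1" for x by (simp_all add: \<phi>_def ramp_bounds)
  have "\<bar>\<phi> x\<bar> \<le> 1 * \<bar>v x\<bar>" for x
    using C1_Lipschitz_diff_le[OF ramp_C1, of "v x" 0] by (simp add: \<phi>_def ramp0)
  then have E\<phi>: "\<phi> \<in> energy_space D V"
    by (intro energy_space_dominated[OF V_meas s\<phi> Ev, of 1] AE_I2)
  note L\<phi> = sobolev0_L2[OF s\<phi>] and LH = sobolev0_L2(2)[OF u]
  have [measurable]: "\<phi> \<in> borel_measurable (lebesgue_on D)" by (rule sobolev0_measurable(1)[OF s\<phi>])
  let ?m = "\<lambda>n. real (Suc n)"
  have pos: "?m n > 0" for n by simp
  note [measurable] = C1_Lipschitz_measurable(1)[OF negative_ramp_C1[OF pos]]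
  define Lm where "Lm n = (\<integral>x. (negative_ramp (?m n) (u x) *\<^sub>R \<Phi> x) \<bullet> H x \<partial>lebesgue_on D) - (\<integral>x. f x * (\<phi> x * negative_ramp (?m n) (u x)) \<partial>lebesgue_on D)" for n
  define L where "L = (\<integral>x. (\<kappa> x *\<^sub>R \<Phi> x) \<bullet> H x \<partial>lebesgue_on D) - (\<integral>x. f x * (\<phi> x * \<kappa> x) \<partial>lebesgue_on D)"
  have Lm: "0 \<le> Lm n" "(\<integral>\<^sup>+x. W x * ennreal (max (- u x) 0 * \<phi> x * negative_ramp (?m n) (u x)) \<partial>lebesgue_on D) \<le> ennreal (Lm n)" for n
    using ineq[OF s\<phi> \<phi>01 pos[of n]] unfolding Lm_def by blast+
  have "Lm \<longlonglongrightarrow> L"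
    unfolding Lm_def[abs_def] L_def
  proof (rule tendsto_diff)
    note t = negative_ramp_scaleR_tendsto[OF sobolev0_measurable(1)[OF u] L\<phi>(2), folded \<kappa>_def]
    show "(\<lambda>n. \<integral>x. (negative_ramp (?m n) (u x) *\<^sub>R \<Phi> x) \<bullet> H x \<partial>lebesgue_on D) \<longlonglongrightarrow> (\<integral>x. (\<kappa> x *\<^sub>R \<Phi> x) \<bullet> H x \<partial>lebesgue_on D)"
      by (rule tendsto_inner_L2_left[OF t LH])
    note t = negative_ramp_scaleR_tendsto[OF sobolev0_measurable(1)[OF u] L\<phi>(1), folded \<kappa>_def]
    show "(\<lambda>n. \<integral>x. f x * (\<phi> x * negative_ramp (?m n) (u x)) \<partial>lebesgue_on D) \<longlonglongrightarrow> (\<integral>x. f x * (\<phi> x * \<kappa> x) \<partial>lebesgue_on D)"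
      using tendsto_inner_L2_left[OF t f] by (simp add: mult_ac del: of_nat_Suc)
  qed
  have L0: "0 \<le> L" by (rule LIMSEQ_le_const[OF \<open>Lm \<longlonglongrightarrow> L\<close>]) (use Lm(1) in blast)
  have "(\<integral>\<^sup>+x. W x * ennreal (max (- u x) 0 * \<phi> x * \<kappa> x) \<partial>lebesgue_on D) \<le> ennreal L"
  proof (rule nn_integral_Fatou_AE[OF _ _ Lm(2) tendsto_ennrealI[OF \<open>Lm \<longlonglongrightarrow> L\<close>]])
    show "(\<lambda>x. W x * ennreal (max (- u x) 0 * \<phi> x * negative_ramp (?m n) (u x))) \<in> borel_measurable (lebesgue_on D)" for n
      by measurable
    have "(\<lambda>n. W x * ennreal (max (- u x) 0 * \<phi> x * negative_ramp (?m n) (u x))) \<longlonglongrightarrow> W x * ennreal (max (- u x) 0 * \<phi> x * \<kappa> x)" for x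
    proof (cases "max (- u x) 0 * \<phi> x = 0")
      case True
      then show ?thesis by (simp only: mult_zero_left ennreal_0 mult_zero_right tendsto_const)
    next
      case False
      then have ux: "u x < 0" "max (- u x) 0 * \<phi> x > 0" using \<phi>01(1)[of x] by (auto simp: max_def less_le split: if_splits)
      show ?thesis
      proof (rule ennreal_tendsto_mult)
        show "(\<lambda>n. ennreal (max (- u x) 0 * \<phi> x * negative_ramp (?m n) (u x))) \<longlonglongrightarrow> ennreal (max (- u x) 0 * \<phi> x * \<kappa> x)"
          unfolding \<kappa>_def by (intro tendsto_ennrealI tendsto_mult tendsto_const negative_ramp_tendsto)
      qed (use ux in \<open>auto simp: \<kappa>_def\<close>)
    qed
    then show "AE x in lebesgue_on D. (\<lambda>n. W x * ennreal (max (- u x) 0 * \<phi> x * negative_ramp (?m n) (u x))) \<longlonglongrightarrow> W x * ennreal (max (- u x) 0 * \<phi> x * \<kappa> x)"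
      by (intro AE_I2)
  qed
  also have "(\<integral>\<^sup>+x. W x * ennreal (max (- u x) 0 * \<phi> x * \<kappa> x) \<partial>lebesgue_on D) = (\<integral>\<^sup>+x. V x * ennreal ((- z x) * \<phi> x) \<partial>lebesgue_on D)"
    by (intro nn_integral_cong) (auto simp: V_def z_def \<kappa>_def max_def min_def)
  also have "\<dots> = ennreal (\<integral>x. enn2real (V x) * (- z x) * \<phi> x \<partial>lebesgue_on D)"
  proof (rule potential_form(3)[OF V_meas _ E\<phi>])
    show "(\<lambda>x. - z x) \<in> energy_space D V" using energy_space_lincomb[OF V_meas Ez Ez, of "-1" 0] by simp
    show "AE x in lebesgue_on D. 0 \<le> (- z x) * \<phi> x" using \<phi>01 by (intro AE_I2) (simp add: z_def min_def mult_nonpos_nonneg)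
  qed
  finally have Vz: "- (\<integral>x. enn2real (V x) * z x * \<phi> x \<partial>lebesgue_on D) \<le> L"
    using L0 by simp
  \<comment> \<open>Where \<open>u\<close> is nonnegative, \<open>V\<close> is infinite, so
    \<open>w\<close> is 0 almost everywhere there; \<open>z\<close> is 0 too and \<phi> is
    \<open>ramp 0\<close>. The cutoff \<kappa> thus changes nothing in the load term, whatever the
    sign of \<open>f\<close>.\<close>
  have "(\<integral>x. f x * (\<phi> x * \<kappa> x) \<partial>lebesgue_on D) = (\<integral>x. f x * \<phi> x \<partial>lebesgue_on D)"
  proof (rule integral_cong_AE)
    show "AE x in lebesgue_on D. f x * (\<phi> x * \<kappa> x) = f x * \<phi> x"
      using energy_space_L2(2)[OF V_meas w(2)]
      by eventually_elim (auto simp: \<kappa>_def \<phi>_def v_def z_def V_def ramp0 min_def)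
    show "(\<lambda>x. f x * (\<phi> x * \<kappa> x)) \<in> borel_measurable (lebesgue_on D)" "(\<lambda>x. f x * \<phi> x) \<in> borel_measurable (lebesgue_on D)"
      using L2_on_measurable[OF f] unfolding \<kappa>_def by measurable
  qed
  moreover have "(\<integral>x. (\<kappa> x *\<^sub>R \<Phi> x) \<bullet> H x \<partial>lebesgue_on D) = (\<integral>x. Gz x \<bullet> \<Phi> x \<partial>lebesgue_on D)"
    by (simp add: Gz_def inner_commute)
  ultimately have L_eq: "L = (\<integral>x. Gz x \<bullet> \<Phi> x \<partial>lebesgue_on D) - (\<integral>x. f x * \<phi> x \<partial>lebesgue_on D)"
    by (simp add: L_def)
  have GvPhi: "(\<integral>x. Gv x \<bullet> \<Phi> x \<partial>lebesgue_on D) = (\<integral>x. Gw x \<bullet> \<Phi> x \<partial>lebesgue_on D) - (\<integral>x. Gz x \<bullet> \<Phi> x \<partial>lebesgue_on D)"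
    unfolding Gv_def inner_diff_left
    by (rule Bochner_Integration.integral_diff[OF L2_on_inner_integrable[OF sobolev0_L2(2)[OF w(1)] L\<phi>(2)] L2_on_inner_integrable[OF sobolev0_L2(2)[OF sz] L\<phi>(2)]])
  have "(\<integral>x. enn2real (V x) * v x * \<phi> x \<partial>lebesgue_on D)
      = (\<integral>x. enn2real (V x) * w x * \<phi> x \<partial>lebesgue_on D) - (\<integral>x. enn2real (V x) * z x * \<phi> x \<partial>lebesgue_on D)"
    using Bochner_Integration.integral_diff[OF potential_form(2)[OF V_meas w(2) E\<phi>] potential_form(2)[OF V_meas Ez E\<phi>]]
    by (simp add: v_def algebra_simps)
  moreover have "0 \<le> (\<integral>x. enn2real (V x) * v x * \<phi> x \<partial>lebesgue_on D)"
  proof (rule Bochner_Integration.integral_nonneg)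
    fix x
    have "0 \<le> v x * \<phi> x" using ramp_bounds(3)[of "v x"] \<phi>01(1)[of x] by (cases "v x \<le> 0") (auto simp: \<phi>_def)
    from mult_nonneg_nonneg[OF enn2real_nonneg this, of "V x"]
    show "0 \<le> enn2real (V x) * v x * \<phi> x" by (simp only: mult.assoc)
  qed
  \<comment> \<open>The equation for \<open>w\<close> minus the inequality for \<open>z\<close>,
    both tested with \<phi>; the potential part of the difference is nonnegative because
    \<open>v\<close> and \<open>ramp (v x)\<close> never have opposite signs.\<close>
  ultimately have le0: "(\<integral>x. Gv x \<bullet> \<Phi> x \<partial>lebesgue_on D) \<le> 0"
    using w(3)[OF s\<phi> E\<phi>] Vz L_eq GvPhi by linarith
  have Gv_nonneg: "0 \<le> Gv x \<bullet> \<Phi> x" for x by (simp add: \<Phi>_def ramp_bounds)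
  then have "(\<integral>x. Gv x \<bullet> \<Phi> x \<partial>lebesgue_on D) = 0"
    using le0 by (intro antisym) (auto intro: Bochner_Integration.integral_nonneg)
  then have "AE x in lebesgue_on D. Gv x \<bullet> \<Phi> x = 0"
    using integral_nonneg_eq_0_iff_AE[OF L2_on_inner_integrable[OF sobolev0_L2(2)[OF sv] L\<phi>(2)]] Gv_nonneg by simp
  \<comment> \<open>The integrand is \<open>ramp' (v x)\<close> times the squared norm of
    \<open>Gv x\<close>; when it vanishes, one of the two factors of \<open>\<Phi> x\<close> does.
    Poincare then gives \<phi> = 0.\<close>
  then have "AE x in lebesgue_on D. \<Phi> x = 0"
    by eventually_elim (auto simp: \<Phi>_def)
  then have "l2 D \<Phi> = 0" using l2_eq_0_iff[OF L\<phi>(2)] by simp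
  moreover obtain C where "C > 0" "\<And>u G. sobolev0 D u G \<Longrightarrow> l2 D u \<le> C * l2 D G"
    by (rule Poincare_sobolev0) (rule that)
  from this(2)[OF s\<phi>] have "l2 D \<phi> \<le> C * l2 D \<Phi>" .
  ultimately have "l2 D \<phi> = 0" using l2_nonneg[of D \<phi>] by simp
  then have "AE x in lebesgue_on D. \<phi> x = 0" using l2_eq_0_iff[OF L\<phi>(1)] by simp
  then show ?thesis
  proof eventually_elim
    case (elim x)
    then have "v x \<le> 0" using ramp_bounds(4)[of "v x"] by (cases "v x \<le> 0") (auto simp: \<phi>_def)
    then show ?case by (auto simp: v_def z_def min_def split: if_splits)
  qed
qed

end

section \<open>Existence of an optimal potential\<close>

locale potential_problem = bounded_open D + convex_weight \<Psi> p
  for D :: "(real^'n) set" and \<Psi> p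
begin

lemma optimal_potential_exists:
  assumes ne: "admissible D \<Psi> \<noteq> {}" and f: "L2_on D f" and g: "L2_on D g" and g0: "AE x in lebesgue_on D. 0 \<le> g x"
  shows "\<exists>V_opt \<in> admissible D \<Psi>. \<forall>V \<in> admissible D \<Psi>.
    (\<integral>x. g x * resolvent D V_opt f x \<partial>lebesgue_on D) \<le> (\<integral>x. g x * resolvent D V f x \<partial>lebesgue_on D)"
proof -
  have adm: "V \<in> borel_measurable (lebesgue_on D)" "(\<integral>\<^sup>+x. \<Psi> (V x) \<partial>lebesgue_on D) \<le> 1" if "V \<in> admissible D \<Psi>" for V
    using that by (auto simp: admissible_def)
  obtain B where B: "\<And>V. V \<in> borel_measurable (lebesgue_on D) \<Longrightarrow> \<exists>G. state_pair f V (resolvent D V f) G \<and>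
     l2 D (resolvent D V f) \<le> B \<and> l2 D G \<le> B \<and>
     (\<integral>\<^sup>+x. V x * ennreal ((resolvent D V f x)\<^sup>2) \<partial>lebesgue_on D) \<le> ennreal B"
    by (rule resolvent_bound[OF f]) (rule that)
  define cost where "cost V = (\<integral>x. g x * resolvent D V f x \<partial>lebesgue_on D)" for V
  have cost_lower: "- (l2 D g * B) \<le> cost V" if "V \<in> admissible D \<Psi>" for V
  proof -
    obtain G where G: "state_pair f V (resolvent D V f) G" "l2 D (resolvent D V f) \<le> B"
      using B[OF adm(1)[OF \<open>V \<in> admissible D \<Psi>\<close>]] by blast
    then have "\<bar>cost V\<bar> \<le> l2 D g * l2 D (resolvent D V f)"
      unfolding cost_def state_pair_def by (intro l2_Cauchy_Schwarz_real g sobolev0_L2(1)) auto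
    also have "\<dots> \<le> l2 D g * B" by (intro mult_left_mono G) simp
    finally show ?thesis by simp
  qed
  define \<iota> where "\<iota> = Inf (cost ` admissible D \<Psi>)"
  have bdd: "bdd_below (cost ` admissible D \<Psi>)" using cost_lower by (auto intro!: bdd_belowI)
  have \<iota>_le: "\<iota> \<le> cost V" if "V \<in> admissible D \<Psi>" for V
    unfolding \<iota>_def using that by (intro cInf_lower bdd) auto
  define e where "e n = inverse (real (Suc n))" for n
  have e: "e \<longlonglongrightarrow> 0" "e n > 0" for n unfolding e_def by (rule LIMSEQ_inverse_real_of_nat) simp
  have "\<exists>V\<in>admissible D \<Psi>. cost V < \<iota> + e n" for n
    using cInf_lessD[of "cost ` admissible D \<Psi>" "\<iota> + e n"] ne e(2)[of n] by (auto simp: \<iota>_def)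
  then obtain V1 where V1: "\<And>n. V1 n \<in> admissible D \<Psi>" "\<And>n. cost (V1 n) < \<iota> + e n" by metis
  have "\<forall>n. \<exists>G. state_pair f (V1 n) (resolvent D (V1 n) f) G \<and> l2 D (resolvent D (V1 n) f) \<le> B \<and> l2 D G \<le> B \<and>
     (\<integral>\<^sup>+x. V1 n x * ennreal ((resolvent D (V1 n) f x)\<^sup>2) \<partial>lebesgue_on D) \<le> ennreal B"
    using B[OF adm(1)[OF V1(1)]] by blast
  then obtain G1 where G1: "\<And>n. state_pair f (V1 n) (resolvent D (V1 n) f) (G1 n)"
    "\<And>n. l2 D (resolvent D (V1 n) f) \<le> B" "\<And>n. l2 D (G1 n) \<le> B"
    "\<And>n. (\<integral>\<^sup>+x. V1 n x * ennreal ((resolvent D (V1 n) f x)\<^sup>2) \<partial>lebesgue_on D) \<le> ennreal B" by metis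
  have G1s: "sobolev0 D (resolvent D (V1 n) f) (G1 n)" for n using G1(1) by (simp add: state_pair_def)
  obtain r1 u0 where r1: "strict_mono r1" "L2_on D u0" "(\<lambda>n. l2 D (\<lambda>x. resolvent D (V1 (r1 n)) f x - u0 x)) \<longlonglongrightarrow> 0"
    by (rule Rellich_sobolev0[OF G1s G1(2,3)]) (rule that)
  obtain r2 where r2: "strict_mono r2" "AE x in lebesgue_on D. (\<lambda>n. resolvent D (V1 (r1 (r2 n))) f x) \<longlonglongrightarrow> u0 x"
    by (rule L2_tendsto_AE_subseq[OF sobolev0_L2(1)[OF G1s] r1(2,3)]) (rule that)
  define V where "V n = V1 (r1 (r2 n))" for n
  define G where "G n = G1 (r1 (r2 n))" for n
  define u where "u n = resolvent D (V n) f" for n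
  have V: "V n \<in> admissible D \<Psi>" for n by (simp add: V_def V1)
  note V_meas = adm(1)[OF V]
  have uG: "state_pair f (V n) (u n) (G n)" "l2 D (G n) \<le> B" "(\<integral>\<^sup>+x. V n x * ennreal ((u n x)\<^sup>2) \<partial>lebesgue_on D) \<le> ennreal B" for n
    unfolding u_def V_def G_def using G1 by blast+
  have us: "sobolev0 D (u n) (G n)" for n using uG(1) by (simp add: state_pair_def)
  note Lu = sobolev0_L2[OF us]
  have ulim: "(\<lambda>n. l2 D (\<lambda>x. u n x - u0 x)) \<longlonglongrightarrow> 0" "AE x in lebesgue_on D. (\<lambda>n. u n x) \<longlonglongrightarrow> u0 x"
    using LIMSEQ_subseq_LIMSEQ[OF r1(3) r2(1)] r2(2) by (simp_all add: o_def u_def V_def)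
  have cost_u0: "(\<integral>x. g x * u0 x \<partial>lebesgue_on D) \<le> \<iota>"
  proof -
    have "(\<lambda>n. \<integral>x. g x * u n x \<partial>lebesgue_on D) \<longlonglongrightarrow> (\<integral>x. g x * u0 x \<partial>lebesgue_on D)"
      using tendsto_inner_L2_left[OF Lu(1) r1(2) ulim(1) g] by (simp add: mult.commute)
    moreover have "(\<lambda>n. \<iota> + e (r1 (r2 n))) \<longlonglongrightarrow> \<iota> + 0"
      using LIMSEQ_subseq_LIMSEQ[OF LIMSEQ_subseq_LIMSEQ[OF e(1) r1(1)] r2(1)]
      by (intro tendsto_add tendsto_const) (simp add: o_def)
    ultimately have "(\<integral>x. g x * u0 x \<partial>lebesgue_on D) \<le> \<iota> + 0"
      by (rule LIMSEQ_le) (use less_imp_le[OF V1(2)] in \<open>auto simp: cost_def u_def V_def\<close>)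
    then show ?thesis by simp
  qed
  \<comment> \<open>Only indices from \<open>n\<close> on are averaged. This makes the sets decrease
    and ties the limits to the tails of the minimising sequence.\<close>
  define K where "K n = midpoint_hull {(G k, V k) | k. n \<le> k}" for n
  have K_prop: "L2_on D y \<and> l2 D y \<le> B" if "(y, W) \<in> K n" for y W n
    using that unfolding K_def
  proof (induction rule: midpoint_hull_induct)
    case (base y W)
    then show ?case using Lu(2) uG(2) by auto
  next
    case (midpoint y W z Y)
    have "l2 D (\<lambda>x. (1/2) *\<^sub>R (y x + z x)) = (1/2) * l2 D (\<lambda>x. y x + z x)" by (simp only: l2_scaleR)
    also have "\<dots> \<le> B" using l2_triangle[of D y z] midpoint by simp
    finally show ?case using midpoint by (auto intro!: L2_on_scaleR L2_on_add)
  qed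
  have K_adm: "W \<in> borel_measurable (lebesgue_on D) \<and> (\<integral>\<^sup>+x. \<Psi> (W x) \<partial>lebesgue_on D) \<le> 1" if "(y, W) \<in> K n" for y W n
    using that unfolding K_def by (rule midpoint_hull_admissible) (use adm[OF V] in auto)
  obtain H W H0 W0 where HW: "\<And>n::nat. (H n, W n) \<in> K n" and H0: "L2_on D H0" "(\<lambda>n. l2 D (\<lambda>x. H n x - H0 x)) \<longlonglongrightarrow> 0"
    and W0: "W0 \<in> borel_measurable (lebesgue_on D)" "AE x in lebesgue_on D. (\<lambda>n. W n x) \<longlonglongrightarrow> W0 x"
  proof (rule convex_compactness[of K B])
    have "(G n, V n) \<in> K n" for n unfolding K_def by (rule midpoint_hull.base) blast
    then show "K n \<noteq> {}" for n by (metis empty_iff)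
    have "{(G k, V k) | k. n \<le> k} \<subseteq> {(G k, V k) | k. m \<le> k}" if "m \<le> n" for m n
      using that by (auto intro: order_trans)
    then show "K n \<subseteq> K m" if "m \<le> n" for m n
      unfolding K_def using that by (intro midpoint_hull_mono)
    show "(\<lambda>x. (1/2) *\<^sub>R (y x + z x), \<lambda>x. (V x + W x) / 2) \<in> K n" if "(y, V) \<in> K n" "(z, W) \<in> K n" for n y V z W
      using that unfolding K_def by (rule midpoint_hull.midpoint)
    show "L2_on D y" "l2 D y \<le> B" if "(y, V) \<in> K n" for n y V using K_prop[OF that] by auto
    show "V \<in> borel_measurable (lebesgue_on D)" if "(y, V) \<in> K n" for n y V using K_adm[OF that] by blast
  qed (rule that)
  note HW' = HW[unfolded K_def]
  \<comment> \<open>Late averaged gradients belong to averages of late states, which are close to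
    \<open>u0\<close>. The limit field is therefore a gradient of \<open>u0\<close> itself, although
    the gradients \<open>G n\<close> need not converge strongly.\<close>
  have sH0: "sobolev0 D u0 H0"
  proof (rule sobolev0_closed_approx[OF r1(2) H0(1)])
    fix \<epsilon> :: real assume "\<epsilon> > 0"
    obtain N1 where N1: "\<And>n. n \<ge> N1 \<Longrightarrow> l2 D (\<lambda>x. u n x - u0 x) < \<epsilon>"
      using LIMSEQ_D[OF ulim(1) \<open>\<epsilon> > 0\<close>] by auto
    obtain N2 where N2: "\<And>n. n \<ge> N2 \<Longrightarrow> l2 D (\<lambda>x. H n x - H0 x) < \<epsilon>"
      using LIMSEQ_D[OF H0(2) \<open>\<epsilon> > 0\<close>] by auto
    let ?n = "max N1 N2"
    have "\<exists>z. sobolev0 D z (H ?n) \<and> l2 D (\<lambda>x. z x - u0 x) \<le> \<epsilon>"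
    proof (rule midpoint_hull_sobolev0[OF HW'[of ?n] r1(2)])
      fix G' V' assume "(G', V') \<in> {(G k, V k) | k. ?n \<le> k}"
      then obtain k where "?n \<le> k" "G' = G k" by auto
      then show "\<exists>z. sobolev0 D z G' \<and> l2 D (\<lambda>x. z x - u0 x) \<le> \<epsilon>"
        using us[of k] N1[of k] by (intro exI[of _ "u k"]) auto
    qed
    then show "\<exists>z G. sobolev0 D z G \<and> l2 D (\<lambda>x. z x - u0 x) \<le> \<epsilon> \<and> l2 D (\<lambda>x. G x - H0 x) \<le> \<epsilon>"
      using less_imp_le[OF N2[of ?n]] by auto
  qed
  have Psi_W0: "(\<integral>\<^sup>+x. \<Psi> (W0 x) \<partial>lebesgue_on D) \<le> 1"
  proof -
    have "(\<integral>\<^sup>+x. \<Psi> (W0 x) \<partial>lebesgue_on D) \<le> (\<integral>\<^sup>+x. liminf (\<lambda>n. \<Psi> (W n x)) \<partial>lebesgue_on D)"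
      using W0(2) by (intro nn_integral_mono_AE, eventually_elim) (rule Psi_lsc)
    also have "\<dots> \<le> liminf (\<lambda>n. \<integral>\<^sup>+x. \<Psi> (W n x) \<partial>lebesgue_on D)"
      using K_adm[OF HW] by (intro nn_integral_liminf measurable_compose[OF _ Psi_measurable]) blast
    also have "\<dots> \<le> liminf (\<lambda>n. 1)" using K_adm[OF HW] by (intro Liminf_mono always_eventually) blast
    also have "\<dots> = 1" by (simp add: Liminf_const)
    finally show ?thesis .
  qed
  note limit_inequality = midpoint_hull_limit_inequality[OF HW' Lu(2) V_meas H0 W0(2)]
  have energy: "(\<integral>\<^sup>+x. W0 x * ennreal ((u0 x)\<^sup>2) \<partial>lebesgue_on D) \<le> ennreal B"
  proof -
    have B0: "0 \<le> B" using order_trans[OF l2_nonneg uG(2)] .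
    \<comment> \<open>The limit inequality with zero field and right-hand side constantly
      \<open>B\<close>: it serves here as pure lower semicontinuity of the energy.\<close>
    have "(\<integral>\<^sup>+x. W0 x * ennreal ((u0 x)\<^sup>2) \<partial>lebesgue_on D) \<le> ennreal ((\<integral>x. 0 \<bullet> H0 x \<partial>lebesgue_on D) + B)"
    proof (rule limit_inequality(2))
      show "(\<lambda>x. ennreal ((u k x)\<^sup>2)) \<in> borel_measurable (lebesgue_on D)" for k
        using L2_on_measurable[OF Lu(1)[of k]] by measurable
      show "AE x in lebesgue_on D. (\<lambda>k. ennreal ((u k x)\<^sup>2)) \<longlonglongrightarrow> ennreal ((u0 x)\<^sup>2)"
        using ulim(2) by eventually_elim (intro tendsto_ennrealI tendsto_power)
      show "0 \<le> B \<and> (\<integral>\<^sup>+x. V k x * ennreal ((u k x)\<^sup>2) \<partial>lebesgue_on D) \<le> ennreal B" for k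
        using B0 uG(3) by blast
    qed simp_all
    then show ?thesis by simp
  qed
  have test: "0 \<le> (\<integral>x. (negative_ramp m (u0 x) *\<^sub>R \<Phi> x) \<bullet> H0 x \<partial>lebesgue_on D) - (\<integral>x. f x * (\<phi> x * negative_ramp m (u0 x)) \<partial>lebesgue_on D) \<and>
      (\<integral>\<^sup>+x. W0 x * ennreal (max (- u0 x) 0 * \<phi> x * negative_ramp m (u0 x)) \<partial>lebesgue_on D)
       \<le> ennreal ((\<integral>x. (negative_ramp m (u0 x) *\<^sub>R \<Phi> x) \<bullet> H0 x \<partial>lebesgue_on D) - (\<integral>x. f x * (\<phi> x * negative_ramp m (u0 x)) \<partial>lebesgue_on D))"
    if \<phi>: "sobolev0 D \<phi> \<Phi>" "\<And>x. 0 \<le> \<phi> x" "\<And>x. \<phi> x \<le> 1" and m: "m > 0" for \<phi> \<Phi> m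
  proof -
    note C1 = negative_ramp_C1[OF m] and nr = negative_ramp_bounds[OF m] and L\<phi> = sobolev0_L2[OF \<phi>(1)]
    note [measurable] = C1_Lipschitz_measurable(1)[OF C1] L2_on_measurable[OF Lu(1)] L2_on_measurable[OF r1(2)]
      L2_on_measurable[OF L\<phi>(1)] L2_on_measurable[OF L\<phi>(2)]
    have b: "\<bar>negative_ramp m t\<bar> \<le> 1" for t using nr(1,2)[of t] by simp
    have mult_L2: "L2_on D (\<lambda>x. negative_ramp m (y x) *\<^sub>R F x)"
      if "L2_on D F" "y \<in> borel_measurable (lebesgue_on D)" for F :: "real^'n \<Rightarrow> 'c::euclidean_space" and y
      using that(2) by (intro L2_on_mult_bounded[OF that(1) _ b]) measurable
    have conv: "(\<lambda>k. l2 D (\<lambda>x. negative_ramp m (u k x) *\<^sub>R F x - negative_ramp m (u0 x) *\<^sub>R F x)) \<longlonglongrightarrow> 0"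
      if F: "L2_on D F" for F :: "real^'n \<Rightarrow> 'c::euclidean_space"
    proof (rule l2_tendsto_dominated[OF F])
      show "(\<lambda>x. negative_ramp m (u k x) *\<^sub>R F x - negative_ramp m (u0 x) *\<^sub>R F x) \<in> borel_measurable (lebesgue_on D)" for k
        by (rule L2_on_measurable[OF L2_on_diff[OF mult_L2[OF F] mult_L2[OF F]]]) measurable
      have "\<bar>negative_ramp m s - negative_ramp m t\<bar> \<le> 1" for s t using nr(1,2)[of s] nr(1,2)[of t] by linarith
      then have "norm (negative_ramp m (u k x) *\<^sub>R F x - negative_ramp m (u0 x) *\<^sub>R F x) \<le> 1 * norm (F x)" for k x
        unfolding scaleR_diff_left[symmetric] norm_scaleR by (intro mult_right_mono) auto
      then show "AE x in lebesgue_on D. norm (negative_ramp m (u k x) *\<^sub>R F x - negative_ramp m (u0 x) *\<^sub>R F x) \<le> norm (F x)" for k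
        by (intro AE_I2) simp
      show "AE x in lebesgue_on D. (\<lambda>k. negative_ramp m (u k x) *\<^sub>R F x - negative_ramp m (u0 x) *\<^sub>R F x) \<longlonglongrightarrow> 0"
        using ulim(2) by eventually_elim (intro LIM_zero tendsto_scaleR tendsto_const C1_Lipschitz_tendsto(1)[OF C1])
    qed
    define a where "a x = negative_ramp m (u0 x) *\<^sub>R \<Phi> x" for x
    define c where "c = - (\<integral>x. f x * (\<phi> x * negative_ramp m (u0 x)) \<partial>lebesgue_on D)"
    \<comment> \<open>The exact right-hand side with the \<open>k\<close>-th state in its
      coefficients. The affine functional given by \<open>a\<close> and \<open>c\<close> has the
      limit state there instead, and is the same for all \<open>k\<close>.\<close>
    define R where "R k = (\<integral>x. (negative_ramp m (u k x) *\<^sub>R \<Phi> x) \<bullet> G k x \<partial>lebesgue_on D) - (\<integral>x. f x * (\<phi> x * negative_ramp m (u k x)) \<partial>lebesgue_on D)" for k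
    have La: "L2_on D a" unfolding a_def[abs_def] by (rule mult_L2[OF L\<phi>(2)]) measurable
    have Lak: "L2_on D (\<lambda>x. negative_ramp m (u k x) *\<^sub>R \<Phi> x)" for k by (rule mult_L2[OF L\<phi>(2)]) measurable
    have L\<phi>u: "L2_on D (\<lambda>x. negative_ramp m (u k x) *\<^sub>R \<phi> x)" for k by (rule mult_L2[OF L\<phi>(1)]) measurable
    have L\<phi>u0: "L2_on D (\<lambda>x. negative_ramp m (u0 x) *\<^sub>R \<phi> x)" by (rule mult_L2[OF L\<phi>(1)]) measurable
    have err: "(\<lambda>k. R k - ((\<integral>x. a x \<bullet> G k x \<partial>lebesgue_on D) + c)) \<longlonglongrightarrow> 0"
    proof -
      have eq: "R k - ((\<integral>x. a x \<bullet> G k x \<partial>lebesgue_on D) + c)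
         = (\<integral>x. (negative_ramp m (u k x) *\<^sub>R \<Phi> x - a x) \<bullet> G k x \<partial>lebesgue_on D)
          - ((\<integral>x. f x * (\<phi> x * negative_ramp m (u k x)) \<partial>lebesgue_on D) + c)" for k
        using Bochner_Integration.integral_diff[OF L2_on_inner_integrable[OF Lak Lu(2)] L2_on_inner_integrable[OF La Lu(2)], of k k k]
        by (simp add: R_def inner_diff_left)
      \<comment> \<open>The coefficient of \<open>G k\<close> converges strongly and
        \<open>G k\<close> is bounded by \<open>B\<close>, so the substitution error vanishes
        without strong convergence of the gradients.\<close>
      have 1: "(\<lambda>k. \<integral>x. (negative_ramp m (u k x) *\<^sub>R \<Phi> x - a x) \<bullet> G k x \<partial>lebesgue_on D) \<longlonglongrightarrow> 0"
      proof (rule Lim_null_comparison[OF always_eventually], rule allI)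
        fix k
        have "\<bar>\<integral>x. (negative_ramp m (u k x) *\<^sub>R \<Phi> x - a x) \<bullet> G k x \<partial>lebesgue_on D\<bar>
           \<le> l2 D (\<lambda>x. negative_ramp m (u k x) *\<^sub>R \<Phi> x - a x) * l2 D (G k)"
          by (rule l2_Cauchy_Schwarz[OF L2_on_diff[OF Lak La] Lu(2)])
        also have "\<dots> \<le> l2 D (\<lambda>x. negative_ramp m (u k x) *\<^sub>R \<Phi> x - a x) * B"
          by (intro mult_left_mono uG(2)) simp
        finally show "norm (\<integral>x. (negative_ramp m (u k x) *\<^sub>R \<Phi> x - a x) \<bullet> G k x \<partial>lebesgue_on D)
          \<le> l2 D (\<lambda>x. negative_ramp m (u k x) *\<^sub>R \<Phi> x - a x) * B" by simp
        show "(\<lambda>k. l2 D (\<lambda>x. negative_ramp m (u k x) *\<^sub>R \<Phi> x - a x) * B) \<longlonglongrightarrow> 0"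
          unfolding a_def by (rule tendsto_mult_left_zero[OF conv[OF L\<phi>(2)]])
      qed
      have "(\<lambda>k. \<integral>x. f x * (\<phi> x * negative_ramp m (u k x)) \<partial>lebesgue_on D) \<longlonglongrightarrow> (\<integral>x. f x * (\<phi> x * negative_ramp m (u0 x)) \<partial>lebesgue_on D)"
        using tendsto_inner_L2_left[OF L\<phi>u L\<phi>u0 conv[OF L\<phi>(1)] f] by (simp add: mult_ac)
      then have 2: "(\<lambda>k. (\<integral>x. f x * (\<phi> x * negative_ramp m (u k x)) \<partial>lebesgue_on D) + c) \<longlonglongrightarrow> 0"
        unfolding c_def by (simp add: LIM_zero)
      show ?thesis unfolding eq using tendsto_diff[OF 1 2] by simp
    qed
    have base: "0 \<le> R k \<and> (\<integral>\<^sup>+x. V k x * ennreal (max (- u k x) 0 * \<phi> x * negative_ramp m (u k x)) \<partial>lebesgue_on D) \<le> ennreal (R k)" for k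
      unfolding R_def
      by (rule negative_ramp_inequality[OF V_meas f us _ _ \<phi> m]) (use uG(1)[of k] in \<open>auto simp: state_pair_def\<close>)
    have h_meas: "(\<lambda>x. ennreal (max (- u k x) 0 * \<phi> x * negative_ramp m (u k x))) \<in> borel_measurable (lebesgue_on D)" for k
      by measurable
    have h_lim: "AE x in lebesgue_on D. (\<lambda>k. ennreal (max (- u k x) 0 * \<phi> x * negative_ramp m (u k x)))
        \<longlonglongrightarrow> ennreal (max (- u0 x) 0 * \<phi> x * negative_ramp m (u0 x))"
      using ulim(2) by eventually_elim
        (intro tendsto_ennrealI tendsto_mult tendsto_max tendsto_minus tendsto_const C1_Lipschitz_tendsto(1)[OF C1])
    from limit_inequality[OF h_meas h_lim _ La base err]
    show ?thesis unfolding a_def c_def by simp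
  qed
  define V_opt where "V_opt = (\<lambda>x. if u0 x < 0 then W0 x else \<infinity>)"
  have [measurable]: "V_opt \<in> borel_measurable (lebesgue_on D)"
    using W0(1) L2_on_measurable[OF r1(2)] unfolding V_opt_def by measurable
  have "(\<integral>\<^sup>+x. \<Psi> (V_opt x) \<partial>lebesgue_on D) \<le> (\<integral>\<^sup>+x. \<Psi> (W0 x) \<partial>lebesgue_on D)"
    by (intro nn_integral_mono antimono_Psi) (simp add: V_opt_def)
  then have V_opt: "V_opt \<in> admissible D \<Psi>" using Psi_W0 by (auto simp: admissible_def)
  obtain Gw where Gw: "state_pair f V_opt (resolvent D V_opt f) Gw" using B[OF adm(1)[OF V_opt]] by blast
  have "AE x in lebesgue_on D. resolvent D V_opt f x \<le> u0 x"
  proof (rule resolvent_le_of_limit_inequality[OF f sH0 W0(1) _ test])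
    show "(\<integral>\<^sup>+x. W0 x * ennreal ((u0 x)\<^sup>2) \<partial>lebesgue_on D) < \<infinity>"
      by (rule le_less_trans[OF energy]) simp
    show "state_pair f (\<lambda>x. if u0 x < 0 then W0 x else \<infinity>) (resolvent D V_opt f) Gw"
      by (fold V_opt_def) (rule Gw)
  qed
  then have "(\<integral>x. g x * resolvent D V_opt f x \<partial>lebesgue_on D) \<le> (\<integral>x. g x * u0 x \<partial>lebesgue_on D)"
    using g0 Gw sobolev0_L2(1) by (intro integral_mono_AE L2_on_mult_integrable g r1(2))
      (auto simp: state_pair_def intro: mult_left_mono)
  then have "cost V_opt \<le> \<iota>" using cost_u0 by (simp add: cost_def)
  then show ?thesis
    using V_opt \<iota>_le unfolding cost_def by (meson order_trans)
qed

end

theorem theorem2p4: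
  fixes D :: "(real^'n) set" and \<Psi> :: "ennreal \<Rightarrow> ennreal" and f g :: "real^'n \<Rightarrow> real"
  assumes "open D" and "bounded D"
    and "strict_antimono_on UNIV \<Psi>"
    and "\<exists>p>1. ennreal_convex_on {s. ennreal_powr s p \<in> range \<Psi>} (\<lambda>s. inv \<Psi> (ennreal_powr s p))"
    and "admissible D \<Psi> \<noteq> {}"
    and "L2_on D f" and "L2_on D g" and "AE x in lebesgue_on D. 0 \<le> g x"
  shows "\<exists>V_opt \<in> admissible D \<Psi>. \<forall>V \<in> admissible D \<Psi>.
    (\<integral>x. g x * resolvent D V_opt f x \<partial>lebesgue_on D)
      \<le> (\<integral>x. g x * resolvent D V f x \<partial>lebesgue_on D)"
proof -
  obtain p where "p > 1" "ennreal_convex_on {s. ennreal_powr s p \<in> range \<Psi>} (\<lambda>s. inv \<Psi> (ennreal_powr s p))"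
    using assms(4) by blast
  then interpret potential_problem D \<Psi> p
    using assms(1-3) by unfold_locales
  show ?thesis by (rule optimal_potential_exists[OF assms(5-8)])
qed

end
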